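(* Let $\mathfrak{L}$ be a finite-dimensional semi-simple left Leibniz algebra over a field $\mathbb{F}$ of characteristic zero, and let $M$ be a finite-dimensional $\mathfrak{L}$-bimodule. Then $\mathrm{HL}^n(\mathfrak{L},M)=0$ for every integer $n\ge 2$, and there is a five-term exact sequence $$0\to M_0\to\mathrm{HL}^0(\mathfrak{L},M)\to M_{\mathrm{sym}}^{\mathfrak{L}_{\mathrm{Lie}}}\to\mathrm{Hom}_{\mathfrak{L}}(\mathfrak{L}_{\mathrm{ad},\ell},M_0)\to\mathrm{HL}^1(\mathfrak{L},M)\to 0\,.$$ Moreover, if $M$ is symmetric, then $\mathrm{HL}^n(\mathfrak{L},M)=0$ for every integer $n\ge 1$.
   Context: A left Leibniz algebra over $\mathbb{F}$ is an $\mathbb{F}$-vector space $\mathfrak{L}$ with a bilinear product satisfying $x(yz)=(xy)z+y(xz)$ for all $x,y,z$. Its Leibniz kernel is $\mathrm{Leib}(\mathfrak{L})=\langle x^2\mid x\in\mathfrak{L}\rangle_{\mathbb{F}}$, an ideal, and $\mathfrak{L}_{\mathrm{Lie}}:=\mathfrak{L}/\mathrm{Leib}(\mathfrak{L})$ is a Lie algebra. $\mathfrak{L}$ is semi-simple if $\mathrm{Leib}(\mathfrak{L})$ contains every solvable ideal of $\mathfrak{L}$ (equivalently, $\mathfrak{L}_{\mathrm{Lie}}$ is a semi-simple Lie algebra). A left $\mathfrak{L}$-module is a vector space $M$ with bilinear $(x,m)\mapsto x\cdot m$ such that $(xy)\cdot m=x\cdot(y\cdot m)-y\cdot(x\cdot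 m)$. An $\mathfrak{L}$-bimodule is a left $\mathfrak{L}$-module $M$ with a bilinear right action $(m,x)\mapsto m\cdot x$ such that $(x\cdot m)\cdot y=x\cdot(m\cdot y)-m\cdot(xy)$ and $(m\cdot x)\cdot y=m\cdot(xy)-x\cdot(m\cdot y)$. $M$ is symmetric if $m\cdot x=-x\cdot m$ for all $x,m$, and anti-symmetric if $m\cdot x=0$ for all $x,m$. The anti-symmetric kernel $M_0:=\langle x\cdot m+m\cdot x\mid x\in\mathfrak{L},m\in M\rangle_{\mathbb{F}}$ is an anti-symmetric sub-bimodule, $M_{\mathrm{sym}}:=M/M_0$ is symmetric (hence a module over $\mathfrak{L}_{\mathrm{Lie}}$), and $M_{\mathrm{sym}}^{\mathfrak{L}_{\mathrm{Lie}}}:=\{m\in M_{\mathrm{sym}}\mid x\cdot m=0\ \forall x\in\mathfrak{L}\}$. $\mathfrak{L}_{\mathrm{ad},\ell}$ is $\mathfrak{L}$ as a left $\mathfrak{L}$-module via left multiplication, and $\mathrm{Hom}_{\mathfrak{L}}(\mathfrak{L}_{\mathrm{ad},\ell},M_0)$ is the space of left $\mathfrak{L}$-module homomorphisms. Leibniz cohomology: $\mathrm{CL}^n(\mathfrak{L},M)=\mathrm{Hom}_{\mathbb{F}}(\mathfrak{L}^{\otimes n},M)$ with coboundary $(\mathrm{d}^nf)(x_1,\dots,x_{n+1})=\sum_{i=1}^n(-1)^{i+1}x_i\cdot f(x_1,\dots,\hat{x}_i,\dots,x_{n+1})+(-1)^{n+1}f(x_1,\dots,x_n)\cdot x_{n+1}+\sum_{1\le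 i<j\le n+1}(-1)^if(x_1,\dots,\hat{x}_i,\dots,x_ix_j,\dots,x_{n+1})$, where $x_ix_j$ stands in the $j$-th position; $\mathrm{HL}^n(\mathfrak{L},M)$ is its $n$-th cohomology. *)

theory Defs
  imports Complex_Main
begin

text \<open>Used uniformly for subspaces, spaces of cochains and quotient spaces
(quotients are represented by their cosets).\<close>

record ('f, 'v) vsp =
  vcarrier :: "'v set"
  vadd :: "'v \<Rightarrow> 'v \<Rightarrow> 'v"
  vzero :: "'v"
  vscale :: "'f \<Rightarrow> 'v \<Rightarrow> 'v"

definition lin_map :: "('f, 'v) vsp \<Rightarrow> ('f, 'w) vsp \<Rightarrow> ('v \<Rightarrow> 'w) \<Rightarrow> bool" where
  "lin_map V W f \<longleftrightarrow>
     (\<forall>x\<in>vcarrier V. f x \<in> vcarrier W) \<and>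
     (\<forall>x\<in>vcarrier V. \<forall>y\<in>vcarrier V. f (vadd V x y) = vadd W (f x) (f y)) \<and>
     (\<forall>c. \<forall>x\<in>vcarrier V. f (vscale V c x) = vscale W c (f x))"

definition exact_at :: "('f, 'a) vsp \<Rightarrow> ('f, 'b) vsp \<Rightarrow> ('f, 'c) vsp
    \<Rightarrow> ('a \<Rightarrow> 'b) \<Rightarrow> ('b \<Rightarrow> 'c) \<Rightarrow> bool" where
  "exact_at A B C f g \<longleftrightarrow> f ` vcarrier A = {b \<in> vcarrier B. g b = vzero C}"

definition exact5 :: "('f, 'a) vsp \<Rightarrow> ('f, 'b) vsp \<Rightarrow> ('f, 'c) vsp \<Rightarrow> ('f, 'd) vsp
    \<Rightarrow> ('f, 'e) vsp \<Rightarrow> ('a \<Rightarrow> 'b) \<Rightarrow> ('b \<Rightarrow> 'c) \<Rightarrow> ('c \<Rightarrow> 'd) \<Rightarrow> ('d \<Rightarrow> 'e) \<Rightarrow> bool" where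
  "exact5 A B C D E f1 f2 f3 f4 \<longleftrightarrow>
     lin_map A B f1 \<and> lin_map B C f2 \<and> lin_map C D f3 \<and> lin_map D E f4 \<and>
     {a \<in> vcarrier A. f1 a = vzero B} = {vzero A} \<and>
     exact_at A B C f1 f2 \<and> exact_at B C D f2 f3 \<and> exact_at C D E f3 f4 \<and>
     f4 ` vcarrier D = vcarrier E"

definition trivial_vs :: "('f, 'v) vsp \<Rightarrow> bool" where
  "trivial_vs V \<longleftrightarrow> vcarrier V = {vzero V}"

definition sub_vs :: "('f \<Rightarrow> 'v::ab_group_add \<Rightarrow> 'v) \<Rightarrow> 'v set \<Rightarrow> ('f, 'v) vsp" where
  "sub_vs s U = \<lparr>vcarrier = U, vadd = (+), vzero = 0, vscale = s\<rparr>"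

definition coset :: "('f, 'v) vsp \<Rightarrow> 'v set \<Rightarrow> 'v \<Rightarrow> 'v set" where
  "coset V U v = {vadd V v u | u. u \<in> U}"

definition quot :: "('f, 'v) vsp \<Rightarrow> 'v set \<Rightarrow> ('f, 'v set) vsp" where
  "quot V U = \<lparr>vcarrier = {coset V U v | v. v \<in> vcarrier V},
     vadd = (\<lambda>A B. coset V U (vadd V (SOME a. a \<in> A) (SOME b. b \<in> B))),
     vzero = coset V U (vzero V),
     vscale = (\<lambda>c A. coset V U (vscale V c (SOME a. a \<in> A)))\<rparr>"

definition fin_dim :: "('f::field \<Rightarrow> 'v::ab_group_add \<Rightarrow> 'v) \<Rightarrow> bool" where
  "fin_dim s \<longleftrightarrow> vector_space s \<and> (\<exists>B. finite B \<and> module.span s B = UNIV)"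

definition bilin :: "('f::field \<Rightarrow> 'a::ab_group_add \<Rightarrow> 'a) \<Rightarrow> ('f \<Rightarrow> 'b::ab_group_add \<Rightarrow> 'b)
    \<Rightarrow> ('f \<Rightarrow> 'c::ab_group_add \<Rightarrow> 'c) \<Rightarrow> ('a \<Rightarrow> 'b \<Rightarrow> 'c) \<Rightarrow> bool" where
  "bilin s1 s2 s3 b \<longleftrightarrow> (\<forall>x. Vector_Spaces.linear s2 s3 (b x)) \<and>
                          (\<forall>y. Vector_Spaces.linear s1 s3 (\<lambda>x. b x y))"

definition leibniz_algebra :: "('f::field \<Rightarrow> 'l::ab_group_add \<Rightarrow> 'l) \<Rightarrow> ('l \<Rightarrow> 'l \<Rightarrow> 'l) \<Rightarrow> bool" where
  "leibniz_algebra sL mult \<longleftrightarrow> vector_space sL \<and> bilin sL sL sL mult \<and>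
     (\<forall>x y z. mult x (mult y z) = mult (mult x y) z + mult y (mult x z))"

definition leib_kernel :: "('f::field \<Rightarrow> 'l::ab_group_add \<Rightarrow> 'l) \<Rightarrow> ('l \<Rightarrow> 'l \<Rightarrow> 'l) \<Rightarrow> 'l set" where
  "leib_kernel sL mult = module.span sL {mult x x | x. True}"

definition is_ideal :: "('f::field \<Rightarrow> 'l::ab_group_add \<Rightarrow> 'l) \<Rightarrow> ('l \<Rightarrow> 'l \<Rightarrow> 'l) \<Rightarrow> 'l set \<Rightarrow> bool" where
  "is_ideal sL mult I \<longleftrightarrow> module.subspace sL I \<and>
     (\<forall>x y. y \<in> I \<longrightarrow> mult x y \<in> I \<and> mult y x \<in> I)"

fun derived :: "('f::field \<Rightarrow> 'l::ab_group_add \<Rightarrow> 'l) \<Rightarrow> ('l \<Rightarrow> 'l \<Rightarrow> 'l) \<Rightarrow> 'l set \<Rightarrow> nat \<Rightarrow> 'l set" where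
  "derived sL mult I 0 = I"
| "derived sL mult I (Suc k) =
     module.span sL {mult x y | x y. x \<in> derived sL mult I k \<and> y \<in> derived sL mult I k}"

definition solvable_set :: "('f::field \<Rightarrow> 'l::ab_group_add \<Rightarrow> 'l) \<Rightarrow> ('l \<Rightarrow> 'l \<Rightarrow> 'l) \<Rightarrow> 'l set \<Rightarrow> bool" where
  "solvable_set sL mult I \<longleftrightarrow> (\<exists>k. derived sL mult I k = {0})"

definition semisimple :: "('f::field \<Rightarrow> 'l::ab_group_add \<Rightarrow> 'l) \<Rightarrow> ('l \<Rightarrow> 'l \<Rightarrow> 'l) \<Rightarrow> bool" where
  "semisimple sL mult \<longleftrightarrow>
     (\<forall>I. is_ideal sL mult I \<and> solvable_set sL mult I \<longrightarrow> I \<subseteq> leib_kernel sL mult)"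

definition left_module :: "('f::field \<Rightarrow> 'l::ab_group_add \<Rightarrow> 'l) \<Rightarrow> ('l \<Rightarrow> 'l \<Rightarrow> 'l)
    \<Rightarrow> ('f \<Rightarrow> 'm::ab_group_add \<Rightarrow> 'm) \<Rightarrow> ('l \<Rightarrow> 'm \<Rightarrow> 'm) \<Rightarrow> bool" where
  "left_module sL mult sM la \<longleftrightarrow> bilin sL sM sM la \<and>
     (\<forall>x y m. la (mult x y) m = la x (la y m) - la y (la x m))"

definition bimodule :: "('f::field \<Rightarrow> 'l::ab_group_add \<Rightarrow> 'l) \<Rightarrow> ('l \<Rightarrow> 'l \<Rightarrow> 'l)
    \<Rightarrow> ('f \<Rightarrow> 'm::ab_group_add \<Rightarrow> 'm) \<Rightarrow> ('l \<Rightarrow> 'm \<Rightarrow> 'm) \<Rightarrow> ('m \<Rightarrow> 'l \<Rightarrow> 'm) \<Rightarrow> bool" where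
  "bimodule sL mult sM la ra \<longleftrightarrow> left_module sL mult sM la \<and> bilin sM sL sM ra \<and>
     (\<forall>x m y. ra (la x m) y = la x (ra m y) - ra m (mult x y)) \<and>
     (\<forall>m x y. ra (ra m x) y = ra m (mult x y) - la x (ra m y))"

definition symmetric_bimod :: "('l \<Rightarrow> 'm::ab_group_add \<Rightarrow> 'm) \<Rightarrow> ('m \<Rightarrow> 'l \<Rightarrow> 'm) \<Rightarrow> bool" where
  "symmetric_bimod la ra \<longleftrightarrow> (\<forall>x m. ra m x = - la x m)"

definition M0 :: "('f::field \<Rightarrow> 'm::ab_group_add \<Rightarrow> 'm) \<Rightarrow> ('l \<Rightarrow> 'm \<Rightarrow> 'm) \<Rightarrow> ('m \<Rightarrow> 'l \<Rightarrow> 'm) \<Rightarrow> 'm set" where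
  "M0 sM la ra = module.span sM {la x m + ra m x | x m. True}"

definition M0_vs where
  "M0_vs sM la ra = sub_vs sM (M0 sM la ra)"

text \<open>M_sym = M / M_0, and its invariants under the (induced) left action
  x . (m + M_0) = x . m + M_0.\<close>
definition Msym_vs where
  "Msym_vs sM la ra = quot (sub_vs sM UNIV) (M0 sM la ra)"

definition Msym_inv_vs where
  "Msym_inv_vs sM la ra = (Msym_vs sM la ra)\<lparr>vcarrier :=
     {C \<in> vcarrier (Msym_vs sM la ra).
        \<forall>x. coset (sub_vs sM UNIV) (M0 sM la ra) (la x (SOME m. m \<in> C)) = M0 sM la ra}\<rparr>"

definition HomL_vs where
  "HomL_vs sL mult sM la ra = \<lparr>vcarrier = {\<phi>. Vector_Spaces.linear sL sM \<phi> \<and>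
        (\<forall>x. \<phi> x \<in> M0 sM la ra) \<and> (\<forall>x y. \<phi> (mult x y) = la x (\<phi> y))},
     vadd = (\<lambda>\<phi> \<psi> x. \<phi> x + \<psi> x), vzero = (\<lambda>x. 0), vscale = (\<lambda>c \<phi> x. sM c (\<phi> x))\<rparr>"

text \<open>An n-cochain in CL^n(L,M) = Hom(L^{\<otimes>n}, M) is represented as an n-linear map,
  i.e. a function on lists of length n, linear in each entry, and 0 on lists of other length.\<close>
definition cochains :: "('f::field \<Rightarrow> 'l::ab_group_add \<Rightarrow> 'l) \<Rightarrow> ('f \<Rightarrow> 'm::ab_group_add \<Rightarrow> 'm)
    \<Rightarrow> nat \<Rightarrow> ('l list \<Rightarrow> 'm) set" where
  "cochains sL sM n = {f. (\<forall>xs i. length xs = n \<and> i < n \<longrightarrow>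
        Vector_Spaces.linear sL sM (\<lambda>y. f (xs[i := y]))) \<and>
     (\<forall>xs. length xs \<noteq> n \<longrightarrow> f xs = 0)}"

definition remove_nth :: "nat \<Rightarrow> 'a list \<Rightarrow> 'a list" where
  "remove_nth i xs = take i xs @ drop (Suc i) xs"

definition sgn_pow :: "nat \<Rightarrow> 'm::ab_group_add \<Rightarrow> 'm" where
  "sgn_pow k v = (if even k then v else - v)"

text \<open>Coboundary d^n (0-based indices; sgn_pow k v = (-1)^k v).\<close>
definition cobound :: "('l \<Rightarrow> 'l \<Rightarrow> 'l) \<Rightarrow> ('l \<Rightarrow> 'm::ab_group_add \<Rightarrow> 'm) \<Rightarrow> ('m \<Rightarrow> 'l \<Rightarrow> 'm)
    \<Rightarrow> nat \<Rightarrow> ('l list \<Rightarrow> 'm) \<Rightarrow> ('l list \<Rightarrow> 'm)" where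
  "cobound mult la ra n f = (\<lambda>xs. if length xs = Suc n then
       (\<Sum>i<n. sgn_pow i (la (xs ! i) (f (remove_nth i xs))))
     + sgn_pow (Suc n) (ra (f (take n xs)) (xs ! n))
     + (\<Sum>j\<le>n. \<Sum>i<j. sgn_pow (Suc i) (f (remove_nth i (xs[j := mult (xs ! i) (xs ! j)]))))
     else 0)"

definition cocycles where
  "cocycles sL mult sM la ra n = {f \<in> cochains sL sM n. cobound mult la ra n f = (\<lambda>xs. 0)}"

fun coboundaries where
  "coboundaries sL mult sM la ra 0 = {\<lambda>xs. 0}"
| "coboundaries sL mult sM la ra (Suc n) = cobound mult la ra n ` cochains sL sM n"

definition cocycle_vs where
  "cocycle_vs sL mult sM la ra n = \<lparr>vcarrier = cocycles sL mult sM la ra n,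
     vadd = (\<lambda>f g xs. f xs + g xs), vzero = (\<lambda>xs. 0), vscale = (\<lambda>c f xs. sM c (f xs))\<rparr>"

definition HL where
  "HL sL mult sM la ra n =
     quot (cocycle_vs sL mult sM la ra n) (coboundaries sL mult sM la ra n)"

end

theory Submission
  imports "HOL-Library.Function_Algebras" "HOL-Algebra.Algebraic_Closure_Type" Defs
begin

text \<open>
The insertion operators \<open>i\<^sub>a f = f (a, \<dots>)\<close> and the natural action \<open>\<theta>\<^sub>a\<close> of \<open>L\<close> on cochains satisfy
Cartan's formula \<open>i\<^sub>a d + d i\<^sub>a = \<theta>\<^sub>a\<close> in positive degrees, for every bimodule. So \<open>L\<close> maps cocycles
to coboundaries, and complete reducibility makes any cocycle \<open>f\<close> of positive degree invariant without
changing its class. For invariant \<open>f\<close> of degree at least 2, \<open>i\<^sub>a f\<close> is a cocycle with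
\<open>i\<^bsub>xa\<^esub> f = \<theta>\<^sub>x i\<^sub>a f = d i\<^sub>x i\<^sub>a f\<close>; since \<open>L = LL\<close>, there are \<open>s\<^sub>a\<close> with
\<open>i\<^sub>a f = d s\<^sub>a\<close>. Complete reducibility again allows \<open>s\<close> to be chosen linear and invariant, and then
\<open>f = d (- s)\<close>. In degree 1 an invariant cocycle takes its values in \<open>M\<^sub>0\<close> and is a
homomorphism of left modules, which yields the exact sequence and the symmetric case.

Complete reducibility and \<open>L = LL\<close> follow from Cartan's criterion: if the trace form of a Lie algebra
of operators vanishes, sums of commutators are nilpotent. This is proved over the algebraic closure,
by pairing the eigenvalues of such an operator with additive functionals to the rationals, and descends.
By Engel's theorem the radical of a trace form then lies in the Leibniz kernel. For a module \<open>W\<close> the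
Casimir operator is formed on the Killing complement of the annihilator of \<open>W\<close>; its trace is the number
of basis vectors used, and its Fitting decomposition gives an induction on the dimension of \<open>W\<close>.
\<close>

section \<open>Traces on finite-dimensional subspaces\<close>

text \<open>The quotient of \<open>L\<close> by its Leibniz kernel \<open>K\<close> is never formed.
  Left modules are annihilated by \<open>K\<close>, trace forms vanish on it, and semisimplicity
  makes it the largest solvable ideal, so facts about the Lie quotient are stated in
  \<open>L\<close> modulo \<open>K\<close>. Trace forms are then degenerate and dual bases exist
  only modulo \<open>K\<close>; the error acts as zero. Modules are sets inside a type, because the
  ones that matter are spaces of cochains, carved out of all functions on lists. Their structure is
  the left action \<open>th\<close>, in which the right action does not occur. Complete reducibility
  is used only for \<open>V \<subseteq> W\<close> with \<open>L W \<subseteq> V\<close>, that is for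
  trivial quotients. A Casimir operator then maps \<open>W\<close> into \<open>V\<close>, and only
  its Fitting null part has to be examined. Functionals to the rationals enter Cartan's criterion
  because a sum of rational squares vanishes only trivially, which fails in an algebraically closed
  field.\<close>

text \<open>Abbreviations placed in \<open>vector_space\<close> itself would be inherited by its global interpretations
  such as \<open>real_vector\<close> and clash there.\<close>

locale vspace = vector_space scale
  for scale :: "'a::field \<Rightarrow> 'b::ab_group_add \<Rightarrow> 'b"
begin

abbreviation endo :: "('b \<Rightarrow> 'b) \<Rightarrow> bool" where
  "endo T \<equiv> Vector_Spaces.linear scale scale T"

abbreviation "rep \<equiv> representation"

lemma endoI:
  assumes "\<And>x y. T (x + y) = T x + T y" and "\<And>c x. T (scale c x) = scale c (T x)"
  shows "endo T"
  using assms vector_space_axioms by (simp add: Vector_Spaces.linear_iff)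

lemma endo_add: "endo T \<Longrightarrow> T (x + y) = T x + T y"
  and endo_scale: "endo T \<Longrightarrow> T (scale c x) = scale c (T x)"
  by (simp_all add: Vector_Spaces.linear_iff)

lemma endo_zero: "endo T \<Longrightarrow> T 0 = 0"
  by (metis endo_scale scale_zero_left)

lemma endo_diff: "endo T \<Longrightarrow> T (x - y) = T x - T y"
  by (metis add_diff_cancel diff_add_cancel endo_add)

lemma endo_sum: "endo T \<Longrightarrow> T (sum g A) = (\<Sum>i\<in>A. T (g i))"
  by (induction A rule: infinite_finite_induct) (auto simp: endo_zero endo_add)

lemma endo_comp: "endo S \<Longrightarrow> endo T \<Longrightarrow> endo (\<lambda>v. S (T v))"
  by (intro endoI) (auto simp: endo_add endo_scale)

lemma endo_compow: "endo T \<Longrightarrow> endo (T ^^ n)"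
proof (induction n)
  case 0
  show ?case by (intro endoI) auto
next
  case (Suc n)
  then show ?case by (intro endoI) (auto simp: endo_add endo_scale)
qed

lemma endo_eq_on_span:
  assumes "endo S" "endo T" "\<And>b. b \<in> B \<Longrightarrow> S b = T b" "v \<in> span B"
  shows "S v = T v"
  using assms(4)
  by (induction rule: span_induct_alt)
     (auto simp: endo_zero endo_add endo_scale assms)

lemma compow_in: "(\<And>v. v \<in> W \<Longrightarrow> T v \<in> W) \<Longrightarrow> v \<in> W \<Longrightarrow> (T ^^ n) v \<in> W"
  by (induction n) auto

section \<open>Finite bases of subspaces\<close>

definition fin_basis :: "'b set \<Rightarrow> 'b set \<Rightarrow> bool" where
  "fin_basis B W \<longleftrightarrow> finite B \<and> independent B \<and> span B = W"

lemma fin_basisD: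
  assumes "fin_basis B W"
  shows "finite B" "independent B" "span B = W"
  using assms unfolding fin_basis_def by auto

lemma fin_basis_subspace: "fin_basis B W \<Longrightarrow> subspace W"
  unfolding fin_basis_def by auto

lemma fin_basis_base: "fin_basis B W \<Longrightarrow> b \<in> B \<Longrightarrow> b \<in> W"
  unfolding fin_basis_def using span_base by auto

lemma fin_basis_exists:
  assumes "subspace K" "K \<subseteq> span G" "finite G"
  shows "\<exists>B. fin_basis B K"
proof -
  obtain B where B: "B \<subseteq> K" "independent B" "K \<subseteq> span B"
    using maximal_independent_subset by blast
  have "finite B" using independent_span_bound[OF assms(3) B(2)] B(1) assms(2) by auto
  moreover have "span B = K" using B assms(1) by (simp add: span_subspace)
  ultimately show ?thesis using B(2) unfolding fin_basis_def by blast
qed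

lemma fin_basis_psubset:
  assumes "fin_basis B W" "subspace K" "K \<subset> W"
  shows "\<exists>B'. fin_basis B' K \<and> card B' < card B"
proof -
  have B: "finite B" "span B = W" using assms(1) unfolding fin_basis_def by auto
  obtain B' where B': "fin_basis B' K"
    using fin_basis_exists[OF assms(2), of B] assms(3) B by auto
  obtain w where w: "w \<in> W" "w \<notin> K" using assms(3) by auto
  have wB': "w \<notin> span B'" "w \<notin> B'"
    using w B' fin_basis_base unfolding fin_basis_def by auto
  have "independent (insert w B')"
    using B' wB' independent_insertI[of w B'] unfolding fin_basis_def by auto
  moreover have "insert w B' \<subseteq> span B"
    using w B B' assms(3) fin_basis_base by auto
  ultimately have "card (insert w B') \<le> card B"
    using independent_span_bound[OF B(1)] by auto
  then show ?thesis using B' wB' unfolding fin_basis_def by auto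
qed

section \<open>Coordinates and traces\<close>

definition trc :: "'b set \<Rightarrow> ('b \<Rightarrow> 'b) \<Rightarrow> 'a" where
  "trc B T = (\<Sum>b\<in>B. rep B (T b) b)"

lemma rep_sum:
  assumes "fin_basis B W" "v \<in> W"
  shows "(\<Sum>b\<in>B. scale (rep B v b) b) = v"
  using assms sum_representation_eq[of B v B] unfolding fin_basis_def by auto

lemma rep_add: "fin_basis B W \<Longrightarrow> v \<in> W \<Longrightarrow> w \<in> W \<Longrightarrow>
    rep B (v + w) c = rep B v c + rep B w c"
  using representation_add[of B w v] unfolding fin_basis_def by (auto simp: fun_eq_iff)

lemma rep_diff: "fin_basis B W \<Longrightarrow> v \<in> W \<Longrightarrow> w \<in> W \<Longrightarrow>
    rep B (v - w) c = rep B v c - rep B w c"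
  using representation_diff[of B w v] unfolding fin_basis_def by (auto simp: fun_eq_iff)

lemma rep_scale: "fin_basis B W \<Longrightarrow> v \<in> W \<Longrightarrow>
    rep B (scale k v) c = k * rep B v c"
  using representation_scale[of B v k] unfolding fin_basis_def by (auto simp: fun_eq_iff)

lemma rep_sum_distrib: "fin_basis B W \<Longrightarrow> (\<And>i. i \<in> I \<Longrightarrow> v i \<in> W) \<Longrightarrow>
    rep B (\<Sum>i\<in>I. v i) c = (\<Sum>i\<in>I. rep B (v i) c)"
proof (induction I rule: infinite_finite_induct)
  case (insert x F)
  then show ?case
    by (auto simp: rep_add subspace_sum[OF fin_basis_subspace])
qed (auto simp: representation_zero)

lemma endo_rep:
  assumes "fin_basis B W" "endo T" "v \<in> W"
  shows "T v = (\<Sum>b\<in>B. scale (rep B v b) (T b))"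
  using endo_sum[OF assms(2), of "\<lambda>b. scale (rep B v b) b" B]
    rep_sum[OF assms(1,3)] endo_scale[OF assms(2)] by simp

text \<open>Both traces equal one double sum over \<open>B\<close> and \<open>B'\<close>, obtained
  by expanding the vectors of each basis in the other.\<close>

lemma trc_indep:
  assumes B: "fin_basis B W" and B': "fin_basis B' W" and T: "endo T" "\<And>v. v \<in> W \<Longrightarrow> T v \<in> W"
  shows "trc B T = trc B' T"
proof -
  note bs = fin_basis_base[OF B] fin_basis_base[OF B']
  have "trc B T = (\<Sum>b\<in>B. \<Sum>c\<in>B'. rep B' b c * rep B (T c) b)"
    unfolding trc_def
  proof (intro sum.cong refl)
    fix b assume b: "b \<in> B"
    have "rep B (T b) b
        = rep B (\<Sum>c\<in>B'. scale (rep B' b c) (T c)) b"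
      using endo_rep[OF B' T(1), of b] b bs by simp
    also have "\<dots> = (\<Sum>c\<in>B'. rep B (scale (rep B' b c) (T c)) b)"
      using bs T fin_basis_subspace[OF B] by (intro rep_sum_distrib[OF B]) (auto intro: subspace_scale)
    finally show "rep B (T b) b = (\<Sum>c\<in>B'. rep B' b c * rep B (T c) b)"
      using bs T rep_scale[OF B] by simp
  qed
  also have "\<dots> = (\<Sum>c\<in>B'. \<Sum>b\<in>B. rep B (T c) b * rep B' b c)"
    by (subst sum.swap) (simp add: mult.commute)
  also have "\<dots> = (\<Sum>c\<in>B'. rep B' (\<Sum>b\<in>B. scale (rep B (T c) b) b) c)"
  proof (intro sum.cong refl)
    fix c assume "c \<in> B'"
    show "(\<Sum>b\<in>B. rep B (T c) b * rep B' b c) =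
       rep B' (\<Sum>b\<in>B. scale (rep B (T c) b) b) c"
      using bs fin_basis_subspace[OF B]
      by (subst rep_sum_distrib[OF B']) (auto intro!: subspace_scale sum.cong simp: rep_scale[OF B'])
  qed
  also have "\<dots> = trc B' T"
    unfolding trc_def using bs T by (intro sum.cong refl) (simp add: rep_sum[OF B])
  finally show ?thesis .
qed

lemma trc_cong: "(\<And>b. b \<in> B \<Longrightarrow> S b = T b) \<Longrightarrow> trc B S = trc B T"
  unfolding trc_def by auto

lemma trc_add:
  assumes "fin_basis B W" "\<And>v. v \<in> W \<Longrightarrow> S v \<in> W" "\<And>v. v \<in> W \<Longrightarrow> T v \<in> W"
  shows "trc B (\<lambda>v. S v + T v) = trc B S + trc B T"
  unfolding trc_def using assms fin_basis_base[OF assms(1)]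
  by (auto simp: rep_add[OF assms(1)] sum.distrib)

lemma trc_diff:
  assumes "fin_basis B W" "\<And>v. v \<in> W \<Longrightarrow> S v \<in> W" "\<And>v. v \<in> W \<Longrightarrow> T v \<in> W"
  shows "trc B (\<lambda>v. S v - T v) = trc B S - trc B T"
  unfolding trc_def using assms fin_basis_base[OF assms(1)]
  by (auto simp: rep_diff[OF assms(1)] sum_subtractf)

lemma trc_scale:
  assumes "fin_basis B W" "\<And>v. v \<in> W \<Longrightarrow> T v \<in> W"
  shows "trc B (\<lambda>v. scale c (T v)) = c * trc B T"
  unfolding trc_def using assms fin_basis_base[OF assms(1)]
  by (auto simp: rep_scale[OF assms(1)] sum_distrib_left)

lemma trc_sum:
  assumes "fin_basis B W" "\<And>i v. i \<in> I \<Longrightarrow> v \<in> W \<Longrightarrow> T i v \<in> W"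
  shows "trc B (\<lambda>v. \<Sum>i\<in>I. T i v) = (\<Sum>i\<in>I. trc B (T i))"
proof -
  have "trc B (\<lambda>v. \<Sum>i\<in>I. T i v) = (\<Sum>b\<in>B. \<Sum>i\<in>I. rep B (T i b) b)"
    unfolding trc_def using assms fin_basis_base[OF assms(1)]
    by (intro sum.cong refl rep_sum_distrib[OF assms(1)]) auto
  then show ?thesis unfolding trc_def by (subst sum.swap) simp
qed

lemma rep_comp:
  assumes B: "fin_basis B W" and S: "endo S" "\<And>v. v \<in> W \<Longrightarrow> S v \<in> W" and v: "v \<in> W"
  shows "rep B (S v) c = (\<Sum>d\<in>B. rep B v d * rep B (S d) c)"
  using fin_basis_base[OF B] S v fin_basis_subspace[OF B]
  by (subst endo_rep[OF B S(1) v], subst rep_sum_distrib[OF B])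
     (auto intro!: subspace_scale sum.cong simp: rep_scale[OF B])

lemma trc_commute:
  assumes B: "fin_basis B W" and S: "endo S" "\<And>v. v \<in> W \<Longrightarrow> S v \<in> W"
    and T: "endo T" "\<And>v. v \<in> W \<Longrightarrow> T v \<in> W"
  shows "trc B (\<lambda>v. S (T v)) = trc B (\<lambda>v. T (S v))"
proof -
  have "trc B (\<lambda>v. S (T v)) = (\<Sum>b\<in>B. \<Sum>d\<in>B. rep B (T b) d * rep B (S d) b)"
    unfolding trc_def using fin_basis_base[OF B] T by (intro sum.cong refl rep_comp[OF B S]) auto
  also have "\<dots> = (\<Sum>b\<in>B. \<Sum>d\<in>B. rep B (S b) d * rep B (T d) b)"
    by (subst sum.swap) (simp add: mult.commute)
  also have "\<dots> = trc B (\<lambda>v. T (S v))"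
    unfolding trc_def using fin_basis_base[OF B] S by (intro sum.cong refl rep_comp[OF B T, symmetric]) auto
  finally show ?thesis .
qed

text \<open>Extend \<open>B'\<close> to a basis \<open>C\<close> of \<open>W\<close>. As
  \<open>T\<close> maps \<open>W\<close> into \<open>W'\<close>, coordinates of its values at
  \<open>C - B'\<close> vanish, so only the terms of \<open>B'\<close> survive.\<close>

lemma trc_image:
  assumes B: "fin_basis B W" and B': "fin_basis B' W'" and T: "endo T" "\<And>v. v \<in> W \<Longrightarrow> T v \<in> W'"
    and sub: "W' \<subseteq> W"
  shows "trc B T = trc B' T"
proof -
  have ind': "independent B'" "finite B'" and sp': "span B' = W'"
    using B' unfolding fin_basis_def by auto
  have B'W: "B' \<subseteq> W" using fin_basis_base[OF B'] sub by auto
  obtain C where C: "B' \<subseteq> C" "C \<subseteq> W" "independent C" "W \<subseteq> span C"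
    using maximal_independent_subset_extend[OF B'W ind'(1)] by blast
  have "finite C" using independent_span_bound[of B C] C B unfolding fin_basis_def by auto
  then have FC: "fin_basis C W"
    using C fin_basis_subspace[OF B] unfolding fin_basis_def by (simp add: span_subspace)
  have eq: "rep C (T v) c = rep B' (T v) c" if "v \<in> W" for v c
    using representation_extend[OF C(3), of "T v" B'] T(2)[OF that] sp' C(1) by simp
  have "trc B T = trc C T"
    by (rule trc_indep[OF B FC T(1)]) (use T sub in auto)
  also have "\<dots> = (\<Sum>b\<in>C. rep B' (T b) b)"
    unfolding trc_def using eq C by (intro sum.cong) auto
  also have "\<dots> = (\<Sum>b\<in>B'. rep B' (T b) b)"
    using \<open>finite C\<close> C(1) representation_ne_zero[of B'] by (intro sum.mono_neutral_right) blast+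
  finally show ?thesis unfolding trc_def .
qed

text \<open>Restricting to the image of \<open>W\<close> under \<open>T\<close> keeps the trace and
  lowers the nilpotency exponent.\<close>

lemma trc_nilpotent:
  assumes "fin_basis B W" "endo T" "\<And>v. v \<in> W \<Longrightarrow> T v \<in> W" "\<And>v. v \<in> W \<Longrightarrow> (T ^^ N) v = 0"
  shows "trc B T = 0"
  using assms
proof (induction N arbitrary: B W)
  case 0
  then have "T b = 0" if "b \<in> B" for b
    using that fin_basis_base[OF 0(1)] by force
  then show ?case
    unfolding trc_def by (simp add: representation_zero)
next
  case (Suc N)
  define W' where "W' = T ` W"
  have "subspace W'"
    unfolding W'_def
    using module_hom.subspace_image[of scale scale T W] Suc.prems(1,2) fin_basis_subspace
    by (auto simp: linear_iff_module_hom)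
  moreover have sub: "W' \<subseteq> W" unfolding W'_def using Suc.prems by auto
  ultimately obtain B' where B': "fin_basis B' W'"
    using fin_basis_exists[of W' B] Suc.prems(1) unfolding fin_basis_def by auto
  have "trc B T = trc B' T"
    by (rule trc_image[OF Suc.prems(1) B' Suc.prems(2) _ sub]) (simp add: W'_def)
  also have "\<dots> = 0"
  proof (rule Suc.IH[OF B' Suc.prems(2)])
    show "T v \<in> W'" if "v \<in> W'" for v using that sub unfolding W'_def by auto
    show "(T ^^ N) v = 0" if "v \<in> W'" for v
      using that Suc.prems(4) unfolding W'_def by (auto simp: funpow_swap1)
  qed
  finally show ?case .
qed

end

text \<open>Applied to operators, this makes \<open>ad x\<close> an endomorphism with its own
  generalised eigenspaces; applied to functions on lists, it provides the vector space containing
  the cochains.\<close>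

lemma vspace_fun:
  assumes "vspace s"
  shows "vspace (\<lambda>c (f :: 'x \<Rightarrow> 'v::ab_group_add) x. s c (f x))"
proof -
  interpret vspace s by fact
  show ?thesis
    by unfold_locales (auto simp: fun_eq_iff scale_right_distrib scale_left_distrib)
qed

section \<open>Generalised eigenspaces\<close>

lemma funpow_commute:
  assumes "\<And>v. f (g v) = g (f v)"
  shows "(f ^^ k) (g v) = g ((f ^^ k) v)"
  by (induction k) (auto simp: assms)

lemma funpow_commute2:
  assumes "\<And>v. f (g v) = g (f v)"
  shows "(f ^^ k) ((g ^^ j) v) = (g ^^ j) ((f ^^ k) v)"
  by (metis assms funpow_commute)

context vspace
begin

definition shift :: "('b \<Rightarrow> 'b) \<Rightarrow> 'a \<Rightarrow> 'b \<Rightarrow> 'b" where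
  "shift T \<mu> = (\<lambda>v. T v - scale \<mu> v)"

lemma endo_shift: "endo T \<Longrightarrow> endo (shift T \<mu>)"
  by (intro endoI) (auto simp: shift_def endo_add endo_scale algebra_simps scale_right_distrib scale_right_diff_distrib)

lemma shift_commute: "endo T \<Longrightarrow> shift T \<mu> (shift T \<nu> v) = shift T \<nu> (shift T \<mu> v)"
  by (simp add: shift_def endo_diff endo_scale algebra_simps scale_right_distrib scale_right_diff_distrib)

lemma shift_in: "subspace B \<Longrightarrow> (\<And>v. v \<in> B \<Longrightarrow> T v \<in> B) \<Longrightarrow> v \<in> B \<Longrightarrow> shift T \<mu> v \<in> B"
  by (simp add: shift_def subspace_diff subspace_scale)

lemma shift_pow_in:
  "subspace B \<Longrightarrow> (\<And>v. v \<in> B \<Longrightarrow> T v \<in> B) \<Longrightarrow> v \<in> B \<Longrightarrow> (shift T \<mu> ^^ k) v \<in> B"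
  by (rule compow_in) (auto intro: shift_in)

text \<open>The difference \<open>shift T \<nu> c - shift T \<mu> c\<close> is the nonzero multiple
  \<open>(\<mu> - \<nu>) c\<close>. Induction on \<open>K\<close> puts
  \<open>shift T \<mu> c\<close> into \<open>B\<close>, hence also \<open>c\<close>.\<close>

lemma shift_peel:
  assumes "endo T" "subspace B" "\<And>v. v \<in> B \<Longrightarrow> T v \<in> B" "\<mu> \<noteq> \<nu>"
    and "(shift T \<mu> ^^ K) c \<in> B" "shift T \<nu> c \<in> B"
  shows "c \<in> B"
  using assms(5,6)
proof (induction K arbitrary: c)
  case (Suc K)
  have "shift T \<nu> (shift T \<mu> c) \<in> B"
    using shift_in[where \<mu>=\<mu>, OF assms(2,3) Suc.prems(2)] by (simp add: shift_commute[OF assms(1)])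
  then have c': "shift T \<mu> c \<in> B"
    using Suc.IH[of "shift T \<mu> c"] Suc.prems(1) by (simp add: funpow_swap1)
  have "scale (\<mu> - \<nu>) c = shift T \<nu> c - shift T \<mu> c"
    by (simp add: shift_def scale_left_diff_distrib)
  then have "scale (\<mu> - \<nu>) c \<in> B" using c' Suc.prems(2) by (simp add: subspace_diff[OF assms(2)])
  then have "scale (inverse (\<mu> - \<nu>)) (scale (\<mu> - \<nu>) c) \<in> B" by (rule subspace_scale[OF assms(2)])
  then show ?case using assms(4) by simp
qed auto

lemma shift_peel_pow:
  assumes "endo T" "subspace B" "\<And>v. v \<in> B \<Longrightarrow> T v \<in> B" "\<mu> \<noteq> \<nu>"
    and "(shift T \<mu> ^^ K) c \<in> B" "(shift T \<nu> ^^ k) c \<in> B"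
  shows "c \<in> B"
  using assms(5,6)
proof (induction k arbitrary: c)
  case (Suc k)
  have "(shift T \<mu> ^^ K) (shift T \<nu> c) \<in> B"
    using shift_in[where \<mu>=\<nu>, OF assms(2,3) Suc.prems(1)]
    by (simp add: funpow_commute shift_commute[OF assms(1)])
  then have "shift T \<nu> c \<in> B"
    using Suc.IH[of "shift T \<nu> c"] Suc.prems(2) by (simp add: funpow_swap1)
  then show ?case using shift_peel[OF assms(1-4) Suc.prems(1)] by blast
qed auto

text \<open>A stable subspace contains the primary components of its elements, where being primary
  is asked only modulo \<open>B\<close>. The power of one shift removes its own component modulo
  \<open>B\<close>, induction treats the others, and peeling undoes that power. In Cartan's
  criterion this takes the place of the polynomial in \<open>ad x\<close> that yields the semisimple
  part.\<close>

lemma eigen_sum_in: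
  assumes T: "endo T" "subspace B" "\<And>v. v \<in> B \<Longrightarrow> T v \<in> B" and "finite S"
    and "\<And>\<mu>. \<mu> \<in> S \<Longrightarrow> (shift T \<mu> ^^ K \<mu>) (c \<mu>) \<in> B" "(\<Sum>\<mu>\<in>S. c \<mu>) \<in> B" "\<mu> \<in> S"
  shows "c \<mu> \<in> B"
  using assms(4-)
proof (induction S arbitrary: c \<mu>)
  case (insert \<nu> S)
  let ?P = "shift T \<nu> ^^ K \<nu>"
  have P: "endo ?P" by (intro endo_compow endo_shift T)
  have PB: "?P v \<in> B" if "v \<in> B" for v by (rule shift_pow_in[OF T(2,3) that])
  have S: "c \<eta> \<in> B" if "\<eta> \<in> S" for \<eta>
  proof -
    have "?P (c \<eta>) \<in> B"
    proof (rule insert.IH[of "\<lambda>\<mu>. ?P (c \<mu>)", OF _ _ that])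
      fix \<mu> assume "\<mu> \<in> S"
      then have "?P ((shift T \<mu> ^^ K \<mu>) (c \<mu>)) \<in> B" by (intro PB insert.prems) auto
      then show "(shift T \<mu> ^^ K \<mu>) (?P (c \<mu>)) \<in> B"
        by (simp add: funpow_commute2 shift_commute[OF T(1)])
    next
      have "?P (\<Sum>\<mu>\<in>insert \<nu> S. c \<mu>) - ?P (c \<nu>) \<in> B"
        using insert.prems(1)[of \<nu>] insert.prems(2) by (intro subspace_diff[OF T(2)] PB[of "sum c _"]) auto
      then show "(\<Sum>\<mu>\<in>S. ?P (c \<mu>)) \<in> B"
        using insert.hyps by (simp add: endo_add[OF P] endo_sum[OF P])
    qed
    moreover have "\<eta> \<noteq> \<nu>" using that insert.hyps by auto
    ultimately show ?thesis
      using shift_peel_pow[of T B \<eta> \<nu> "K \<eta>" "c \<eta>" "K \<nu>"] T insert.prems(1)[of \<eta>] that by auto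
  qed
  have "(\<Sum>\<mu>\<in>insert \<nu> S. c \<mu>) - (\<Sum>\<mu>\<in>S. c \<mu>) \<in> B"
    using S by (intro subspace_diff[OF T(2)] insert.prems subspace_sum[OF T(2)])
  then have "c \<nu> \<in> B" using insert.hyps by simp
  then show ?case using S insert.prems by auto
qed auto

lemma endo_extend:
  assumes "independent B"
  shows "\<exists>g. endo g \<and> (\<forall>b\<in>B. g b = h b)"
proof -
  interpret vector_space_pair scale scale by unfold_locales
  show ?thesis using linear_independent_extend[OF assms, of h] by auto
qed

section \<open>Polynomials in an operator\<close>

definition peval :: "('b \<Rightarrow> 'b) \<Rightarrow> 'a poly \<Rightarrow> 'b \<Rightarrow> 'b" where
  "peval x p v = (\<Sum>i\<le>degree p. scale (coeff p i) ((x ^^ i) v))"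

lemma peval_bound:
  assumes "degree p \<le> n"
  shows "peval x p v = (\<Sum>i\<le>n. scale (coeff p i) ((x ^^ i) v))"
  unfolding peval_def using assms by (intro sum.mono_neutral_left) (auto simp: coeff_eq_0)

text \<open>\<open>pCons (- a) (pCons 1 0)\<close> is the polynomial \<open>X - a\<close>; the
  identity allows roots to be split off one at a time.\<close>

lemma peval_linear_factor:
  assumes "endo x"
  shows "peval x (pCons (- a) (pCons 1 0) * q) v = shift x a (peval x q v)"
proof -
  let ?n = "degree q"
  have c: "coeff (pCons (- a) (pCons 1 0) * q) i = (case i of 0 \<Rightarrow> 0 | Suc j \<Rightarrow> coeff q j) - a * coeff q i" for i
    by (auto split: nat.split simp: coeff_pCons)
  have "degree (pCons (- a) (pCons 1 0) * q) \<le> Suc ?n"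
    using degree_mult_le[of "pCons (- a) (pCons 1 0)" q] by simp
  then have "peval x (pCons (- a) (pCons 1 0) * q) v =
      (\<Sum>i\<le>Suc ?n. scale (case i of 0 \<Rightarrow> 0 | Suc j \<Rightarrow> coeff q j) ((x ^^ i) v) - scale (a * coeff q i) ((x ^^ i) v))"
    by (subst peval_bound) (auto simp only: c scale_left_diff_distrib intro!: sum.cong)
  also have "\<dots> = (\<Sum>i\<le>?n. scale (coeff q i) ((x ^^ Suc i) v)) - (\<Sum>i\<le>Suc ?n. scale (a * coeff q i) ((x ^^ i) v))"
    by (subst sum_subtractf, subst sum.atMost_Suc_shift) simp
  also have "(\<Sum>i\<le>?n. scale (coeff q i) ((x ^^ Suc i) v)) = x (peval x q v)"
    by (simp add: peval_def endo_sum[OF assms] endo_scale[OF assms])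
  also have "(\<Sum>i\<le>Suc ?n. scale (a * coeff q i) ((x ^^ i) v)) = scale a (peval x q v)"
    by (simp add: peval_bound[of q "Suc ?n"] scale_sum_right coeff_eq_0)
  finally show ?thesis by (simp add: shift_def)
qed

lemma annihilating_poly:
  assumes x: "\<And>v. v \<in> U \<Longrightarrow> x v \<in> U" and B: "fin_basis B U" and w: "w \<in> U"
  shows "\<exists>p. p \<noteq> 0 \<and> peval x p w = 0"
proof -
  let ?n = "card B"
  let ?g = "\<lambda>i. (x ^^ i) w"
  have "\<exists>c. (\<exists>k\<le>?n. c k \<noteq> 0) \<and> (\<Sum>i\<le>?n. scale (c i) (?g i)) = 0"
  proof (cases "inj_on ?g {..?n}")
    case True
    have "?g ` {..?n} \<subseteq> span B" using compow_in[OF x w] B unfolding fin_basis_def by auto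
    then have "dependent (?g ` {..?n})"
      using independent_span_bound[of B "?g ` {..?n}"] B card_image[OF True] unfolding fin_basis_def by auto
    then obtain u where u: "\<exists>v\<in>?g ` {..?n}. u v \<noteq> 0" "(\<Sum>v\<in>?g ` {..?n}. scale (u v) v) = 0"
      using dependent_finite[of "?g ` {..?n}"] by auto
    have "(\<Sum>i\<le>?n. scale (u (?g i)) (?g i)) = 0"
      using u(2) sum.reindex[OF True, of "\<lambda>v. scale (u v) v"] by simp
    then show ?thesis using u(1) by (intro exI[of _ "\<lambda>i. u (?g i)"]) auto
  next
    case False
    then obtain i j where ij: "i \<le> ?n" "j \<le> ?n" "i \<noteq> j" "?g i = ?g j"
      unfolding inj_on_def by auto
    \<comment> \<open>Two equal powers are annihilated by the difference of the monomials of degrees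
      \<open>i\<close> and \<open>j\<close>.\<close>
    let ?c = "\<lambda>k. (if k = i then 1 else 0) - (if k = j then 1 else (0::'a))"
    have "(\<Sum>k\<le>?n. scale (?c k) (?g k))
        = (\<Sum>k\<le>?n. if k = i then ?g k else 0) - (\<Sum>k\<le>?n. if k = j then ?g k else 0)"
      unfolding sum_subtractf[symmetric] by (intro sum.cong) (auto simp: scale_left_diff_distrib)
    also have "\<dots> = 0" using ij by simp
    finally show ?thesis using ij by (intro exI[of _ ?c]) auto
  qed
  then obtain c k where c: "k \<le> ?n" "c k \<noteq> 0" "(\<Sum>i\<le>?n. scale (c i) (?g i)) = 0" by auto
  define p where "p = (\<Sum>i\<le>?n. monom (c i) i)"
  have cp: "coeff p i = (if i \<le> ?n then c i else 0)" for i
    unfolding p_def coeff_sum coeff_monom by simp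
  have "degree p \<le> ?n" by (rule degree_le) (simp add: cp)
  then have "peval x p w = 0" using c(3) by (simp add: peval_bound cp)
  moreover have "p \<noteq> 0" using cp[of k] c by auto
  ultimately show ?thesis by blast
qed

end

locale vspace_ac = vspace scale
  for scale :: "'a::{alg_closed_field, field_char_0} \<Rightarrow> 'b::ab_group_add \<Rightarrow> 'b"
begin

text \<open>Split a root off the polynomial, \<open>p = (X - a) q\<close>. Either \<open>q\<close>
  still sends \<open>w\<close> into \<open>Y\<close> and has smaller degree, or
  \<open>peval x q w\<close> is the desired eigenvector modulo \<open>Y\<close>.\<close>

lemma eigenvector_mod:
  assumes x: "endo x" "\<And>v. v \<in> U \<Longrightarrow> x v \<in> U" and U: "subspace U" and Y: "subspace Y"
    and w: "w \<in> U" "w \<notin> Y" and p: "p \<noteq> 0" "peval x p w \<in> Y"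
  shows "\<exists>a u. u \<in> U \<and> u \<notin> Y \<and> shift x a u \<in> Y"
  using p
proof (induction "degree p" arbitrary: p rule: less_induct)
  case less
  show ?case
  proof (cases "degree p = 0")
    case True
    then have "coeff p 0 \<noteq> 0" using less.prems(1) leading_coeff_0_iff by metis
    moreover have "scale (coeff p 0) w \<in> Y" using less.prems(2) True by (simp add: peval_def)
    then have "scale (inverse (coeff p 0)) (scale (coeff p 0) w) \<in> Y" by (rule subspace_scale[OF Y])
    ultimately show ?thesis using w by simp
  next
    case False
    then obtain a where "poly p a = 0" using alg_closed_imp_poly_has_root[of p] by auto
    then obtain q where q: "p = pCons (- a) (pCons 1 0) * q" by (auto simp: poly_eq_0_iff_dvd)
    have "q \<noteq> 0" using less.prems q by auto
    then have "degree q < degree p" unfolding q by (subst degree_mult_eq) auto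
    show ?thesis
    proof (cases "peval x q w \<in> Y")
      case True
      then show ?thesis using less.hyps[OF \<open>degree q < degree p\<close> \<open>q \<noteq> 0\<close>] by auto
    next
      case False
      have "peval x q w \<in> U" unfolding peval_def
        using compow_in[OF x(2) w(1)] by (intro subspace_sum[OF U] subspace_scale[OF U]) auto
      then show ?thesis using False less.prems(2) unfolding q peval_linear_factor[OF x(1)] by blast
    qed
  qed
qed

text \<open>\<open>shift x a\<close> and \<open>shift x b\<close> differ by the nonzero scalar
  \<open>b - a\<close>. Up to this factor \<open>u\<close> is its own preimage with error
  \<open>shift x b u\<close>, which is killed by a smaller power and lifted by induction.\<close>

lemma shift_surj:
  assumes x: "endo x" and "a \<noteq> b" "(shift x b ^^ k) u = 0" and U: "subspace U" "\<And>v. v \<in> U \<Longrightarrow> x v \<in> U" "u \<in> U"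
  shows "\<exists>z. z \<in> U \<and> (shift x b ^^ k) z = 0 \<and> shift x a z = u"
  using assms(3,6)
proof (induction k arbitrary: u)
  case 0
  then show ?case by (intro exI[of _ 0]) (auto simp: endo_zero[OF endo_shift[OF x]] subspace_0 U)
next
  case (Suc k)
  have "(shift x b ^^ k) (shift x b u) = 0" using Suc.prems by (simp add: funpow_swap1)
  from Suc.IH[OF this shift_in[OF U(1,2) Suc.prems(2)]] obtain z where
    z: "z \<in> U" "(shift x b ^^ k) z = 0" "shift x a z = shift x b u" by auto
  let ?z = "scale (inverse (b - a)) (u - z)"
  have E: "endo (shift x b ^^ Suc k)" by (intro endo_compow endo_shift x)
  have "(shift x b ^^ Suc k) z = 0" using z(2) by (simp add: endo_zero[OF endo_shift[OF x]])
  then have "(shift x b ^^ Suc k) ?z = 0"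
    using Suc.prems by (simp only: endo_scale[OF E] endo_diff[OF E]) simp
  moreover have "shift x a ?z = scale (inverse (b - a)) (shift x a u - shift x b u)"
    using z by (simp add: endo_scale[OF endo_shift[OF x]] endo_diff[OF endo_shift[OF x]])
  then have "shift x a ?z = u" using \<open>a \<noteq> b\<close>
    by (simp add: shift_def flip: scale_left_diff_distrib)
  moreover have "?z \<in> U" using z Suc.prems by (intro subspace_scale subspace_diff U) auto
  ultimately show ?case by blast
qed

text \<open>Let \<open>Y\<close> be the sum of the generalised eigenspaces \<open>G a\<close>. Were
  \<open>Y\<close> proper, some \<open>u\<close> outside \<open>Y\<close> would have
  \<open>shift x a u\<close> in \<open>Y\<close>. Since \<open>shift x a\<close> is onto on every
  \<open>G b\<close> with \<open>b\<close> different from \<open>a\<close>, one can write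
  \<open>shift x a u = shift x a y + g\<close> with \<open>g\<close> in \<open>G a\<close>. Then
  \<open>u - y\<close> lies in \<open>G a\<close>, and \<open>u\<close> in \<open>Y\<close> after
  all.\<close>

lemma gen_eig_basis:
  assumes x: "endo x" and U: "\<And>v. v \<in> U \<Longrightarrow> x v \<in> U" and B0: "fin_basis B0 U"
  shows "\<exists>B ev N. fin_basis B U \<and> (\<forall>b\<in>B. (shift x (ev b) ^^ N) b = 0)"
proof -
  note sU = fin_basis_subspace[OF B0]
  define G where "G a = {v\<in>U. \<exists>k. (shift x a ^^ k) v = 0}" for a
  have pow_ge: "(shift x a ^^ m) v = 0" if "(shift x a ^^ k) v = 0" "k \<le> m" for a k m v
    using that endo_zero[OF endo_compow[OF endo_shift[OF x]]]
    by (metis comp_apply funpow_add le_add_diff_inverse2)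
  have sG: "subspace (G a)" for a
  proof (rule subspaceI)
    show "0 \<in> G a" unfolding G_def using subspace_0[OF sU] by (auto intro: exI[of _ 0])
    show "u + v \<in> G a" if uv: "u \<in> G a" "v \<in> G a" for u v
    proof -
      obtain k l where "(shift x a ^^ k) u = 0" "(shift x a ^^ l) v = 0" using uv unfolding G_def by auto
      then have "(shift x a ^^ (k + l)) (u + v) = 0"
        using pow_ge[of k a u "k+l"] pow_ge[of l a v "k+l"] endo_add[OF endo_compow[OF endo_shift[OF x]]]
        by simp
      then show ?thesis using uv subspace_add[OF sU] unfolding G_def by blast
    qed
    show "scale c u \<in> G a" if "u \<in> G a" for c u
      using that subspace_scale[OF sU] endo_scale[OF endo_compow[OF endo_shift[OF x]]] unfolding G_def by auto
  qed
  define Y where "Y = span (\<Union>a. G a)"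
  have YU: "Y \<subseteq> U" unfolding Y_def using sU by (intro span_minimal) (auto simp: G_def)
  have "U \<subseteq> Y"
  proof (rule ccontr)
    assume "\<not> U \<subseteq> Y"
    then obtain w where w: "w \<in> U" "w \<notin> Y" by auto
    obtain p where p: "p \<noteq> 0" "peval x p w = 0" using annihilating_poly[of U x B0 w] U B0 w(1) by auto
    have sY: "subspace Y" unfolding Y_def by simp
    obtain a u where u: "u \<in> U" "u \<notin> Y" "shift x a u \<in> Y"
      using eigenvector_mod[of x U Y w p] x U sU sY w p subspace_0[OF sY] by auto
    have "\<exists>y\<in>Y. \<exists>g\<in>G a. v = shift x a y + g" if "v \<in> Y" for v
      using that[unfolded Y_def]
    proof (induction rule: span_induct_alt)
      case base
      then show ?case using subspace_0[OF sY] subspace_0[OF sG]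
        by (intro bexI[of _ 0]) (auto simp: endo_zero[OF endo_shift[OF x]])
    next
      case (step c z v)
      then obtain y g where yg: "y \<in> Y" "g \<in> G a" "v = shift x a y + g" by auto
      obtain b where b: "z \<in> G b" using step by auto
      have "\<exists>y\<in>Y. \<exists>g\<in>G a. z = shift x a y + g"
      proof (cases "a = b")
        case True
        then show ?thesis using b subspace_0[OF sY]
          by (intro bexI[of _ 0] bexI[of _ z]) (auto simp: endo_zero[OF endo_shift[OF x]])
      next
        case False
        obtain k where "(shift x b ^^ k) z = 0" "z \<in> U" using b unfolding G_def by auto
        then obtain z' where
          "z' \<in> U" "(shift x b ^^ k) z' = 0" "shift x a z' = z"
          using shift_surj[OF x False, of k z U] sU U by auto
        then have "z' \<in> G b" "shift x a z' = z" unfolding G_def by auto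
        moreover from this have "z' \<in> Y" unfolding Y_def by (auto intro: span_base)
        ultimately show ?thesis using subspace_0[OF sG] by (metis add_0_right)
      qed
      then obtain y' g' where y'g': "y' \<in> Y" "g' \<in> G a" "z = shift x a y' + g'" by auto
      have "scale c z + v = shift x a (scale c y' + y) + (scale c g' + g)"
        using yg y'g' by (simp add: endo_add[OF endo_shift[OF x]] endo_scale[OF endo_shift[OF x]] scale_right_distrib)
      moreover have "scale c y' + y \<in> Y" "scale c g' + g \<in> G a"
        using yg y'g' sY sG by (auto intro: subspace_add subspace_scale)
      ultimately show ?case by blast
    qed
    from this[OF u(3)] obtain y g where yg: "y \<in> Y" "g \<in> G a" "shift x a u = shift x a y + g" by auto
    then have "shift x a (u - y) = g" by (simp add: endo_diff[OF endo_shift[OF x]])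
    moreover obtain k where "(shift x a ^^ k) g = 0" using yg(2) unfolding G_def by auto
    ultimately have "(shift x a ^^ Suc k) (u - y) = 0" by (simp add: funpow_swap1)
    moreover have "u - y \<in> U" using u yg YU subspace_diff[OF sU] by auto
    ultimately have "u - y \<in> G a" unfolding G_def by blast
    then have "u - y \<in> Y" unfolding Y_def by (auto intro: span_base)
    then have "u - y + y \<in> Y" using yg(1) subspace_add[OF sY] by blast
    then show False using u by simp
  qed
  obtain B where B: "B \<subseteq> (\<Union>a. G a)" "independent B" "(\<Union>a. G a) \<subseteq> span B"
    using maximal_independent_subset by blast
  have spB: "span B = U"
    using B YU \<open>U \<subseteq> Y\<close> unfolding Y_def
    by (metis span_mono span_span subset_antisym)
  have "finite B"
    using independent_span_bound[of B0 B] B0 B(2) spB span_superset[of B] unfolding fin_basis_def by auto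
  have "\<exists>a k. (shift x a ^^ k) b = 0" if "b \<in> B" for b using that B(1) unfolding G_def by blast
  then obtain ev K where K: "\<And>b. b \<in> B \<Longrightarrow> (shift x (ev b) ^^ K b) b = 0" by metis
  \<comment> \<open>The sum of all exponents is one exponent that serves every basis vector.\<close>
  have "(shift x (ev b) ^^ (\<Sum>b\<in>B. K b)) b = 0" if "b \<in> B" for b
    by (rule pow_ge[OF K[OF that]]) (simp add: member_le_sum that \<open>finite B\<close>)
  then show ?thesis using B(2) spB \<open>finite B\<close> unfolding fin_basis_def by blast
qed

end

section \<open>Nilpotency from vanishing traces over an algebraically closed field\<close>

text \<open>The field is a vector space over \<open>rat\<close> in which a nonzero \<open>e\<close>
  is independent; linear extension does the rest.\<close>

lemma rational_functional:
  assumes "(e :: 'e::field_char_0) \<noteq> 0"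
  shows "\<exists>\<phi> :: 'e \<Rightarrow> rat. (\<forall>a b. \<phi> (a + b) = \<phi> a + \<phi> b) \<and> (\<forall>q a. \<phi> (of_rat q * a) = q * \<phi> a) \<and> \<phi> e = 1"
proof -
  interpret Q: vspace "\<lambda>(q::rat) (a::'e). of_rat q * a"
    by unfold_locales (auto simp: algebra_simps of_rat_add of_rat_mult)
  interpret R: vspace "\<lambda>(q::rat) (a::rat). q * a"
    by unfold_locales (auto simp: algebra_simps)
  interpret P: vector_space_pair "\<lambda>(q::rat) (a::'e). of_rat q * a" "\<lambda>(q::rat) (a::rat). q * a" ..
  have "Q.independent {e}" using assms by simp
  from P.linear_independent_extend[OF this, of "\<lambda>_. 1"] show ?thesis
    by (auto simp: Vector_Spaces.linear_iff)
qed

context vspace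
begin

lemma endo_pow_ge: "endo T \<Longrightarrow> (T ^^ k) v = 0 \<Longrightarrow> k \<le> m \<Longrightarrow> (T ^^ m) v = 0"
  by (metis comp_apply endo_compow endo_zero funpow_add le_add_diff_inverse2)

lemma endo_zero_map: "endo (\<lambda>_. 0)"
  by (intro endoI) auto

lemma vspace_endo_space: "vspace (\<lambda>c (f :: 'x \<Rightarrow> 'b) x. scale c (f x))"
  by (rule vspace_fun) (rule vspace_axioms)

definition ad :: "('b \<Rightarrow> 'b) \<Rightarrow> ('b \<Rightarrow> 'b) \<Rightarrow> 'b \<Rightarrow> 'b" where
  "ad x g = (\<lambda>v. x (g v) - g (x v))"

text \<open>Cyclicity gives \<open>tr ([p,q] y) = tr (p [q,y])\<close>. A trace against
  \<open>y\<close> can thus be evaluated from \<open>ad y q\<close> alone, even when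
  \<open>y\<close> lies outside the Lie algebra of operators at hand.\<close>

lemma trc_ad:
  assumes B: "fin_basis B W" and p: "endo p" "\<And>v. v \<in> W \<Longrightarrow> p v \<in> W"
    and q: "endo q" "\<And>v. v \<in> W \<Longrightarrow> q v \<in> W"
    and y: "endo y" "\<And>v. v \<in> W \<Longrightarrow> y v \<in> W"
  shows "trc B (\<lambda>v. ad p q (y v)) = - trc B (\<lambda>v. p (ad y q v))"
proof -
  have sW: "subspace W" using fin_basis_subspace B .
  have adW: "p (ad y q v) \<in> W" if "v \<in> W" for v
    unfolding ad_def using that by (intro p(2) subspace_diff[OF sW] y(2) q(2))
  have "trc B (\<lambda>v. ad p q (y v)) = trc B (\<lambda>v. p (q (y v))) - trc B (\<lambda>v. q (p (y v)))"
    unfolding ad_def by (intro trc_diff[OF B] p(2) q(2) y(2))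
  also have "trc B (\<lambda>v. q (p (y v))) = trc B (\<lambda>v. p (y (q v)))"
    by (rule trc_commute[OF B q endo_comp[OF p(1) y(1)]]) (simp_all add: p(2) y(2))
  also have "trc B (\<lambda>v. p (q (y v))) - trc B (\<lambda>v. p (y (q v))) = trc B (\<lambda>v. p (q (y v)) - p (y (q v)))"
    by (intro trc_diff[OF B, symmetric] p(2) q(2) y(2))
  also have "\<dots> = trc B (\<lambda>v. scale (-1) (p (ad y q v)))"
    by (intro trc_cong) (simp add: ad_def endo_diff[OF p(1)])
  also have "\<dots> = - trc B (\<lambda>v. p (ad y q v))"
    by (subst trc_scale[OF B adW]) simp_all
  finally show ?thesis .
qed

end

locale primary_basis = vspace_ac scale
  for scale :: "'a::{alg_closed_field, field_char_0} \<Rightarrow> 'b::ab_group_add \<Rightarrow> 'b" +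
  fixes x :: "'b \<Rightarrow> 'b" and U :: "'b set" and B :: "'b set" and ev :: "'b \<Rightarrow> 'a" and N :: nat
  assumes x: "endo x" "\<And>v. v \<in> U \<Longrightarrow> x v \<in> U"
    and B: "fin_basis B U"
    and ev: "\<And>b. b \<in> B \<Longrightarrow> (shift x (ev b) ^^ N) b = 0"
begin

definition gen :: "'a \<Rightarrow> 'b set" where
  "gen a = span {b\<in>B. ev b = a}"

lemma gen_sub: "v \<in> gen a \<Longrightarrow> v \<in> U"
  unfolding gen_def using B span_mono[of "{b\<in>B. ev b = a}" B] unfolding fin_basis_def by auto

lemma gen_base: "b \<in> B \<Longrightarrow> b \<in> gen (ev b)"
  unfolding gen_def by (auto intro: span_base)

lemma gen_shift_pow: "v \<in> gen a \<Longrightarrow> (shift x a ^^ N) v = 0"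
  unfolding gen_def
  by (rule endo_eq_on_span[where T = "\<lambda>_. 0"]) (auto intro!: endo_compow endo_shift x endoI simp: ev)

text \<open>Together with \<open>gen_shift_pow\<close> this identifies \<open>gen a\<close>, defined
  through the basis, with the whole generalised eigenspace of \<open>a\<close> in
  \<open>U\<close>.\<close>

lemma gen_memI:
  assumes "v \<in> U" "(shift x a ^^ k) v = 0"
  shows "v \<in> gen a"
proof -
  have fB: "finite B" "independent B" using fin_basisD[OF B] by auto
  let ?r = "rep B v"
  have rB: "(\<Sum>b\<in>B. scale (?r b) b) = v" using rep_sum[OF B assms(1)] .
  \<comment> \<open>Subtracting \<open>v\<close> from the component at \<open>a\<close> makes the
    family sum to zero, while each member is still killed by a power of its own shift. Independence
    of primary components, which is \<open>eigen_sum_in\<close> for the subspace \<open>{0}\<close>,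
    then gives \<open>c a = 0\<close>.\<close>
  define c where "c \<mu> = (\<Sum>b\<in>{b\<in>B. ev b = \<mu>}. scale (?r b) b) - (if \<mu> = a then v else 0)" for \<mu>
  let ?S = "insert a (ev ` B)"
  have E: "endo (shift x \<mu> ^^ k)" for \<mu> k by (intro endo_compow endo_shift x)
  have "(\<Sum>\<mu>\<in>?S. c \<mu>) = (\<Sum>\<mu>\<in>?S. \<Sum>b\<in>{b\<in>B. ev b = \<mu>}. scale (?r b) b) - v"
    unfolding c_def using fB by (simp add: sum_subtractf)
  also have "(\<Sum>\<mu>\<in>?S. \<Sum>b\<in>{b\<in>B. ev b = \<mu>}. scale (?r b) b) = v"
    using rB sum.group[of B ?S ev "\<lambda>b. scale (?r b) b"] fB by auto
  finally have s0: "(\<Sum>\<mu>\<in>?S. c \<mu>) = 0" by simp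
  have pow: "(shift x \<mu> ^^ (N + k)) (c \<mu>) = 0" for \<mu>
  proof -
    let ?g = "\<Sum>b\<in>{b\<in>B. ev b = \<mu>}. scale (?r b) b"
    have "?g \<in> gen \<mu>" unfolding gen_def by (intro span_sum span_scale span_base) auto
    then have "(shift x \<mu> ^^ (k + N)) ?g = 0"
      using gen_shift_pow[of ?g \<mu>] by (simp add: funpow_add endo_zero[OF E])
    moreover have "(shift x \<mu> ^^ (N + k)) (if \<mu> = a then v else 0) = 0"
      using assms(2) by (simp add: funpow_add endo_zero[OF E])
    ultimately show ?thesis unfolding c_def endo_diff[OF E] by (simp add: add.commute)
  qed
  have c0: "c \<mu> = 0" if "\<mu> \<in> ?S" for \<mu>
    using eigen_sum_in[of x "{0}" ?S "\<lambda>_. N + k" c \<mu>] x(1) that fB pow s0 endo_zero[OF x(1)] by auto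
  have "c a = 0" by (rule c0) simp
  then have "v = (\<Sum>b\<in>{b\<in>B. ev b = a}. scale (?r b) b)" unfolding c_def by simp
  then show ?thesis unfolding gen_def by (metis (no_types, lifting) span_sum span_scale span_base)
qed

lemma gen_shift:
  assumes "v \<in> gen a"
  shows "shift x a v \<in> gen a"
proof (rule gen_memI)
  show "shift x a v \<in> U" using assms gen_sub by (intro shift_in x fin_basis_subspace[OF B])
  have "(shift x a ^^ N) (shift x a v) = shift x a ((shift x a ^^ N) v)" by (rule funpow_swap1[symmetric])
  then show "(shift x a ^^ N) (shift x a v) = 0"
    using gen_shift_pow[OF assms] endo_zero[OF endo_shift[OF x(1)]] by simp
qed

lemma diag_gen:
  assumes "endo y" "\<And>b. b \<in> B \<Longrightarrow> y b = scale (f (ev b)) b" "v \<in> gen a"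
  shows "y v = scale (f a) v"
  using assms(3) unfolding gen_def
  by (rule endo_eq_on_span[rotated -1]) (auto intro!: assms(1) endoI simp: assms(2) scale_right_distrib mult.commute)

text \<open>On operators \<open>h\<close> raising generalised eigenvalues by \<open>\<mu>\<close>, \<open>ad x h - \<mu> h\<close> is
  \<open>(x - (a + \<mu>)) h - h (x - a)\<close> on the generalised eigenspace of \<open>a\<close>.\<close>

lemma graded_ad_nilpotent:
  assumes g: "endo g" "\<And>a v. v \<in> gen a \<Longrightarrow> g v \<in> gen (a + \<mu>)" and v: "v \<in> U"
  shows "((\<lambda>h u. ad x h u - scale \<mu> (h u)) ^^ (2 * N)) g v = 0"
proof -
  let ?A = "\<lambda>h u. ad x h u - scale \<mu> (h u)"
  have E: "endo ((?A ^^ k) g)" for k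
  proof (induction k)
    case (Suc k)
    then show ?case using x
      by (intro endoI) (auto simp: ad_def endo_add endo_scale algebra_simps scale_right_diff_distrib scale_right_distrib)
  qed (use g in auto)
  \<comment> \<open>Each application of \<open>?A\<close> produces a factor
    \<open>x - (a + \<mu>)\<close> on the left or a factor \<open>x - a\<close> on the right; among
    \<open>2 * N\<close> factors one side receives at least \<open>N\<close>.\<close>
  have *: "(shift x (a + \<mu>) ^^ i) ((?A ^^ k) g ((shift x a ^^ j) v)) = 0"
    if "v \<in> gen a" "2 * N \<le> i + j + k" for a i j k v
    using that(2)
  proof (induction k arbitrary: i j)
    case 0
    show ?case
    proof (cases "N \<le> j")
      case True
      then have "(shift x a ^^ j) v = 0"
        by (rule endo_pow_ge[OF endo_shift[OF x(1)] gen_shift_pow[OF that(1)]])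
      then show ?thesis by (simp add: endo_zero[OF g(1)] endo_zero[OF endo_compow[OF endo_shift[OF x(1)]]])
    next
      case False
      then have "N \<le> i" using 0 by simp
      have "g ((shift x a ^^ j) v) \<in> gen (a + \<mu>)"
        using that(1) by (intro g(2) compow_in gen_shift)
      then have "(shift x (a + \<mu>) ^^ i) (g ((shift x a ^^ j) v)) = 0"
        by (rule endo_pow_ge[OF endo_shift[OF x(1)] gen_shift_pow \<open>N \<le> i\<close>])
      then show ?thesis by simp
    qed
  next
    case (Suc k)
    let ?h = "(?A ^^ k) g" and ?u = "(shift x a ^^ j) v"
    have "?A h w = shift x (a + \<mu>) (h w) - h (shift x a w)" if "endo h" for h w
      by (simp add: ad_def shift_def endo_diff[OF that] endo_scale[OF that] scale_left_distrib)
    from this[OF E] have "(?A ^^ Suc k) g ?u = shift x (a + \<mu>) (?h ?u) - ?h (shift x a ?u)"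
      by simp
    then have "(shift x (a + \<mu>) ^^ i) ((?A ^^ Suc k) g ?u)
       = (shift x (a + \<mu>) ^^ Suc i) (?h ?u) - (shift x (a + \<mu>) ^^ i) (?h ((shift x a ^^ Suc j) v))"
      by (simp add: endo_diff[OF endo_compow[OF endo_shift[OF x(1)]]] funpow_swap1)
    also have "\<dots> = 0" using Suc.IH[of "Suc i" j] Suc.IH[of i "Suc j"] Suc.prems by simp
    finally show ?case .
  qed
  have "(?A ^^ (2 * N)) g b = 0" if "b \<in> B" for b
    using *[OF gen_base[OF that], of 0 0 "2 * N"] by simp
  moreover have "v \<in> span B" using v B unfolding fin_basis_def by auto
  ultimately show ?thesis
    by (intro endo_eq_on_span[of "(?A ^^ (2 * N)) g" "\<lambda>_. 0" B v]) (auto intro!: endoI E)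
qed

text \<open>Sort the matrix entries of \<open>c\<close> by the difference
  \<open>ev b' - ev b\<close> of the eigenvalues that they connect.\<close>

lemma graded_decomposition:
  assumes c: "\<And>v. v \<in> U \<Longrightarrow> c v \<in> U"
  shows "\<exists>M cc. finite M \<and> (\<forall>\<mu>\<in>M. endo (cc \<mu>) \<and> (\<forall>a. \<forall>v\<in>gen a. cc \<mu> v \<in> gen (a + \<mu>)))
    \<and> (\<forall>b\<in>B. (\<Sum>\<mu>\<in>M. cc \<mu> b) = c b)"
proof -
  have fB: "finite B" "independent B" using fin_basisD[OF B] by auto
  define M where "M = (\<lambda>(b, b'). ev b' - ev b) ` (B \<times> B)"
  let ?h = "\<lambda>\<mu> b. \<Sum>b'\<in>{b'\<in>B. ev b' - ev b = \<mu>}. scale (rep B (c b) b') b'"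
  define cc where "cc \<mu> = (SOME g. endo g \<and> (\<forall>b\<in>B. g b = ?h \<mu> b))" for \<mu>
  have "endo (cc \<mu>) \<and> (\<forall>b\<in>B. cc \<mu> b = ?h \<mu> b)" for \<mu>
    unfolding cc_def using someI_ex[OF endo_extend[OF fB(2), of "?h \<mu>"]] .
  then have cc: "\<And>\<mu>. endo (cc \<mu>)" "\<And>\<mu> b. b \<in> B \<Longrightarrow> cc \<mu> b = ?h \<mu> b" by blast+
  have deg: "cc \<mu> v \<in> gen (a + \<mu>)" if "v \<in> gen a" for \<mu> a v
    using that unfolding gen_def
  proof (induction rule: span_induct_alt)
    case base
    then show ?case by (simp add: endo_zero[OF cc(1)] span_zero)
  next
    case (step k b v)
    have "cc \<mu> b \<in> span {b \<in> B. ev b = a + \<mu>}"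
      using step(1) unfolding cc(2)[of b \<mu>, OF CollectD[OF step(1), THEN conjunct1]]
      by (intro span_sum span_scale span_base) (auto simp: algebra_simps)
    then show ?case using step(2) by (auto simp: endo_add[OF cc(1)] endo_scale[OF cc(1)] intro: span_add span_scale)
  qed
  have sum: "(\<Sum>\<mu>\<in>M. cc \<mu> b) = c b" if b: "b \<in> B" for b
  proof -
    have "(\<Sum>\<mu>\<in>M. cc \<mu> b) = (\<Sum>b'\<in>B. scale (rep B (c b) b') b')"
      unfolding cc(2)[OF b]
      using b fB by (intro sum.group) (auto simp: M_def)
    then show ?thesis using rep_sum[OF B c[OF fin_basis_base[OF B b]]] by simp
  qed
  have "finite M" unfolding M_def using fB by auto
  with cc(1) deg sum show ?thesis
    by (intro exI[of _ M] exI[of _ cc] conjI ballI allI)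
qed

text \<open>Let \<open>s\<close> be the diagonal operator with entries \<open>ev b\<close>. On
  \<open>gen a\<close> the difference of \<open>x y\<close> and \<open>s y\<close> is
  \<open>f a\<close> times \<open>shift x a\<close>; it is nilpotent and has trace zero, so
  \<open>x\<close> may be replaced by \<open>s\<close>.\<close>

lemma trc_diag:
  assumes y: "endo y" "\<And>b. b \<in> B \<Longrightarrow> y b = scale (f (ev b)) b"
  shows "trc B (\<lambda>v. x (y v)) = (\<Sum>b\<in>B. ev b * f (ev b))"
proof -
  have fB: "finite B" "independent B" using fin_basisD[OF B] by auto
  have sU: "subspace U" using fin_basis_subspace[OF B] .
  obtain s where s: "endo s" "\<And>b. b \<in> B \<Longrightarrow> s b = scale (ev b) b"
    using endo_extend[OF fB(2), of "\<lambda>b. scale (ev b) b"] by auto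
  have diagU: "z v \<in> U" if z: "endo z" "\<And>b. b \<in> B \<Longrightarrow> z b = scale (h b) b" and v: "v \<in> U" for z h v
    unfolding endo_rep[OF B z(1) v]
    using z(2) fin_basis_base[OF B] by (intro subspace_sum[OF sU] subspace_scale[OF sU]) (simp add: subspace_scale[OF sU])
  have yU: "\<And>v. v \<in> U \<Longrightarrow> y v \<in> U" using diagU[OF y] by blast
  have sU': "\<And>v. v \<in> U \<Longrightarrow> s v \<in> U" using diagU[OF s] by blast
  define t where "t = (\<lambda>v. x (y v) - s (y v))"
  have t: "endo t" unfolding t_def
    by (intro endoI) (auto simp: endo_add endo_scale x y s scale_right_diff_distrib)
  have tU: "\<And>v. v \<in> U \<Longrightarrow> t v \<in> U" unfolding t_def using x yU sU' sU by (auto intro: subspace_diff)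
  have tg: "t v = scale (f a) (shift x a v)" if "v \<in> gen a" for a v
    using diag_gen[OF y that] diag_gen[of s "\<lambda>a. a", OF s that]
    by (simp add: t_def shift_def endo_scale x(1) s(1) scale_right_diff_distrib)
  have "(t ^^ k) v = scale (f a ^ k) ((shift x a ^^ k) v)" if "v \<in> gen a" for a v k
  proof (induction k)
    case (Suc k)
    have "(shift x a ^^ k) v \<in> gen a" by (intro compow_in gen_shift that)
    then show ?case using Suc tg[of "(shift x a ^^ k) v" a] by (simp add: endo_scale[OF t] mult.commute)
  qed auto
  then have "(t ^^ N) b = 0" if "b \<in> B" for b using gen_base[OF that] ev[OF that] by simp
  then have "(t ^^ N) v = 0" if "v \<in> U" for v
    using that B endo_eq_on_span[OF endo_compow[OF t] endo_zero_map] unfolding fin_basis_def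
    by blast
  then have "trc B t = 0" using trc_nilpotent[OF B t tU] by blast
  moreover have "trc B (\<lambda>v. x (y v)) = trc B (\<lambda>v. t v + s (y v))" by (simp add: t_def)
  moreover have "\<dots> = trc B t + trc B (\<lambda>v. s (y v))" using tU yU sU' by (intro trc_add[OF B]) auto
  moreover have "trc B (\<lambda>v. s (y v)) = (\<Sum>b\<in>B. ev b * f (ev b))"
    unfolding trc_def using s y fB
    by (intro sum.cong refl) (simp add: endo_scale representation_scale span_base representation_basis)
  ultimately show ?thesis by simp
qed

end

context vspace_ac
begin

text \<open>For an additive functional \<phi> let \<open>y\<close> be diagonal with entries
  \<open>\<phi> (ev b)\<close>. Although \<open>y\<close> may lie outside \<open>S\<close>,
  \<open>ad y\<close> preserves \<open>S\<close> up to agreement on \<open>U\<close>: by stability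
  under \<open>ad x\<close>, \<open>S\<close> contains the graded components of its elements, and on
  the component of degree \<open>\<mu>\<close> the operator \<open>ad y\<close> is the scalar
  \<open>\<phi> \<mu>\<close>. After moving brackets, \<open>tr (x y)\<close> vanishes; the same
  trace is the sum of the products of \<open>ev b\<close> and \<open>\<phi> (ev b)\<close>.\<close>

theorem cartan_nilpotent_ac:
  fixes S :: "('b \<Rightarrow> 'b) set"
  assumes B0: "fin_basis B0 U"
    and S: "module.subspace (\<lambda>c f v. scale c (f v)) S"
    and SU: "\<And>a. a \<in> S \<Longrightarrow> endo a" "\<And>a v. a \<in> S \<Longrightarrow> v \<in> U \<Longrightarrow> a v \<in> U"
    and br: "\<And>a b. a \<in> S \<Longrightarrow> b \<in> S \<Longrightarrow> \<exists>c\<in>S. \<forall>v\<in>U. c v = ad a b v"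
    and tr: "\<And>a b. a \<in> S \<Longrightarrow> b \<in> S \<Longrightarrow> trc B0 (\<lambda>v. a (b v)) = 0"
    and xS: "x \<in> S" and pq: "finite I" "\<And>i. i \<in> I \<Longrightarrow> p i \<in> S" "\<And>i. i \<in> I \<Longrightarrow> q i \<in> S"
    and xpq: "\<And>v. v \<in> U \<Longrightarrow> x v = (\<Sum>i\<in>I. ad (p i) (q i) v)"
  shows "\<exists>N. \<forall>v\<in>U. (x ^^ N) v = 0"
proof -
  interpret O: vspace "\<lambda>c (f :: 'b \<Rightarrow> 'b) v. scale c (f v)" by (rule vspace_endo_space)
  note x = SU[OF xS]
  note sU = fin_basis_subspace[OF B0]
  obtain B ev N where B: "fin_basis B U" and ev: "\<And>b. b \<in> B \<Longrightarrow> (shift x (ev b) ^^ N) b = 0"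
    using gen_eig_basis[of x U B0] x B0 by blast
  have fB: "finite B" "independent B" "span B = U" using fin_basisD[OF B] by auto
  interpret G: primary_basis scale x U B ev N
    by (intro primary_basis.intro primary_basis_axioms.intro vspace_ac_axioms x B ev)
  \<comment> \<open>The hypotheses control brackets and traces on \<open>U\<close> only, so
    membership in \<open>S\<close> is relaxed to agreement on \<open>U\<close> with a member of
    \<open>S\<close>.\<close>
  define S' where "S' = {g. \<exists>s\<in>S. \<forall>v\<in>U. g v = s v}"
  have sS': "O.subspace S'"
  proof (rule O.subspaceI)
    show "0 \<in> S'" unfolding S'_def using O.subspace_0[OF S] by (auto intro!: bexI[of _ 0])
    show "g + h \<in> S'" if gh: "g \<in> S'" "h \<in> S'" for g h
    proof -
      obtain s t where "s \<in> S" "t \<in> S" "\<forall>v\<in>U. g v = s v" "\<forall>v\<in>U. h v = t v"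
        using gh unfolding S'_def by blast
      then have "s + t \<in> S" "\<forall>v\<in>U. (g + h) v = (s + t) v" using O.subspace_add[OF S] by auto
      then show ?thesis unfolding S'_def by blast
    qed
    show "(\<lambda>v. scale k (g v)) \<in> S'" if g: "g \<in> S'" for k g
    proof -
      obtain s where "s \<in> S" "\<forall>v\<in>U. g v = s v"
        using g unfolding S'_def by blast
      then have "(\<lambda>v. scale k (s v)) \<in> S" "\<forall>v\<in>U. scale k (g v) = scale k (s v)"
        using O.subspace_scale[OF S, of s k] by auto
      then show ?thesis unfolding S'_def by (intro CollectI bexI[of _ "\<lambda>v. scale k (s v)"])
    qed
  qed
  have adS': "ad x g \<in> S'" if g: "g \<in> S'" for g
  proof -
    obtain s where s: "s \<in> S" "\<forall>v\<in>U. g v = s v" using g unfolding S'_def by blast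
    then have "\<forall>v\<in>U. ad x g v = ad x s v" using x by (simp add: ad_def)
    moreover obtain c where "c \<in> S" "\<forall>v\<in>U. c v = ad x s v" using br[OF xS s(1)] by blast
    ultimately show ?thesis unfolding S'_def by (intro CollectI bexI[of _ c]) auto
  qed
  have adE: "O.endo (ad x)"
    by (intro O.endoI) (auto simp: ad_def fun_eq_iff endo_add[OF x(1)] endo_scale[OF x(1)] scale_right_diff_distrib)
  have shO: "O.shift (ad x) \<mu> = (\<lambda>h u. ad x h u - scale \<mu> (h u))" for \<mu>
    by (simp add: O.shift_def fun_eq_iff)
  have main: "\<phi> (ev b0) = 0"
    if b0: "b0 \<in> B" and \<phi>: "\<And>a b. \<phi> (a + b) = \<phi> a + \<phi> b" "\<And>q a. \<phi> (of_rat q * a) = q * \<phi> a"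
    for b0 and \<phi> :: "'a \<Rightarrow> rat"
  proof -
    define f :: "'a \<Rightarrow> 'a" where "f a = of_rat (\<phi> a)" for a
    have fadd: "f (a + b) = f a + f b" for a b by (simp add: f_def \<phi> of_rat_add)
    obtain y where y: "endo y" "\<And>b. b \<in> B \<Longrightarrow> y b = scale (f (ev b)) b"
      using endo_extend[OF fB(2), of "\<lambda>b. scale (f (ev b)) b"] by auto
    have yU: "y v \<in> U" if "v \<in> U" for v
      unfolding endo_rep[OF B y(1) that]
      using y(2) fin_basis_base[OF B] by (intro subspace_sum[OF sU] subspace_scale[OF sU]) (simp add: subspace_scale[OF sU])
    have key: "ad y g \<in> S'" if g: "g \<in> S" for g
    proof -
      obtain M cc where M: "finite M"
        and cc': "\<forall>\<mu>\<in>M. endo (cc \<mu>) \<and> (\<forall>a. \<forall>v\<in>G.gen a. cc \<mu> v \<in> G.gen (a + \<mu>))"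
        and sum': "\<forall>b\<in>B. (\<Sum>\<mu>\<in>M. cc \<mu> b) = g b"
        using G.graded_decomposition[of g] SU(2)[OF g] by blast
      have cc: "\<And>\<mu>. \<mu> \<in> M \<Longrightarrow> endo (cc \<mu>)"
          "\<And>\<mu> a v. \<mu> \<in> M \<Longrightarrow> v \<in> G.gen a \<Longrightarrow> cc \<mu> v \<in> G.gen (a + \<mu>)"
        and sum: "\<And>b. b \<in> B \<Longrightarrow> (\<Sum>\<mu>\<in>M. cc \<mu> b) = g b"
        using cc' sum' by blast+
      have ext: "(\<Sum>\<mu>\<in>M. cc \<mu>) v = g v" if "v \<in> U" for v
      proof (rule endo_eq_on_span[of "\<Sum>\<mu>\<in>M. cc \<mu>" g B v])
        have *: "(\<Sum>\<mu>\<in>M. cc \<mu>) = (\<lambda>v. \<Sum>\<mu>\<in>M. cc \<mu> v)"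
          by (induction M rule: infinite_finite_induct) (auto simp: fun_eq_iff)
        show "endo (\<Sum>\<mu>\<in>M. cc \<mu>)"
          unfolding * using cc(1) by (intro endoI) (auto simp: endo_add endo_scale sum.distrib scale_sum_right)
        show "(\<Sum>\<mu>\<in>M. cc \<mu>) b = g b" if "b \<in> B" for b
          unfolding * using sum[OF that] .
      qed (use SU[OF g] that fB in auto)
      \<comment> \<open>\<open>graded_ad_nilpotent\<close> gives vanishing on \<open>U\<close> only;
        this is enough, since \<open>S'\<close> contains every operator that vanishes on
        \<open>U\<close>.\<close>
      have ccS': "cc \<mu> \<in> S'" if "\<mu> \<in> M" for \<mu>
      proof (rule O.eigen_sum_in[of "ad x" S' M "\<lambda>_. 2 * N" cc \<mu>])
        show "(O.shift (ad x) \<mu> ^^ (2 * N)) (cc \<mu>) \<in> S'" if "\<mu> \<in> M" for \<mu>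
        proof -
          have "\<forall>v\<in>U. (O.shift (ad x) \<mu> ^^ (2 * N)) (cc \<mu>) v = 0"
            unfolding shO using G.graded_ad_nilpotent[OF cc(1)[OF that] cc(2)[OF that]] by blast
          then show ?thesis using O.subspace_0[OF S] unfolding S'_def by (auto intro!: bexI[of _ 0])
        qed
        show "sum cc M \<in> S'" using ext g unfolding S'_def by auto
      qed (use adE sS' adS' M that in auto)
      have "(\<Sum>\<mu>\<in>M. (\<lambda>v. scale (f \<mu>) (cc \<mu> v))) \<in> S'"
        using ccS' by (intro O.subspace_sum[OF sS'] O.subspace_scale[OF sS'])
      then obtain s where s: "s \<in> S" "\<forall>v\<in>U. (\<Sum>\<mu>\<in>M. (\<lambda>v. scale (f \<mu>) (cc \<mu> v))) v = s v"
        unfolding S'_def by auto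
      have "ad y g b = s b" if b: "b \<in> B" for b
      proof -
        have "ad y g b = (\<Sum>\<mu>\<in>M. y (cc \<mu> b)) - scale (f (ev b)) (\<Sum>\<mu>\<in>M. cc \<mu> b)"
          using b by (simp add: ad_def y(2) endo_scale[OF SU(1)[OF g]] endo_sum[OF y(1), symmetric] sum)
        also have "\<dots> = (\<Sum>\<mu>\<in>M. y (cc \<mu> b) - scale (f (ev b)) (cc \<mu> b))"
          by (simp add: sum_subtractf scale_sum_right)
        also have "\<dots> = (\<Sum>\<mu>\<in>M. scale (f \<mu>) (cc \<mu> b))"
        proof (intro sum.cong refl)
          fix \<mu> assume "\<mu> \<in> M"
          then have "y (cc \<mu> b) = scale (f (ev b + \<mu>)) (cc \<mu> b)"
            using G.diag_gen[OF y, of "cc \<mu> b" "ev b + \<mu>"] cc(2) G.gen_base[OF b] by blast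
          then show "y (cc \<mu> b) - scale (f (ev b)) (cc \<mu> b) = scale (f \<mu>) (cc \<mu> b)"
            by (simp add: fadd scale_left_distrib)
        qed
        also have "\<dots> = (\<Sum>\<mu>\<in>M. (\<lambda>v. scale (f \<mu>) (cc \<mu> v))) b"
          by (induction M rule: infinite_finite_induct) auto
        also have "\<dots> = s b" using s fin_basis_base[OF B b] by auto
        finally show ?thesis .
      qed
      moreover have "endo (ad y g)"
        using y(1) SU(1)[OF g] by (intro endoI) (auto simp: ad_def endo_add endo_scale scale_right_diff_distrib)
      ultimately have "ad y g v = s v" if "v \<in> U" for v
        using endo_eq_on_span[of "ad y g" s B v] SU(1)[OF s(1)] that fB by auto
      then show ?thesis using s(1) unfolding S'_def by auto
    qed
    have "trc B0 (\<lambda>v. x (y v)) = trc B0 (\<lambda>v. \<Sum>i\<in>I. ad (p i) (q i) (y v))"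
      using fin_basis_base[OF B0] yU xpq by (intro trc_cong) auto
    also have "\<dots> = (\<Sum>i\<in>I. trc B0 (\<lambda>v. ad (p i) (q i) (y v)))"
      using SU pq yU sU by (intro trc_sum[OF B0]) (auto simp: ad_def intro!: subspace_diff)
    also have "\<dots> = 0"
    proof (intro sum.neutral ballI)
      fix i assume i: "i \<in> I"
      obtain s where s: "s \<in> S" "\<forall>v\<in>U. ad y (q i) v = s v" using key[OF pq(3)[OF i]] unfolding S'_def by auto
      have "trc B0 (\<lambda>v. ad (p i) (q i) (y v)) = - trc B0 (\<lambda>v. p i (ad y (q i) v))"
        using SU pq(2,3)[OF i] y(1) yU by (intro trc_ad[OF B0]) auto
      also have "trc B0 (\<lambda>v. p i (ad y (q i) v)) = trc B0 (\<lambda>v. p i (s v))"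
        using s fin_basis_base[OF B0] by (intro trc_cong) auto
      finally show "trc B0 (\<lambda>v. ad (p i) (q i) (y v)) = 0" using tr pq(2)[OF i] s by simp
    qed
    finally have "trc B0 (\<lambda>v. x (y v)) = 0" .
    moreover have "trc B0 (\<lambda>v. x (y v)) = trc B (\<lambda>v. x (y v))"
      by (rule trc_indep[OF B0 B endo_comp[OF x(1) y(1)]]) (simp add: x(2) yU)
    ultimately have "(\<Sum>b\<in>B. ev b * f (ev b)) = 0" using G.trc_diag[OF y] by simp
    \<comment> \<open>Applying \<phi> once more turns the relation into a sum of rational
      squares.\<close>
    then have "\<phi> (\<Sum>b\<in>B. of_rat (\<phi> (ev b)) * ev b) = \<phi> 0" by (simp add: f_def mult.commute)
    moreover have "\<phi> 0 = 0" using \<phi>(1)[of 0 0] by simp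
    moreover have "\<phi> (\<Sum>b\<in>A. of_rat (\<phi> (ev b)) * ev b) = (\<Sum>b\<in>A. \<phi> (ev b) * \<phi> (ev b))" for A
      by (induction A rule: infinite_finite_induct) (auto simp: \<phi> \<open>\<phi> 0 = 0\<close>)
    ultimately have "(\<Sum>b\<in>B. \<phi> (ev b) * \<phi> (ev b)) = 0" by simp
    then show ?thesis using b0 fB(1) by (subst (asm) sum_nonneg_eq_0_iff) auto
  qed
  have "ev b = 0" if b: "b \<in> B" for b
  proof (rule ccontr)
    assume "ev b \<noteq> 0"
    from rational_functional[OF this] obtain \<phi> :: "'a \<Rightarrow> rat" where
      \<phi>: "\<forall>a b. \<phi> (a + b) = \<phi> a + \<phi> b" "\<forall>q a. \<phi> (of_rat q * a) = q * \<phi> a" "\<phi> (ev b) = 1"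
      by (elim exE conjE)
    have "\<phi> (ev b) = 0" using main[OF b, of \<phi>] \<phi>(1,2) by simp
    then show False using \<phi>(3) by simp
  qed
  moreover have "shift x 0 = x" by (simp add: shift_def)
  ultimately have "(x ^^ N) b = 0" if "b \<in> B" for b using ev that by auto
  then have "(x ^^ N) v = 0" if "v \<in> U" for v
    using that fB endo_eq_on_span[OF endo_compow[OF x(1)] endo_zero_map] by blast
  then show ?thesis by blast
qed

end

section \<open>Descent to an arbitrary field of characteristic zero\<close>

locale vspace_0 = vspace scale
  for scale :: "'a::field_char_0 \<Rightarrow> 'b::ab_group_add \<Rightarrow> 'b"
begin

text \<open>The extension of scalars of the span of \<open>B\<close> is modelled by the functions on \<open>B\<close>.\<close>

definition ext_map :: "'b set \<Rightarrow> ('b \<Rightarrow> 'b) \<Rightarrow> ('b \<Rightarrow> 'a alg_closure) \<Rightarrow> 'b \<Rightarrow> 'a alg_closure" where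
  "ext_map B T v = (\<lambda>c. \<Sum>b\<in>B. v b * to_ac (rep B (T b) c))"

definition unit_fun :: "'b \<Rightarrow> 'b \<Rightarrow> 'a alg_closure" where
  "unit_fun b = (\<lambda>c. if c = b then 1 else 0)"

definition ext_carrier :: "'b set \<Rightarrow> ('b \<Rightarrow> 'a alg_closure) set" where
  "ext_carrier B = {v. \<forall>c. c \<notin> B \<longrightarrow> v c = 0}"

lemma ext_map_cong: "(\<And>b. b \<in> B \<Longrightarrow> S b = T b) \<Longrightarrow> ext_map B S = ext_map B T"
  unfolding ext_map_def by (auto simp: fun_eq_iff intro!: sum.cong)

lemma ext_map_carrier: "ext_map B T v \<in> ext_carrier B"
  unfolding ext_map_def ext_carrier_def
  using representation_ne_zero[of B] by (auto intro!: sum.neutral)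

lemma ext_map_comp:
  assumes B: "fin_basis B W" and S: "endo S" "\<And>v. v \<in> W \<Longrightarrow> S v \<in> W" and T: "\<And>v. v \<in> W \<Longrightarrow> T v \<in> W"
  shows "ext_map B S (ext_map B T v) = ext_map B (\<lambda>v. S (T v)) v"
proof
  fix c
  have "ext_map B S (ext_map B T v) c =
      (\<Sum>b\<in>B. \<Sum>d\<in>B. v d * (to_ac (rep B (T d) b) * to_ac (rep B (S b) c)))"
    unfolding ext_map_def by (simp add: sum_distrib_right mult.assoc)
  also have "\<dots> = (\<Sum>d\<in>B. v d * to_ac (\<Sum>b\<in>B. rep B (T d) b * rep B (S b) c))"
    by (subst sum.swap) (simp add: sum_distrib_left to_ac_sum)
  also have "\<dots> = ext_map B (\<lambda>v. S (T v)) v c"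
    unfolding ext_map_def
    by (intro sum.cong refl) (simp add: rep_comp[OF B S T[OF fin_basis_base[OF B]]])
  finally show "ext_map B S (ext_map B T v) c = ext_map B (\<lambda>v. S (T v)) v c" .
qed

lemma ext_map_diff:
  assumes B: "fin_basis B W" and S: "\<And>v. v \<in> W \<Longrightarrow> S v \<in> W" and T: "\<And>v. v \<in> W \<Longrightarrow> T v \<in> W"
  shows "ext_map B (\<lambda>v. S v - T v) v = ext_map B S v - ext_map B T v"
  using fin_basis_base[OF B] S T
  by (auto simp: ext_map_def fun_eq_iff rep_diff[OF B] right_diff_distrib sum_subtractf)

lemma ext_map_sum:
  assumes B: "fin_basis B W" and T: "\<And>i v. i \<in> I \<Longrightarrow> v \<in> W \<Longrightarrow> T i v \<in> W"
  shows "ext_map B (\<lambda>v. \<Sum>i\<in>I. T i v) v = (\<Sum>i\<in>I. ext_map B (T i) v)"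
proof
  fix c
  have "ext_map B (\<lambda>v. \<Sum>i\<in>I. T i v) v c = (\<Sum>b\<in>B. \<Sum>i\<in>I. v b * to_ac (rep B (T i b) c))"
    unfolding ext_map_def
    using fin_basis_base[OF B] T
    by (intro sum.cong refl) (simp add: rep_sum_distrib[OF B] to_ac_sum sum_distrib_left)
  also have "\<dots> = (\<Sum>i\<in>I. ext_map B (T i) v c)"
    unfolding ext_map_def by (rule sum.swap)
  also have "\<dots> = (\<Sum>i\<in>I. ext_map B (T i) v) c"
    by (induction I rule: infinite_finite_induct) auto
  finally show "ext_map B (\<lambda>v. \<Sum>i\<in>I. T i v) v c = (\<Sum>i\<in>I. ext_map B (T i) v) c" .
qed

lemma ext_map_unit:
  assumes "finite B" "b \<in> B"
  shows "ext_map B T (unit_fun b) c = to_ac (rep B (T b) c)"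
proof -
  have "ext_map B T (unit_fun b) c = (\<Sum>d\<in>B. if d = b then to_ac (rep B (T d) c) else 0)"
    unfolding ext_map_def unit_fun_def by (intro sum.cong) auto
  then show ?thesis using assms by simp
qed

text \<open>The matrix entries of the powers of \<open>T\<close> survive the extension of scalars;
  as \<open>to_ac\<close> is injective, nilpotency of the extended operator descends to
  \<open>T\<close>.\<close>

lemma ext_map_pow_unit:
  assumes B: "fin_basis B W" and T: "endo T" "\<And>v. v \<in> W \<Longrightarrow> T v \<in> W" and b: "b \<in> B"
  shows "(ext_map B T ^^ k) (unit_fun b) c = to_ac (rep B ((T ^^ k) b) c)"
proof (induction k arbitrary: c)
  case 0
  have "rep B b c = (if c = b then 1 else 0)"
    using B b representation_basis[of B b] unfolding fin_basis_def by auto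
  then show ?case by (simp add: unit_fun_def)
next
  case (Suc k)
  have "(T ^^ k) b \<in> W" by (rule compow_in[of W T b k, OF T(2) fin_basis_base[OF B b]])
  from rep_comp[OF B T this]
  show ?case
    using Suc by (simp add: ext_map_def to_ac_sum)
qed

abbreviation ext_scale :: "'a alg_closure \<Rightarrow> ('b \<Rightarrow> 'a alg_closure) \<Rightarrow> 'b \<Rightarrow> 'a alg_closure" where
  "ext_scale \<equiv> (\<lambda>c v b. c * v b)"

lemma vspace_ac_ext: "vspace_ac ext_scale"
  by unfold_locales (auto simp: fun_eq_iff algebra_simps)

lemma inj_unit_fun: "inj_on unit_fun B"
  unfolding inj_on_def unit_fun_def by (metis zero_neq_one)

lemma sum_unit_fun:
  assumes "finite B"
  shows "(\<Sum>d\<in>unit_fun ` B. ext_scale (g d) d) = (\<lambda>c. if c \<in> B then g (unit_fun c) else 0)"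
proof
  fix c
  have "(\<Sum>d\<in>unit_fun ` B. ext_scale (g d) d) c = (\<Sum>b\<in>B. g (unit_fun b) * unit_fun b c)"
    by (subst sum.reindex[OF inj_unit_fun], induction B rule: infinite_finite_induct) auto
  also have "\<dots> = (\<Sum>b\<in>B. if b = c then g (unit_fun b) else 0)"
    unfolding unit_fun_def by (intro sum.cong) auto
  finally show "(\<Sum>d\<in>unit_fun ` B. ext_scale (g d) d) c = (if c \<in> B then g (unit_fun c) else 0)"
    using assms by simp
qed

lemma ext_basis:
  assumes "finite B"
  shows "vspace.fin_basis ext_scale (unit_fun ` B) (ext_carrier B)"
proof -
  interpret E: vspace_ac ext_scale by (rule vspace_ac_ext)
  have "E.independent (unit_fun ` B)"
  proof (rule E.independent_if_scalars_zero)
    fix f d assume s: "(\<Sum>d\<in>unit_fun ` B. ext_scale (f d) d) = 0" and d: "d \<in> unit_fun ` B"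
    then obtain c where "d = unit_fun c" "c \<in> B" by auto
    then show "f d = 0" using fun_cong[OF s, of c] unfolding sum_unit_fun[OF assms] by simp
  qed (simp add: assms)
  moreover have "E.span (unit_fun ` B) = ext_carrier B"
  proof
    have "E.subspace (ext_carrier B)" by (rule E.subspaceI) (auto simp: ext_carrier_def)
    moreover have "unit_fun ` B \<subseteq> ext_carrier B" by (auto simp: ext_carrier_def unit_fun_def)
    ultimately show "E.span (unit_fun ` B) \<subseteq> ext_carrier B" by (rule E.span_minimal[rotated])
    show "ext_carrier B \<subseteq> E.span (unit_fun ` B)"
    proof
      fix v assume v: "v \<in> ext_carrier B"
      let ?s = "\<Sum>d\<in>unit_fun ` B. ext_scale (v (the_inv_into B unit_fun d)) d"
      have eq: "?s = v"
        unfolding sum_unit_fun[OF assms] using v inj_unit_fun by (auto simp: fun_eq_iff ext_carrier_def the_inv_into_f_f)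
      have "?s \<in> E.span (unit_fun ` B)" by (intro E.span_sum E.span_scale E.span_base)
      then show "v \<in> E.span (unit_fun ` B)" unfolding eq .
    qed
  qed
  ultimately show ?thesis unfolding E.fin_basis_def using assms by simp
qed

lemma trc_ext:
  assumes B: "fin_basis B W"
  shows "vspace.trc ext_scale (unit_fun ` B) (ext_map B T) = to_ac (trc B T)"
proof -
  interpret E: vspace_ac ext_scale by (rule vspace_ac_ext)
  have fB: "finite B" using fin_basisD[OF B] by auto
  have EB: "E.independent (unit_fun ` B)" "E.span (unit_fun ` B) = ext_carrier B"
    using ext_basis[OF fB] unfolding E.fin_basis_def by auto
  have rep: "E.rep (unit_fun ` B) v (unit_fun b) = v b" if v: "v \<in> ext_carrier B" and b: "b \<in> B" for v b
  proof -
    have "(\<Sum>d\<in>unit_fun ` B. ext_scale (E.rep (unit_fun ` B) v d) d) = v"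
      using v EB fB by (intro E.sum_representation_eq) auto
    then show ?thesis using b unfolding sum_unit_fun[OF fB] by (metis (mono_tags, lifting))
  qed
  have "E.trc (unit_fun ` B) (ext_map B T) = (\<Sum>b\<in>B. E.rep (unit_fun ` B) (ext_map B T (unit_fun b)) (unit_fun b))"
    unfolding E.trc_def by (subst sum.reindex[OF inj_unit_fun]) simp
  also have "\<dots> = (\<Sum>b\<in>B. to_ac (rep B (T b) b))"
    by (intro sum.cong refl) (simp add: rep ext_map_carrier ext_map_unit fB)
  finally show ?thesis by (simp add: trc_def to_ac_sum)
qed

text \<open>Over the closure, \<open>S\<close> is replaced by the span \<open>SE\<close> of the
  extended operators. Closure under brackets and vanishing of the trace form are bilinear
  conditions, so they hold on \<open>SE\<close> once they hold on generators; they are extended in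
  one argument at a time.\<close>

theorem cartan_nilpotent:
  fixes S :: "('b \<Rightarrow> 'b) set"
  assumes B: "fin_basis B W"
    and S: "\<And>a. a \<in> S \<Longrightarrow> endo a" "\<And>a v. a \<in> S \<Longrightarrow> v \<in> W \<Longrightarrow> a v \<in> W"
    and br: "\<And>a b. a \<in> S \<Longrightarrow> b \<in> S \<Longrightarrow> \<exists>c\<in>S. \<forall>v\<in>W. c v = ad a b v"
    and tr: "\<And>a b. a \<in> S \<Longrightarrow> b \<in> S \<Longrightarrow> trc B (\<lambda>v. a (b v)) = 0"
    and xS: "x \<in> S" and pq: "finite I" "\<And>i. i \<in> I \<Longrightarrow> p i \<in> S" "\<And>i. i \<in> I \<Longrightarrow> q i \<in> S"
    and xpq: "\<And>v. v \<in> W \<Longrightarrow> x v = (\<Sum>i\<in>I. ad (p i) (q i) v)"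
  shows "\<exists>N. \<forall>v\<in>W. (x ^^ N) v = 0"
proof -
  interpret E: vspace_ac ext_scale by (rule vspace_ac_ext)
  interpret O: vspace "\<lambda>c (f :: ('b \<Rightarrow> 'a alg_closure) \<Rightarrow> _) v. ext_scale c (f v)" by (rule E.vspace_endo_space)
  have fB: "finite B" and spB: "span B = W" using fin_basisD[OF B] by auto
  note sW = fin_basis_subspace[OF B]
  define M where "M = ext_map B"
  define D where "D = (unit_fun :: 'b \<Rightarrow> 'b \<Rightarrow> 'a alg_closure) ` B"
  note EB = ext_basis[OF fB, folded D_def]
  have ME: "E.endo (M T)" for T
    unfolding M_def ext_map_def
    by (intro E.endoI) (auto simp: fun_eq_iff algebra_simps sum.distrib sum_distrib_left)
  have Mad: "E.ad (M a) (M b) = M (ad a b)" if ab: "a \<in> S" "b \<in> S" for a b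
  proof
    fix v
    have "M (\<lambda>v. a (b v) - b (a v)) v = M (\<lambda>v. a (b v)) v - M (\<lambda>v. b (a v)) v"
      unfolding M_def by (rule ext_map_diff[OF B]) (auto intro: S ab)
    moreover have "M a (M b v) = M (\<lambda>v. a (b v)) v" "M b (M a v) = M (\<lambda>v. b (a v)) v"
      unfolding M_def using S[OF ab(1)] S[OF ab(2)] by (intro ext_map_comp[OF B]; blast)+
    ultimately show "E.ad (M a) (M b) v = M (ad a b) v" unfolding E.ad_def ad_def by simp
  qed
  define SE where "SE = O.span (M ` S)"
  have sSE: "O.subspace SE" unfolding SE_def by simp
  have SE: "E.endo a \<and> (\<forall>v. a v \<in> ext_carrier B)" if "a \<in> SE" for a
    using that unfolding SE_def
  proof (induction rule: O.span_induct_alt)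
    case base
    then show ?case by (auto intro!: E.endoI simp: ext_carrier_def)
  next
    case (step c T a)
    then obtain T' where T: "T = M T'" by auto
    have "E.endo T" "\<forall>v. T v \<in> ext_carrier B" unfolding T using ME ext_map_carrier unfolding M_def by auto
    then show ?case using step
      by (auto intro!: E.endoI simp: ext_carrier_def E.endo_add E.endo_scale fun_eq_iff algebra_simps)
  qed
  have gen: "M a \<in> SE" if "a \<in> S" for a unfolding SE_def using that by (auto intro: O.span_base)
  have ad1: "E.ad a (M b) \<in> SE" if a: "a \<in> SE" and b: "b \<in> S" for a b
    using a[unfolded SE_def]
  proof (induction rule: O.span_induct_alt)
    case base
    have "E.ad 0 (M b) = 0" by (auto simp: E.ad_def fun_eq_iff E.endo_zero[OF ME])
    then show ?case using O.subspace_0[OF sSE] by (simp only:)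
  next
    case (step c T a)
    then obtain t where t: "T = M t" "t \<in> S" by auto
    obtain u where u: "u \<in> S" "\<forall>v\<in>W. u v = ad t b v" using br[OF t(2) b] by blast
    have "E.ad T (M b) = M u"
      unfolding t(1) Mad[OF t(2) b] unfolding M_def using u fin_basis_base[OF B] by (intro ext_map_cong) auto
    then have "E.ad T (M b) \<in> SE" using gen u by simp
    moreover have "E.ad ((\<lambda>v. ext_scale c (T v)) + a) (M b) = (\<lambda>v. ext_scale c (E.ad T (M b) v)) + E.ad a (M b)"
      by (rule ext) (simp add: E.ad_def E.endo_add[OF ME] E.endo_scale[OF ME] fun_eq_iff algebra_simps)
    ultimately show ?case using step(2) by (simp only: O.subspace_add[OF sSE] O.subspace_scale[OF sSE])
  qed
  have ad2: "E.ad a b \<in> SE" if a: "a \<in> SE" and b: "b \<in> SE" for a b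
    using b[unfolded SE_def]
  proof (induction rule: O.span_induct_alt)
    case base
    have "E.ad a 0 = 0" using SE[OF a] by (auto simp: E.ad_def fun_eq_iff E.endo_zero)
    then show ?case using O.subspace_0[OF sSE] by (simp only:)
  next
    case (step c T b)
    then have "E.ad a T \<in> SE" using ad1[OF a] by auto
    moreover have "E.endo a" using SE[OF a] by blast
    then have "E.ad a ((\<lambda>v. ext_scale c (T v)) + b) = (\<lambda>v. ext_scale c (E.ad a T v)) + E.ad a b"
      by (intro ext) (simp add: E.ad_def E.endo_add E.endo_scale fun_eq_iff algebra_simps)
    ultimately show ?case using step(2) by (simp only: O.subspace_add[OF sSE] O.subspace_scale[OF sSE])
  qed
  have repz: "E.rep D (\<lambda>b. 0) = (\<lambda>_. 0)"
    using E.representation_zero[of D] by (simp add: zero_fun_def)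
  \<comment> \<open>Membership in \<open>SE\<close> is carried through the induction because
    additivity of the trace needs the values of \<open>a\<close> to lie in
    \<open>ext_carrier B\<close>.\<close>
  have tr1: "a \<in> SE \<and> E.trc D (\<lambda>v. a (M b v)) = 0" if a: "a \<in> SE" and b: "b \<in> S" for a b
    using a[unfolded SE_def]
  proof (induction rule: O.span_induct_alt)
    case base
    show ?case using O.subspace_0[OF sSE] by (simp add: E.trc_def repz zero_fun_def)
  next
    case (step c T a)
    then obtain t where t: "T = M t" "t \<in> S" by auto
    have aC: "\<And>v. a v \<in> ext_carrier B" "\<And>v. T v \<in> ext_carrier B"
      using SE step(2) gen t by auto
    have "M t (M b v) = M (\<lambda>v. t (b v)) v" for v
      unfolding M_def using S[OF t(2)] S[OF b] by (intro ext_map_comp[OF B]; blast)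
    then have "E.trc D (\<lambda>v. T (M b v)) = to_ac (trc B (\<lambda>v. t (b v)))"
      unfolding t(1) D_def M_def using trc_ext[OF B, of "\<lambda>v. t (b v)"] by simp
    then have T0: "E.trc D (\<lambda>v. T (M b v)) = 0" using tr[OF t(2) b] by simp
    have "E.trc D (\<lambda>v. ((\<lambda>v. ext_scale c (T v)) + a) (M b v))
        = E.trc D (\<lambda>v. ext_scale c (T (M b v)) + a (M b v))" by (simp only: plus_fun_apply)
    also have "\<dots> = E.trc D (\<lambda>v. ext_scale c (T (M b v))) + E.trc D (\<lambda>v. a (M b v))"
      by (rule E.trc_add[OF EB]) (use aC in \<open>auto simp: ext_carrier_def\<close>)
    also have "E.trc D (\<lambda>v. ext_scale c (T (M b v))) = c * E.trc D (\<lambda>v. T (M b v))"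
      by (rule E.trc_scale[OF EB]) (use aC in auto)
    finally have "E.trc D (\<lambda>v. ((\<lambda>v. ext_scale c (T v)) + a) (M b v)) = 0" using T0 step(2) by (simp only: mult_zero_right add_0_left)
    moreover have "(\<lambda>v. ext_scale c (T v)) + a \<in> SE"
      using step(2) gen[OF t(2)] t(1) by (simp only: O.subspace_add[OF sSE] O.subspace_scale[OF sSE])
    ultimately show ?case by blast
  qed
  have tr2: "b \<in> SE \<and> E.trc D (\<lambda>v. a (b v)) = 0" if a: "a \<in> SE" and b: "b \<in> SE" for a b
    using b[unfolded SE_def]
  proof (induction rule: O.span_induct_alt)
    case base
    have "a (\<lambda>b. 0) = (\<lambda>b. 0)" using E.endo_zero[of a] SE[OF a] by (simp add: zero_fun_def)
    then show ?case using O.subspace_0[OF sSE]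
      by (simp add: E.trc_def repz zero_fun_def)
  next
    case (step c T b)
    then obtain t where t: "T = M t" "t \<in> S" by auto
    have ea: "E.endo a" and aC: "\<And>v. a v \<in> ext_carrier B" using SE[OF a] by blast+
    have "E.trc D (\<lambda>v. a (((\<lambda>v. ext_scale c (T v)) + b) v))
        = E.trc D (\<lambda>v. ext_scale c (a (T v)) + a (b v))"
      by (simp only: plus_fun_apply E.endo_add[OF ea] E.endo_scale[OF ea])
    also have "\<dots> = E.trc D (\<lambda>v. ext_scale c (a (T v))) + E.trc D (\<lambda>v. a (b v))"
      by (rule E.trc_add[OF EB]) (use aC in \<open>auto simp: ext_carrier_def\<close>)
    also have "E.trc D (\<lambda>v. ext_scale c (a (T v))) = c * E.trc D (\<lambda>v. a (T v))"
      by (rule E.trc_scale[OF EB]) (use aC in auto)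
    finally have "E.trc D (\<lambda>v. a (((\<lambda>v. ext_scale c (T v)) + b) v)) = 0"
      using tr1[OF a t(2)] t(1) step(2) by (simp only: mult_zero_right add_0_left)
    moreover have "(\<lambda>v. ext_scale c (T v)) + b \<in> SE"
      using step(2) gen[OF t(2)] t(1) by (simp only: O.subspace_add[OF sSE] O.subspace_scale[OF sSE])
    ultimately show ?case by blast
  qed
  have Mx: "M x v = (\<Sum>i\<in>I. E.ad (M (p i)) (M (q i)) v)" for v
  proof -
    have "M x v = M (\<lambda>v. \<Sum>i\<in>I. ad (p i) (q i) v) v"
      unfolding M_def using xpq fin_basis_base[OF B] ext_map_cong[of B x "\<lambda>v. \<Sum>i\<in>I. ad (p i) (q i) v"] by auto
    also have "\<dots> = (\<Sum>i\<in>I. M (ad (p i) (q i)) v)"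
      unfolding M_def
    proof (rule ext_map_sum[OF B])
      fix i v assume i: "i \<in> I" and v: "v \<in> W"
      note pi = S(2)[OF pq(2)[OF i]] and qi = S(2)[OF pq(3)[OF i]]
      show "ad (p i) (q i) v \<in> W"
        unfolding ad_def by (rule subspace_diff[OF sW pi[OF qi[OF v]] qi[OF pi[OF v]]])
    qed
    finally show ?thesis by (simp add: Mad pq)
  qed
  have "\<exists>N. \<forall>v\<in>ext_carrier B. (M x ^^ N) v = 0"
  proof (rule E.cartan_nilpotent_ac[OF EB, of SE "M x" I "\<lambda>i. M (p i)" "\<lambda>i. M (q i)"])
    show "\<exists>c\<in>SE. \<forall>v\<in>ext_carrier B. c v = E.ad a b v" if "a \<in> SE" "b \<in> SE" for a b
      using ad2[OF that] by blast
    show "O.subspace SE" by (rule sSE)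
    show "E.endo a" if "a \<in> SE" for a using SE[OF that] by blast
    show "a v \<in> ext_carrier B" if "a \<in> SE" for a v using SE[OF that] by blast
    show "E.trc D (\<lambda>v. a (b v)) = 0" if "a \<in> SE" "b \<in> SE" for a b using tr2[OF that] by blast
    show "M x \<in> SE" by (rule gen[OF xS])
    show "finite I" by (rule pq)
    show "M (p i) \<in> SE" "M (q i) \<in> SE" if "i \<in> I" for i using that by (intro gen pq; assumption)+
    show "M x v = (\<Sum>i\<in>I. E.ad (M (p i)) (M (q i)) v)" for v by (rule Mx)
  qed
  then obtain N where N: "\<And>v. v \<in> ext_carrier B \<Longrightarrow> (M x ^^ N) v = 0" by auto
  have "(x ^^ N) b = 0" if b: "b \<in> B" for b
  proof -
    have "unit_fun b \<in> ext_carrier B" using b by (auto simp: unit_fun_def ext_carrier_def)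
    then have "to_ac (rep B ((x ^^ N) b) c) = 0" for c
      using N ext_map_pow_unit[OF B S[OF xS] b, of N c] unfolding M_def by simp
    then have "rep B ((x ^^ N) b) c = 0" for c by simp
    moreover have "(x ^^ N) b \<in> W" by (rule compow_in[of W x b N, OF S(2)[OF xS] fin_basis_base[OF B b]])
    ultimately show ?thesis using rep_sum[OF B, of "(x ^^ N) b"] by simp
  qed
  then have "(x ^^ N) v = 0" if "v \<in> W" for v
    using that spB endo_eq_on_span[OF endo_compow[OF S(1)[OF xS]] endo_zero_map] by blast
  then show ?thesis by blast
qed

end

section \<open>Engel's theorem\<close>

context vspace
begin

lemma dim_fin_basis: "fin_basis B W \<Longrightarrow> dim W = card B"
  unfolding fin_basis_def using dim_span_eq_card_independent by auto

lemma dim_psubset_fin: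
  assumes "fin_basis B W" "subspace V" "V \<subset> W"
  shows "dim V < dim W"
  using fin_basis_psubset[OF assms] dim_fin_basis assms(1) by auto

lemma descending_stable:
  assumes B: "fin_basis B W" and "\<And>k. subspace (D k)" "\<And>k. D k \<subseteq> W" "\<And>k. D (Suc k) \<subseteq> D k"
  shows "\<exists>k. D (Suc k) = D k"
proof (rule ccontr)
  assume no: "\<nexists>k. D (Suc k) = D k"
  have "dim (D k) + k \<le> card B" for k
  proof (induction k)
    case 0
    show ?case using assms(3)[of 0] B dim_le_card[of "D 0" B] unfolding fin_basis_def by auto
  next
    case (Suc k)
    obtain B' where "fin_basis B' (D k)"
      using fin_basis_exists[of "D k" B] assms(2,3) B unfolding fin_basis_def by auto
    then have "dim (D (Suc k)) < dim (D k)"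
      using no assms(2,4) by (intro dim_psubset_fin) auto
    then show ?case using Suc by simp
  qed
  from this[of "Suc (card B)"] show False by simp
qed

end

locale semisimple_leibniz = vspace_0 sL
  for sL :: "'f::field_char_0 \<Rightarrow> 'l::ab_group_add \<Rightarrow> 'l" +
  fixes mult :: "'l \<Rightarrow> 'l \<Rightarrow> 'l" (infixl "\<bullet>" 75)
  assumes leibniz_alg: "leibniz_algebra sL mult"
    and fin_dim_L: "fin_dim sL" and semisimple_L: "semisimple sL mult"
begin

lemma endo_mult: "endo (mult x)" and endo_mult_left: "endo (\<lambda>x. x \<bullet> y)"
  using leibniz_alg unfolding leibniz_algebra_def bilin_def by blast+

lemmas mult_simps =
  endo_add[OF endo_mult] endo_scale[OF endo_mult] endo_zero[OF endo_mult] endo_diff[OF endo_mult]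
  endo_add[OF endo_mult_left] endo_scale[OF endo_mult_left] endo_zero[OF endo_mult_left] endo_diff[OF endo_mult_left]

lemma leibniz: "x \<bullet> (y \<bullet> z) = (x \<bullet> y) \<bullet> z + y \<bullet> (x \<bullet> z)"
  using leibniz_alg unfolding leibniz_algebra_def by blast

lemma leibniz': "(x \<bullet> y) \<bullet> z = x \<bullet> (y \<bullet> z) - y \<bullet> (x \<bullet> z)"
  unfolding leibniz[of x y z] by (rule add_diff_cancel[symmetric])

definition LB :: "'l set" where "LB = (SOME B. fin_basis B UNIV)"

lemma LB: "fin_basis LB UNIV"
proof -
  obtain G where "finite G" "span G = UNIV" using fin_dim_L unfolding fin_dim_def by auto
  then have "\<exists>B. fin_basis B UNIV" using fin_basis_exists[of UNIV G] by simp
  then show ?thesis unfolding LB_def by (rule someI_ex)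
qed

lemma subspace_basis: "subspace V \<Longrightarrow> \<exists>B. fin_basis B V"
  using fin_basis_exists[of V LB] LB unfolding fin_basis_def by simp

lemma dim_less: "subspace V \<Longrightarrow> subspace W \<Longrightarrow> V \<subset> W \<Longrightarrow> dim V < dim W"
  using subspace_basis dim_psubset_fin by blast

section \<open>The Leibniz kernel under semisimplicity\<close>

abbreviation "K \<equiv> leib_kernel sL mult"
abbreviation "ideal_L \<equiv> is_ideal sL mult"

lemma idealI:
  "subspace I \<Longrightarrow> (\<And>x y. y \<in> I \<Longrightarrow> x \<bullet> y \<in> I) \<Longrightarrow> (\<And>x y. y \<in> I \<Longrightarrow> y \<bullet> x \<in> I) \<Longrightarrow> ideal_L I"
  unfolding is_ideal_def by auto

lemma idealD:
  assumes "ideal_L I"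
  shows "subspace I" "y \<in> I \<Longrightarrow> x \<bullet> y \<in> I" "y \<in> I \<Longrightarrow> y \<bullet> x \<in> I"
  using assms unfolding is_ideal_def by auto

lemma solvable_ideal_kernel: "ideal_L I \<Longrightarrow> derived sL mult I k = {0} \<Longrightarrow> I \<subseteq> K"
  using semisimple_L unfolding semisimple_def solvable_set_def by blast

lemma kernel_mult: "k \<in> K \<Longrightarrow> k \<bullet> x = 0"
  unfolding leib_kernel_def
  by (induction rule: span_induct_alt) (auto simp: mult_simps leibniz')

lemma kernel_eq: "K = {x. \<forall>y. x \<bullet> y = 0}" (is "_ = ?A")
proof
  show "K \<subseteq> ?A" using kernel_mult by auto
  have "derived sL mult ?A 1 = span {x \<bullet> y |x y. x \<in> ?A \<and> y \<in> ?A}" by simp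
  also have "\<dots> \<subseteq> {0}" by (rule span_minimal) auto
  finally have "derived sL mult ?A 1 = {0}" using span_zero by auto
  moreover have "ideal_L ?A"
    by (rule idealI) (auto intro!: subspaceI simp: mult_simps leibniz')
  ultimately show "?A \<subseteq> K" by (rule solvable_ideal_kernel[rotated])
qed

lemma ideal_kernel: "ideal_L K"
  unfolding kernel_eq by (rule idealI) (auto intro!: subspaceI simp: mult_simps leibniz')

lemmas kernelD = idealD[OF ideal_kernel]

lemma square_in_kernel: "x \<bullet> x \<in> K"
  unfolding leib_kernel_def by (rule span_base) auto

lemma anticomm_in_kernel: "x \<bullet> y + y \<bullet> x \<in> K"
proof -
  have "(x + y) \<bullet> (x + y) - x \<bullet> x - y \<bullet> y \<in> K"
    by (intro subspace_diff kernelD square_in_kernel)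
  then show ?thesis by (simp add: mult_simps add.commute)
qed

text \<open>In terms of the Lie quotient: its centre is zero. The elements \<open>x\<close> with
  \<open>x L \<subseteq> K\<close> form an ideal whose products lie in \<open>K\<close>, and
  \<open>K K = 0\<close>, so its second derived ideal vanishes.\<close>

lemma mult_into_kernel:
  assumes "\<And>y. x \<bullet> y \<in> K"
  shows "x \<in> K"
proof -
  let ?Z = "{x. \<forall>y. x \<bullet> y \<in> K}"
  let ?D = "derived sL mult ?Z"
  have "?D 1 = span {x \<bullet> y |x y. x \<in> ?Z \<and> y \<in> ?Z}" by simp
  also have "\<dots> \<subseteq> K" by (rule span_minimal[OF _ kernelD(1)]) auto
  finally have sub: "?D 1 \<subseteq> K" .
  have "?D 2 = span {x \<bullet> y |x y. x \<in> ?D 1 \<and> y \<in> ?D 1}" by (simp add: numeral_2_eq_2)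
  also have "\<dots> \<subseteq> {0}" by (rule span_minimal) (use sub kernel_mult in auto)
  finally have "?D 2 = {0}" using span_zero by (auto simp: numeral_2_eq_2)
  moreover have "ideal_L ?Z"
    by (rule idealI)
       (auto intro!: subspaceI simp: mult_simps leibniz' subspace_add[OF kernelD(1)] subspace_scale[OF kernelD(1)]
          subspace_diff[OF kernelD(1)] subspace_0[OF kernelD(1)] kernelD(2))
  ultimately have "?Z \<subseteq> K" by (rule solvable_ideal_kernel[rotated])
  then show ?thesis using assms by auto
qed

text \<open>Engel's theorem for left multiplications on \<open>U / V\<close>. What counts is the
  image of \<open>D\<close> in the operators on \<open>U / V\<close>, with kernel \<open>D0\<close>,
  so a maximal proper subalgebra \<open>A\<close> is chosen among those containing
  \<open>D0\<close>. Induction for \<open>A\<close> acting on \<open>D / A\<close> gives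
  \<open>y\<close> normalising \<open>A\<close>, whence \<open>D\<close> is \<open>A\<close> plus
  the multiples of \<open>y\<close>. A second induction, for \<open>A\<close> on
  \<open>U / V\<close>, leaves only \<open>y\<close> to be dealt with.\<close>

lemma engel:
  assumes "subspace D" "\<And>x y. x \<in> D \<Longrightarrow> y \<in> D \<Longrightarrow> x \<bullet> y \<in> D"
    and "subspace U" "subspace V" "V \<subset> U"
    and "\<And>x u. x \<in> D \<Longrightarrow> u \<in> U \<Longrightarrow> x \<bullet> u \<in> U" "\<And>x u. x \<in> D \<Longrightarrow> u \<in> V \<Longrightarrow> x \<bullet> u \<in> V"
    and "\<And>x. x \<in> D \<Longrightarrow> \<exists>N. \<forall>u\<in>U. (mult x ^^ N) u \<in> V"
  shows "\<exists>w. w \<in> U \<and> w \<notin> V \<and> (\<forall>x\<in>D. x \<bullet> w \<in> V)"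
  using assms
proof (induction "dim D" arbitrary: D U V rule: less_induct)
  case less
  note sD = less.prems(1) and DD = less.prems(2) and sU = less.prems(3) and sV = less.prems(4)
    and VU = less.prems(5) and DU = less.prems(6) and DV = less.prems(7) and nil = less.prems(8)
  define D0 where "D0 = {x\<in>D. \<forall>u\<in>U. x \<bullet> u \<in> V}"
  show ?case
  proof (cases "D0 = D")
    case True
    obtain w where w: "w \<in> U" "w \<notin> V" using psubset_imp_ex_mem[OF VU] by auto
    have "x \<bullet> w \<in> V" if "x \<in> D" for x
    proof -
      have "x \<in> D0" unfolding True by (rule that)
      then show ?thesis using w(1) unfolding D0_def by simp
    qed
    with w show ?thesis by blast
  next
    case False
    define P where "P A \<longleftrightarrow> subspace A \<and> (\<forall>x\<in>A. \<forall>y\<in>A. x \<bullet> y \<in> A) \<and> D0 \<subseteq> A \<and> A \<subset> D" for A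
    have "subspace D0"
      unfolding D0_def using subspace_0[OF sD] subspace_0[OF sV] sD sV
      by (intro subspaceI) (auto simp: mult_simps intro: subspace_add subspace_scale)
    moreover have "x \<bullet> y \<in> D0" if xy: "x \<in> D0" "y \<in> D0" for x y
    proof -
      have xD: "x \<in> D" "y \<in> D" using xy unfolding D0_def by auto
      have "(x \<bullet> y) \<bullet> u \<in> V" if "u \<in> U" for u
      proof -
        have "x \<bullet> (y \<bullet> u) \<in> V" "y \<bullet> (x \<bullet> u) \<in> V"
          using xy DU[OF xD(1) that] DU[OF xD(2) that] unfolding D0_def by simp_all
        then show ?thesis unfolding leibniz' by (rule subspace_diff[OF sV])
      qed
      then show ?thesis using DD[OF xD] unfolding D0_def by simp
    qed
    moreover have "D0 \<subset> D" using False unfolding D0_def by blast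
    ultimately have "P D0" unfolding P_def by simp
    moreover have "dim A < dim D" if "P A" for A
      using that dim_less sD unfolding P_def by auto
    ultimately obtain A where A: "P A" and max: "\<And>A'. P A' \<Longrightarrow> dim A' \<le> dim A"
      using ex_has_greatest_nat[of P D0 dim "dim D"] by (metis less_imp_le)
    then have sA: "subspace A" and AA: "\<And>x y. x \<in> A \<Longrightarrow> y \<in> A \<Longrightarrow> x \<bullet> y \<in> A"
      and D0A: "D0 \<subseteq> A" and AD: "A \<subset> D" unfolding P_def by auto
    have dimA: "dim A < dim D" using dim_less sA sD AD by blast
    have "\<exists>y. y \<in> D \<and> y \<notin> A \<and> (\<forall>x\<in>A. x \<bullet> y \<in> A)"
    proof (rule less.hyps[OF dimA sA AA sD sA AD])
      show "x \<bullet> u \<in> D" if "x \<in> A" "u \<in> D" for x u using that AD DD by auto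
      show "x \<bullet> u \<in> A" if "x \<in> A" "u \<in> A" for x u using that AA by auto
      show "\<exists>N. \<forall>u\<in>D. (mult x ^^ N) u \<in> A" if x: "x \<in> A" for x
      proof -
        have xD: "x \<in> D" using x AD by auto
        obtain N where N: "\<And>u. u \<in> U \<Longrightarrow> (mult x ^^ N) u \<in> V" using nil[OF xD] by auto
        have powU: "(mult x ^^ j) u \<in> U" if "u \<in> U" for j u
          using DU[OF xD] that by (rule compow_in)
        have powV: "(mult x ^^ j) u \<in> V" if "u \<in> V" for j u
          using DV[OF xD] that by (rule compow_in)
        have powD: "(mult x ^^ j) u \<in> D" if "u \<in> D" for j u
          using DD[OF xD] that by (rule compow_in)
        have ge: "(mult x ^^ j) u \<in> V" if "u \<in> U" "N \<le> j" for j u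
        proof -
          have "(mult x ^^ (j - N)) ((mult x ^^ N) u) \<in> V" by (intro powV N that)
          then show ?thesis using that(2) by (metis comp_apply funpow_add le_add_diff_inverse2)
        qed
        \<comment> \<open>Left multiplication by \<open>(mult x ^^ k) y\<close> is an iterated
          commutator, so for \<open>k \<ge> 2 * N\<close> every term has at least \<open>N\<close>
          factors \<open>x\<close> before or after \<open>y\<close>. Hence
          \<open>mult x ^^ (2 * N)\<close> maps \<open>D\<close> into \<open>D0\<close>, which gives
          nilpotency on \<open>D / A\<close>.\<close>
        have *: "(mult x ^^ i) (((mult x ^^ k) y) \<bullet> ((mult x ^^ j) u)) \<in> V"
          if "u \<in> U" "y \<in> D" "2 * N \<le> i + j + k" for i j k u y
          using that(3)
        proof (induction k arbitrary: i j)
          case 0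
          then consider "N \<le> j" | "N \<le> i" by linarith
          then show ?case
          proof cases
            case 1
            then show ?thesis using ge[OF that(1) 1] DV[OF that(2)] powV by simp
          next
            case 2
            then show ?thesis using ge[OF DU[OF that(2) powU[OF that(1)]] 2] by simp
          qed
        next
          case (Suc k)
          let ?y = "(mult x ^^ k) y" and ?u = "(mult x ^^ j) u"
          have "((mult x ^^ Suc k) y) \<bullet> ?u = x \<bullet> (?y \<bullet> ?u) - ?y \<bullet> ((mult x ^^ Suc j) u)"
            by (simp add: leibniz')
          then have "(mult x ^^ i) (((mult x ^^ Suc k) y) \<bullet> ?u)
              = (mult x ^^ i) (x \<bullet> (?y \<bullet> ?u)) - (mult x ^^ i) (?y \<bullet> ((mult x ^^ Suc j) u))"
            by (simp only: endo_diff[OF endo_compow[OF endo_mult]])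
          also have "(mult x ^^ i) (x \<bullet> (?y \<bullet> ?u)) = (mult x ^^ Suc i) (?y \<bullet> ?u)"
            by (simp add: funpow_swap1)
          also have "(mult x ^^ Suc i) (?y \<bullet> ?u) - (mult x ^^ i) (?y \<bullet> ((mult x ^^ Suc j) u)) \<in> V"
            using Suc.IH[of "Suc i" j] Suc.IH[of i "Suc j"] Suc.prems by (intro subspace_diff[OF sV]) auto
          finally show ?case .
        qed
        have "(mult x ^^ (2 * N)) y \<in> A" if y: "y \<in> D" for y
        proof -
          have "((mult x ^^ (2 * N)) y) \<bullet> u \<in> V" if "u \<in> U" for u
            using *[OF that y, of 0 0 "2 * N"] by simp
          then show ?thesis using powD[OF y] D0A unfolding D0_def by auto
        qed
        then show ?thesis by blast
      qed
    qed
    then obtain y where y: "y \<in> D" "y \<notin> A" "\<And>x. x \<in> A \<Longrightarrow> x \<bullet> y \<in> A" by auto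
    \<comment> \<open>Elements of \<open>K\<close> multiply everything to zero, so those in
      \<open>D\<close> lie in \<open>D0\<close> and thus in \<open>A\<close>. This applies to
      \<open>y \<bullet> y\<close> and to \<open>x \<bullet> y + y \<bullet> x\<close>, so that
      \<open>y\<close> normalises \<open>A\<close> from both sides.\<close>
    have KD: "k \<in> A" if "k \<in> K" "k \<in> D" for k
      using that kernel_mult[OF that(1)] subspace_0[OF sV] D0A unfolding D0_def by auto
    have yA: "y \<bullet> x \<in> A" if x: "x \<in> A" for x
    proof -
      have "x \<bullet> y + y \<bullet> x \<in> A"
        using anticomm_in_kernel x AD y(1) DD by (intro KD subspace_add[OF sD]) auto
      then have "x \<bullet> y + y \<bullet> x - x \<bullet> y \<in> A" using y(3)[OF x] by (rule subspace_diff[OF sA])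
      then show ?thesis by simp
    qed
    have yy: "y \<bullet> y \<in> A" by (intro KD square_in_kernel DD y)
    define A' where "A' = span (insert y A)"
    have A'_iff: "z \<in> A' \<longleftrightarrow> (\<exists>c a. a \<in> A \<and> z = a + sL c y)" for z
      unfolding A'_def span_breakdown_eq using sA
      by (metis add_diff_cancel diff_add_cancel span_eq_iff)
    have "A' = D"
    proof (rule ccontr)
      assume "A' \<noteq> D"
      have "A' \<subseteq> D" unfolding A'_def using sD AD y(1) by (intro span_minimal) auto
      moreover have "u \<bullet> v \<in> A'" if uv: "u \<in> A'" "v \<in> A'" for u v
      proof -
        obtain a b c d where "a \<in> A" "b \<in> A" "u = a + sL c y" "v = b + sL d y"
          using uv unfolding A'_iff by auto
        then have "u \<bullet> v \<in> A"
          by (simp add: mult_simps)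
             (intro subspace_add[OF sA] subspace_scale[OF sA] AA y(3) yA yy; assumption)
        then show ?thesis unfolding A'_def by (auto intro: span_base)
      qed
      moreover have "A \<subseteq> A'" unfolding A'_def by (auto intro: span_base)
      ultimately have "P A'" unfolding P_def using \<open>A' \<noteq> D\<close> D0A by (auto simp: A'_def)
      moreover have "A \<subset> A'" using \<open>A \<subseteq> A'\<close> y(2) span_base[of y "insert y A"] unfolding A'_def by auto
      then have "dim A < dim A'" using sA by (intro dim_less) (auto simp: A'_def)
      ultimately show False using max by fastforce
    qed
    have "\<exists>w. w \<in> U \<and> w \<notin> V \<and> (\<forall>x\<in>A. x \<bullet> w \<in> V)"
      using DU DV nil AD by (intro less.hyps[OF dimA sA AA sU sV VU]) auto
    then obtain w where w: "w \<in> U" "w \<notin> V" "\<And>x. x \<in> A \<Longrightarrow> x \<bullet> w \<in> V" by auto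
    define U0 where "U0 = {u\<in>U. \<forall>x\<in>A. x \<bullet> u \<in> V}"
    have yU0: "y \<bullet> u \<in> U0" if u: "u \<in> U0" for u
    proof -
      have "x \<bullet> (y \<bullet> u) \<in> V" if "x \<in> A" for x
        unfolding leibniz[of x y u] using u y that DV unfolding U0_def by (intro subspace_add[OF sV]) auto
      then show ?thesis using u DU[OF y(1)] unfolding U0_def by auto
    qed
    obtain N where N: "(mult y ^^ N) w \<in> V" using nil[OF y(1)] w(1) by auto
    \<comment> \<open>The last power of \<open>y\<close> that keeps \<open>w\<close> outside
      \<open>V\<close> is sent into \<open>V\<close> by \<open>y\<close>, and still by
      \<open>A\<close>, because \<open>U0\<close> is stable under \<open>y\<close>.\<close>
    define n where "n = (LEAST n. (mult y ^^ n) w \<in> V)"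
    have n: "(mult y ^^ n) w \<in> V" unfolding n_def by (rule LeastI[of _ N]) (rule N)
    then obtain m where m: "n = Suc m" using w(2) by (cases n) auto
    have "(mult y ^^ m) w \<notin> V"
      using not_less_Least[of m "\<lambda>n. (mult y ^^ n) w \<in> V"] m unfolding n_def by auto
    moreover have mU: "(mult y ^^ m) w \<in> U0"
      by (rule compow_in[OF yU0]) (use w in \<open>auto simp: U0_def\<close>)
    moreover have "z \<bullet> (mult y ^^ m) w \<in> V" if z: "z \<in> D" for z
    proof -
      obtain c a where "a \<in> A" "z = a + sL c y" using z \<open>A' = D\<close> A'_iff by auto
      then show ?thesis using mU n unfolding m U0_def
        by (auto simp: mult_simps intro!: subspace_add[OF sV] subspace_scale[OF sV])
    qed
    ultimately show ?thesis unfolding U0_def by auto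
  qed
qed

section \<open>Ideals whose products act nilpotently\<close>

definition prods :: "'l set \<Rightarrow> 'l set" where
  "prods J = span {x \<bullet> y |x y. x \<in> J \<and> y \<in> J}"

lemma ideal_prods:
  assumes "ideal_L J"
  shows "ideal_L (prods J)"
proof (rule idealI)
  note J = idealD[OF assms]
  have s: "subspace (prods J)" unfolding prods_def by simp
  show "subspace (prods J)" by (rule s)
  have b: "x \<bullet> y \<in> prods J" if "x \<in> J" "y \<in> J" for x y
    unfolding prods_def using that by (intro span_base) auto
  show "z \<bullet> x \<in> prods J" if "x \<in> prods J" for x z
    using that[unfolded prods_def]
  proof (induction rule: span_induct_alt)
    case (step c u v)
    then obtain x y where xy: "u = x \<bullet> y" "x \<in> J" "y \<in> J" by auto
    have "z \<bullet> u \<in> prods J"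
      unfolding xy(1) leibniz[of z x y] by (intro subspace_add[OF s] b J(2) xy)
    then show ?case using step by (simp add: mult_simps subspace_add[OF s] subspace_scale[OF s])
  qed (simp add: mult_simps subspace_0[OF s])
  show "x \<bullet> z \<in> prods J" if "x \<in> prods J" for x z
    using that[unfolded prods_def]
  proof (induction rule: span_induct_alt)
    case (step c u v)
    then obtain x y where xy: "u = x \<bullet> y" "x \<in> J" "y \<in> J" by auto
    have "u \<bullet> z \<in> prods J"
      unfolding xy(1) leibniz'[of x y z] by (intro subspace_diff[OF s] b J(3) xy)
    then show ?case using step by (simp add: mult_simps subspace_add[OF s] subspace_scale[OF s])
  qed (simp add: mult_simps subspace_0[OF s])
qed

text \<open>The derived series stabilises at some \<open>D = DD\<close>. Were
  \<open>V = {v. D v \<subseteq> K}\<close> proper, Engel's theorem would give \<open>w\<close>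
  outside \<open>V\<close> with \<open>D w \<subseteq> V\<close>; but then
  \<open>(DD) w \<subseteq> K\<close>, so \<open>w\<close> is in \<open>V\<close>. Hence
  \<open>D L \<subseteq> K\<close>, which forces \<open>D \<subseteq> K\<close> and
  \<open>D = DD = 0\<close>, and \<open>J\<close> is solvable.\<close>

lemma nilpotent_prods_kernel:
  assumes J: "ideal_L J" and nil: "\<And>x. x \<in> prods J \<Longrightarrow> \<exists>N. \<forall>y. (mult x ^^ N) y \<in> K"
  shows "J \<subseteq> K"
proof -
  let ?D = "derived sL mult J"
  have Dsuc: "?D (Suc k) = prods (?D k)" for k by (simp add: prods_def)
  have Did: "ideal_L (?D k)" for k
    by (induction k) (use J ideal_prods Dsuc in \<open>auto simp del: derived.simps(2)\<close>)
  have dec: "?D (Suc k) \<subseteq> ?D k" for k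
    unfolding Dsuc prods_def using idealD[OF Did[of k]] by (intro span_minimal) auto
  have D1: "?D (Suc k) \<subseteq> prods J" for k
  proof (induction k)
    case (Suc k)
    then show ?case using dec[of "Suc k"] by blast
  qed (simp add: prods_def)
  obtain k where k: "?D (Suc k) = ?D k"
    using descending_stable[OF LB, of ?D] idealD(1)[OF Did] dec by auto
  define D where "D = ?D k"
  have Dp: "D = prods D" using k Dsuc[of k] unfolding D_def by simp
  have D: "ideal_L D" using Did D_def by simp
  note sD = idealD[OF D]
  \<comment> \<open>Equality of two consecutive terms covers \<open>k = 0\<close> as well, where
    \<open>D\<close> is \<open>J\<close> itself.\<close>
  have DJ: "D \<subseteq> prods J" using D1[of k] k unfolding D_def by auto
  note sK = kernelD(1)
  define V where "V = {v. \<forall>x\<in>D. x \<bullet> v \<in> K}"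
  have sV: "subspace V" unfolding V_def
    by (rule subspaceI) (auto simp: mult_simps subspace_0[OF sK] intro: subspace_add[OF sK] subspace_scale[OF sK])
  have KV: "K \<subseteq> V" unfolding V_def using kernelD(2) by auto
  have "V = UNIV"
  proof (rule ccontr)
    assume "V \<noteq> UNIV"
    have "\<exists>w. w \<in> UNIV \<and> w \<notin> V \<and> (\<forall>x\<in>D. x \<bullet> w \<in> V)"
    proof (rule engel[OF sD(1) _ _ sV])
      show "x \<bullet> u \<in> V" if "x \<in> D" "u \<in> V" for x u
        using that kernelD(2) unfolding V_def by auto
      show "\<exists>N. \<forall>u\<in>UNIV. (mult x ^^ N) u \<in> V" if "x \<in> D" for x
        using nil[of x] that DJ KV by blast
    qed (use sD \<open>V \<noteq> UNIV\<close> in auto)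
    then obtain w where w: "w \<notin> V" "\<And>x. x \<in> D \<Longrightarrow> x \<bullet> w \<in> V" by auto
    have "x \<bullet> w \<in> K" if "x \<in> prods D" for x
      using that[unfolded prods_def]
    proof (induction rule: span_induct_alt)
      case (step c u v)
      then have "u \<bullet> w \<in> K" using w(2) unfolding V_def by (auto simp: leibniz' intro!: subspace_diff[OF sK])
      then show ?case using step by (simp add: mult_simps subspace_add[OF sK] subspace_scale[OF sK])
    qed (simp add: mult_simps subspace_0[OF sK])
    then have "w \<in> V" unfolding V_def using Dp by auto
    then show False using w by simp
  qed
  have "D \<subseteq> K"
  proof
    fix x assume x: "x \<in> D"
    have "x \<bullet> y \<in> K" for y
    proof -
      have "y \<in> V" using \<open>V = UNIV\<close> by simp
      then show ?thesis using x unfolding V_def by simp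
    qed
    then show "x \<in> K" by (rule mult_into_kernel)
  qed
  then have "prods D \<subseteq> {0}" unfolding prods_def by (intro span_minimal) (auto simp: kernel_mult subset_iff)
  then have "?D k = {0}" using Dp sD(1) subspace_0 unfolding D_def by auto
  then show ?thesis using solvable_ideal_kernel[OF J] by blast
qed

end

section \<open>Trace forms and the Killing form\<close>

context vspace_0
begin

text \<open>Gram-Schmidt with anisotropic vectors for a form that may be degenerate: what the
  projection leaves over lies in the radical of the form on \<open>I\<close>. Pairwise orthogonality
  makes the vectors \<open>a / \<beta> a a\<close> dual to the vectors \<open>a\<close>.\<close>

lemma orthogonal_set:
  assumes "fin_basis B I"
    and add: "\<And>x y z. \<beta> (x + y) z = \<beta> x z + \<beta> y z" and scl: "\<And>c x z. \<beta> (scale c x) z = c * \<beta> x z"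
    and sym: "\<And>x y. \<beta> x y = \<beta> y x"
  shows "\<exists>A. finite A \<and> A \<subseteq> I \<and> (\<forall>a\<in>A. \<beta> a a \<noteq> 0) \<and> (\<forall>a\<in>A. \<forall>b\<in>A. a \<noteq> b \<longrightarrow> \<beta> a b = 0) \<and>
    (\<forall>x\<in>I. \<forall>z\<in>I. \<beta> (x - (\<Sum>a\<in>A. scale (\<beta> x a / \<beta> a a) a)) z = 0)"
  using assms(1)
proof (induction "card B" arbitrary: B I rule: less_induct)
  case less
  note sI = fin_basis_subspace[OF less.prems]
  have addr: "\<beta> x (y + z) = \<beta> x y + \<beta> x z" for x y z by (simp add: sym[of x] add)
  have sclr: "\<beta> x (scale c y) = c * \<beta> x y" for x y c by (simp add: sym[of x] scl)
  have zero: "\<beta> 0 z = 0" for z using scl[of 0 0 z] by simp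
  have diff: "\<beta> (x - y) z = \<beta> x z - \<beta> y z" for x y z
    using add[of "x - y" y z] by simp
  show ?case
  proof (cases "\<forall>e\<in>I. \<beta> e e = 0")
    case True
    have "\<beta> x z = 0" if "x \<in> I" "z \<in> I" for x z
    proof -
      have "\<beta> (x + z) (x + z) = 0" using True subspace_add[OF sI that] by blast
      \<comment> \<open>Polarisation; 2 is invertible in characteristic zero.\<close>
      then have "2 * \<beta> x z = 0" using True that by (simp add: add addr sym[of z x])
      then show ?thesis by simp
    qed
    then show ?thesis by (intro exI[of _ "{}"]) auto
  next
    case False
    then obtain e where e: "e \<in> I" "\<beta> e e \<noteq> 0" by auto
    define I' where "I' = {z\<in>I. \<beta> z e = 0}"
    have sI': "subspace I'" unfolding I'_def
      using subspace_0[OF sI] subspace_add[OF sI] subspace_scale[OF sI]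
      by (intro subspaceI) (auto simp: zero add scl)
    have "I' \<subset> I" using e unfolding I'_def by auto
    then obtain B' where B': "fin_basis B' I'" "card B' < card B"
      using fin_basis_psubset[OF less.prems sI'] by auto
    obtain A where A: "finite A" "A \<subseteq> I'" "\<forall>a\<in>A. \<beta> a a \<noteq> 0" "\<forall>a\<in>A. \<forall>b\<in>A. a \<noteq> b \<longrightarrow> \<beta> a b = 0"
      and Ax: "\<forall>x\<in>I'. \<forall>z\<in>I'. \<beta> (x - (\<Sum>a\<in>A. scale (\<beta> x a / \<beta> a a) a)) z = 0"
      using less.hyps[OF B'(2,1)] by auto
    have eA: "e \<notin> A" using A(2) e unfolding I'_def by auto
    have Ae: "\<beta> a e = 0" "\<beta> e a = 0" if "a \<in> A" for a
      using that A(2) sym[of e a] unfolding I'_def by auto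
    have proj: "z - scale (\<beta> z e / \<beta> e e) e \<in> I'" if "z \<in> I" for z
      unfolding I'_def using that e by (auto simp: diff scl intro!: subspace_diff[OF sI] subspace_scale[OF sI])
    have main: "\<beta> (x - (\<Sum>a\<in>insert e A. scale (\<beta> x a / \<beta> a a) a)) z = 0" if x: "x \<in> I" and z: "z \<in> I" for x z
    proof -
      define x' where "x' = x - scale (\<beta> x e / \<beta> e e) e"
      define z' where "z' = z - scale (\<beta> z e / \<beta> e e) e"
      have x'I: "x' \<in> I'" and z'I: "z' \<in> I'" unfolding x'_def z'_def using proj x z by auto
      define y where "y = x' - (\<Sum>a\<in>A. scale (\<beta> x' a / \<beta> a a) a)"
      have "\<beta> x' a = \<beta> x a" if "a \<in> A" for a unfolding x'_def using Ae[OF that] by (simp add: diff scl)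
      then have y: "x - (\<Sum>a\<in>insert e A. scale (\<beta> x a / \<beta> a a) a) = y"
        unfolding y_def x'_def[symmetric] using A(1) eA by (simp add: x'_def algebra_simps)
      have "y \<in> I'" unfolding y_def using x'I A(2)
        by (intro subspace_diff[OF sI'] subspace_sum[OF sI'] subspace_scale[OF sI']) auto
      then have "\<beta> y e = 0" unfolding I'_def by simp
      moreover have "\<beta> y z' = 0" using Ax x'I z'I unfolding y_def by auto
      moreover have "z = z' + scale (\<beta> z e / \<beta> e e) e" unfolding z'_def by simp
      ultimately have "\<beta> y z = 0" by (metis addr sclr add_0_left mult_zero_right)
      then show ?thesis unfolding y .
    qed
    have "I' \<subseteq> I" unfolding I'_def by auto
    with A e eA Ae main show ?thesis by (intro exI[of _ "insert e A"]) auto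
  qed
qed

end

text \<open>Linearity in the algebra argument is required on \<open>W\<close> only, because the
  action \<open>th\<close> on functions on lists is linear in that argument only on
  cochains.\<close>

locale leibniz_rep = semisimple_leibniz sL mult + M: vspace_0 sM
  for sL :: "'f::field_char_0 \<Rightarrow> 'l::ab_group_add \<Rightarrow> 'l" and mult (infixl "\<bullet>" 75)
    and sM :: "'f \<Rightarrow> 'm::ab_group_add \<Rightarrow> 'm" +
  fixes act :: "'l \<Rightarrow> 'm \<Rightarrow> 'm" and W :: "'m set" and MB :: "'m set"
  assumes MB: "M.fin_basis MB W"
    and endo_act: "M.endo (act x)"
    and act_in: "w \<in> W \<Longrightarrow> act x w \<in> W"
    and act_add: "w \<in> W \<Longrightarrow> act (x + y) w = act x w + act y w"
    and act_scale: "w \<in> W \<Longrightarrow> act (sL c x) w = sM c (act x w)"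
    and act_mult: "w \<in> W \<Longrightarrow> act (x \<bullet> y) w = act x (act y w) - act y (act x w)"
begin

lemma sW: "M.subspace W" by (rule M.fin_basis_subspace[OF MB])

lemma act_zero_left: "w \<in> W \<Longrightarrow> act 0 w = 0"
  using act_scale[of w 0 0] by simp

lemma act_sum: "w \<in> W \<Longrightarrow> act (\<Sum>i\<in>I. x i) w = (\<Sum>i\<in>I. act (x i) w)"
  by (induction I rule: infinite_finite_induct) (auto simp: act_zero_left act_add)

lemma act_diff: "w \<in> W \<Longrightarrow> act (x - y) w = act x w - act y w"
  using act_add[of w "x - y" y] by simp

lemma act_kernel:
  assumes "k \<in> K" "w \<in> W"
  shows "act k w = 0"
  using assms(1) unfolding leib_kernel_def
  by (induction rule: span_induct_alt) (auto simp: act_zero_left act_add act_scale act_mult assms(2))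

definition form :: "'l \<Rightarrow> 'l \<Rightarrow> 'f" where
  "form x y = M.trc MB (\<lambda>w. act x (act y w))"

lemma form_sym: "form x y = form y x"
  unfolding form_def by (rule M.trc_commute[OF MB endo_act act_in endo_act act_in])

lemma form_add: "form (x + y) z = form x z + form y z"
proof -
  have "form (x + y) z = M.trc MB (\<lambda>w. act x (act z w) + act y (act z w))"
    unfolding form_def using M.fin_basis_base[OF MB] by (intro M.trc_cong) (simp add: act_add act_in)
  also have "\<dots> = form x z + form y z"
    unfolding form_def by (rule M.trc_add[OF MB]) (simp_all add: act_in)
  finally show ?thesis .
qed

lemma form_scale: "form (sL c x) z = c * form x z"
proof -
  have "form (sL c x) z = M.trc MB (\<lambda>w. sM c (act x (act z w)))"
    unfolding form_def using M.fin_basis_base[OF MB] by (intro M.trc_cong) (simp add: act_scale act_in)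
  also have "\<dots> = c * form x z"
    unfolding form_def by (rule M.trc_scale[OF MB]) (simp add: act_in)
  finally show ?thesis .
qed

lemma form_diff: "form (x - y) z = form x z - form y z"
  using form_add[of "x - y" y z] by simp

lemma form_zero: "form 0 z = 0"
  using form_scale[of 0 0 z] by simp

lemma form_add_right: "form z (x + y) = form z x + form z y"
  by (simp add: form_sym[of z] form_add)

lemma form_sum: "form (\<Sum>i\<in>I. x i) z = (\<Sum>i\<in>I. form (x i) z)"
  by (induction I rule: infinite_finite_induct) (auto simp: form_zero form_add)

lemma form_kernel: "k \<in> K \<Longrightarrow> form k z = 0"
  unfolding form_def M.trc_def
  using M.fin_basis_base[OF MB] by (intro sum.neutral) (simp add: act_kernel act_in M.representation_zero)

lemma form_invariant: "form (x \<bullet> y) z = form x (y \<bullet> z)"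
proof -
  have "form (x \<bullet> y) z = M.trc MB (\<lambda>w. act x (act y (act z w)) - act y (act x (act z w)))"
    unfolding form_def using M.fin_basis_base[OF MB] by (intro M.trc_cong) (simp add: act_mult act_in)
  also have "\<dots> = M.trc MB (\<lambda>w. act x (act y (act z w))) - M.trc MB (\<lambda>w. act y (act x (act z w)))"
    by (rule M.trc_diff[OF MB]) (simp_all add: act_in)
  also have "M.trc MB (\<lambda>w. act y (act x (act z w))) = M.trc MB (\<lambda>w. act x (act z (act y w)))"
    by (rule M.trc_commute[OF MB endo_act act_in M.endo_comp[OF endo_act endo_act]]) (simp_all add: act_in)
  also have "M.trc MB (\<lambda>w. act x (act y (act z w))) - M.trc MB (\<lambda>w. act x (act z (act y w)))
     = M.trc MB (\<lambda>w. act x (act y (act z w)) - act x (act z (act y w)))"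
    by (rule M.trc_diff[OF MB, symmetric]) (simp_all add: act_in)
  also have "\<dots> = form x (y \<bullet> z)"
    unfolding form_def using M.fin_basis_base[OF MB]
    by (intro M.trc_cong) (simp add: act_mult act_in M.endo_diff[OF endo_act])
  finally show ?thesis .
qed

lemma form_mult_left: "form (l \<bullet> x) z = form x (z \<bullet> l)"
  by (metis form_invariant form_sym)

lemma radical_ideal:
  assumes "ideal_L I"
  shows "ideal_L {x\<in>I. \<forall>y\<in>I. form x y = 0}"
proof (rule idealI)
  note I = idealD[OF assms]
  show "subspace {x\<in>I. \<forall>y\<in>I. form x y = 0}"
    using subspace_0[OF I(1)] subspace_add[OF I(1)] subspace_scale[OF I(1)]
    by (intro subspaceI) (auto simp: form_zero form_add form_scale)
  show "x \<bullet> y \<in> {x\<in>I. \<forall>y\<in>I. form x y = 0}" if "y \<in> {x\<in>I. \<forall>y\<in>I. form x y = 0}" for x y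
    using that I by (auto simp: form_mult_left)
  show "y \<bullet> x \<in> {x\<in>I. \<forall>y\<in>I. form x y = 0}" if "y \<in> {x\<in>I. \<forall>y\<in>I. form x y = 0}" for x y
    using that I by (auto simp: form_invariant)
qed

lemma perp_ideal:
  assumes "ideal_L I"
  shows "ideal_L {x. \<forall>y\<in>I. form x y = 0}"
proof (rule idealI)
  note I = idealD[OF assms]
  show "subspace {x. \<forall>y\<in>I. form x y = 0}"
    by (intro subspaceI) (auto simp: form_zero form_add form_scale)
  show "x \<bullet> y \<in> {x. \<forall>y\<in>I. form x y = 0}" if "y \<in> {x. \<forall>y\<in>I. form x y = 0}" for x y
    using that I by (auto simp: form_mult_left)
  show "y \<bullet> x \<in> {x. \<forall>y\<in>I. form x y = 0}" if "y \<in> {x. \<forall>y\<in>I. form x y = 0}" for x y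
    using that I by (auto simp: form_invariant)
qed

lemma nilpotent_prods:
  assumes J: "ideal_L J" and z: "\<And>x y. x \<in> J \<Longrightarrow> y \<in> J \<Longrightarrow> form x y = 0" and x: "x \<in> prods J"
  shows "\<exists>N. \<forall>w\<in>W. (act x ^^ N) w = 0"
proof -
  note I = idealD[OF J]
  obtain t r where t: "finite t" "t \<subseteq> {x \<bullet> y |x y. x \<in> J \<and> y \<in> J}" "x = (\<Sum>a\<in>t. sL (r a) a)"
    using x unfolding prods_def span_explicit by auto
  have "\<forall>a\<in>t. \<exists>p q. p \<in> J \<and> q \<in> J \<and> a = p \<bullet> q" using t(2) by blast
  then obtain p q where pq: "\<forall>a\<in>t. p a \<in> J \<and> q a \<in> J \<and> a = p a \<bullet> q a" by metis
  have xJ: "x \<in> J"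
    using x I unfolding prods_def by (rule_tac subsetD[OF span_minimal[of _ J]]) auto
  \<comment> \<open>The coefficients \<open>r a\<close> are absorbed into the left factors, which
    makes \<open>act x\<close> a plain sum of commutators.\<close>
  show ?thesis
  proof (rule M.cartan_nilpotent[OF MB, of "act ` J" "act x" t "\<lambda>a. act (sL (r a) (p a))" "\<lambda>a. act (q a)"])
    show "\<exists>c\<in>act ` J. \<forall>v\<in>W. c v = M.ad a b v" if ab: "a \<in> act ` J" "b \<in> act ` J" for a b
    proof -
      obtain u v where "u \<in> J" "v \<in> J" "a = act u" "b = act v" using ab by auto
      then show ?thesis using I by (intro bexI[of _ "act (u \<bullet> v)"]) (auto simp: M.ad_def act_mult)
    qed
    show "M.trc MB (\<lambda>v. a (b v)) = 0" if "a \<in> act ` J" "b \<in> act ` J" for a b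
      using that z unfolding form_def by auto
    show "act x v = (\<Sum>i\<in>t. M.ad (act (sL (r i) (p i))) (act (q i)) v)" if v: "v \<in> W" for v
    proof -
      have "act x v = (\<Sum>a\<in>t. act (sL (r a) a) v)" unfolding t(3) by (rule act_sum[OF v])
      also have "\<dots> = (\<Sum>a\<in>t. act (sL (r a) (p a) \<bullet> q a) v)"
        using pq by (intro sum.cong refl) (metis endo_scale[OF endo_mult_left])
      finally show ?thesis unfolding M.ad_def using v by (simp add: act_mult)
    qed
    show "act (sL (r i) (p i)) \<in> act ` J" if "i \<in> t" for i
      using pq that subspace_scale[OF I(1)] by auto
    show "act (q i) \<in> act ` J" if "i \<in> t" for i using pq that by auto
  qed (use endo_act act_in xJ t(1) in auto)
qed

text \<open>On \<open>W\<close>, \<open>act ((mult x ^^ k) y)\<close> is the \<open>k\<close>-fold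
  commutator of \<open>act x\<close> with \<open>act y\<close>, so each term has at least
  \<open>N\<close> factors \<open>act x\<close> on one side of \<open>act y\<close>.\<close>

lemma act_pow_mult_zero:
  assumes N: "\<And>w. w \<in> W \<Longrightarrow> (act x ^^ N) w = 0" and w: "w \<in> W" and le: "2 * N \<le> i + j + k"
  shows "(act x ^^ i) (act ((mult x ^^ k) y) ((act x ^^ j) w)) = 0"
  using le
proof (induction k arbitrary: i j)
  case 0
  have pw: "(act x ^^ j) w \<in> W" by (rule compow_in[of W "act x" w j, OF act_in w])
  from 0 consider "N \<le> j" | "N \<le> i" by linarith
  then show ?case
  proof cases
    case 1
    then show ?thesis
      using M.endo_pow_ge[OF endo_act N[OF w] 1] M.endo_zero[OF endo_act] M.endo_zero[OF M.endo_compow[OF endo_act]] by simp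
  next
    case 2
    have "act y ((act x ^^ j) w) \<in> W" by (rule act_in[OF pw])
    from M.endo_pow_ge[OF endo_act N[OF this] 2] show ?thesis by simp
  qed
next
  case (Suc k)
  let ?y = "(mult x ^^ k) y" and ?u = "(act x ^^ j) w"
  have pw: "?u \<in> W" by (rule compow_in[of W "act x" w j, OF act_in w])
  have "act ((mult x ^^ Suc k) y) ?u = act x (act ?y ?u) - act ?y ((act x ^^ Suc j) w)"
    using act_mult[OF pw, of x ?y] by simp
  then have "(act x ^^ i) (act ((mult x ^^ Suc k) y) ?u)
     = (act x ^^ i) (act x (act ?y ?u)) - (act x ^^ i) (act ?y ((act x ^^ Suc j) w))"
    by (simp only: M.endo_diff[OF M.endo_compow[OF endo_act]])
  also have "(act x ^^ i) (act x (act ?y ?u)) = (act x ^^ Suc i) (act ?y ?u)"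
    by (simp add: funpow_swap1)
  finally show ?case using Suc.IH[of "Suc i" j] Suc.IH[of i "Suc j"] Suc.prems by simp
qed

lemma act_annihilator_ideal: "ideal_L {x. \<forall>w\<in>W. act x w = 0}"
  by (intro idealI subspaceI)
     (auto simp: act_zero_left act_add act_scale act_mult act_in M.endo_zero[OF endo_act])

end

context semisimple_leibniz
begin

section \<open>The Killing form and perfectness\<close>

lemma leibniz_rep_adjoint: "leibniz_rep sL mult sL mult UNIV LB"
  by unfold_locales (auto simp: LB endo_mult mult_simps leibniz')

definition killing :: "'l \<Rightarrow> 'l \<Rightarrow> 'f" where
  "killing = leibniz_rep.form sL mult LB"

lemma killing_zero_kernel:
  assumes J: "ideal_L J" and z: "\<And>x y. x \<in> J \<Longrightarrow> y \<in> J \<Longrightarrow> killing x y = 0"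
  shows "J \<subseteq> K"
proof (rule nilpotent_prods_kernel[OF J])
  interpret adj: leibniz_rep sL mult sL mult UNIV LB by (rule leibniz_rep_adjoint)
  fix x assume "x \<in> prods J"
  from adj.nilpotent_prods[OF J z[unfolded killing_def] this]
  obtain N where "\<forall>y. (mult x ^^ N) y = 0" by auto
  then have "\<forall>y. (mult x ^^ N) y \<in> K" using subspace_0[OF kernelD(1)] by simp
  then show "\<exists>N. \<forall>y. (mult x ^^ N) y \<in> K" by blast
qed

text \<open>The Killing form on \<open>I\<close> degenerates only inside \<open>K\<close>, and
  \<open>K\<close> is orthogonal to all of \<open>L\<close>. The orthogonal projection to
  \<open>I\<close> therefore exists for every \<open>x\<close>, also outside \<open>I\<close>, and
  \<open>L\<close> is the sum of \<open>I\<close> and its Killing complement.\<close>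

lemma ideal_decomposition:
  assumes I: "ideal_L I"
  shows "\<exists>y\<in>I. \<forall>z\<in>I. killing (x - y) z = 0"
proof -
  interpret adj: leibniz_rep sL mult sL mult UNIV LB by (rule leibniz_rep_adjoint)
  note sI = idealD(1)[OF I]
  let ?R = "{x\<in>I. \<forall>y\<in>I. killing x y = 0}"
  have R: "?R \<subseteq> K"
    using adj.radical_ideal[OF I] unfolding killing_def[symmetric]
    by (rule killing_zero_kernel) auto
  obtain B where B: "fin_basis B I" using subspace_basis sI by auto
  obtain A where A: "finite A" "A \<subseteq> I" "\<forall>a\<in>A. killing a a \<noteq> 0"
    and Ax: "\<forall>x\<in>I. \<forall>z\<in>I. killing (x - (\<Sum>a\<in>A. sL (killing x a / killing a a) a)) z = 0"
    using orthogonal_set[OF B, of killing] adj.form_add adj.form_scale adj.form_sym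
    unfolding killing_def by auto
  define y where "y = (\<Sum>a\<in>A. sL (killing x a / killing a a) a)"
  have "y \<in> I" unfolding y_def using A(2) by (intro subspace_sum[OF sI] subspace_scale[OF sI]) auto
  moreover have "killing (x - y) z = 0" if z: "z \<in> I" for z
  proof -
    define s where "s = (\<Sum>a\<in>A. sL (killing z a / killing a a) a)"
    have "s \<in> I" unfolding s_def using A(2) by (intro subspace_sum[OF sI] subspace_scale[OF sI]) auto
    then have "z - s \<in> ?R" using Ax z subspace_diff[OF sI z] unfolding s_def by auto
    then have "killing (z - s) x = 0" using R adj.form_kernel unfolding killing_def by auto
    then have "killing z x = killing s x" unfolding killing_def by (simp add: adj.form_diff)
    also have "\<dots> = (\<Sum>a\<in>A. killing z a / killing a a * killing a x)"
      unfolding s_def killing_def by (simp add: adj.form_sum adj.form_scale)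
    also have "\<dots> = (\<Sum>a\<in>A. killing x a / killing a a * killing a z)"
      unfolding killing_def by (intro sum.cong refl) (simp add: adj.form_sym[of _ x] adj.form_sym[of _ z])
    also have "\<dots> = killing y z"
      unfolding y_def killing_def by (simp add: adj.form_sum adj.form_scale)
    finally show ?thesis unfolding killing_def by (simp add: adj.form_diff adj.form_sym[of z x])
  qed
  ultimately show ?thesis by blast
qed

text \<open>Split \<open>x = y + (x - y)\<close> along the ideal \<open>LL\<close> and its Killing
  complement. By invariance \<open>(x - y) v\<close> is orthogonal to everything and so lies in
  \<open>K\<close>; then \<open>x - y\<close> lies in \<open>K\<close>, which is spanned by squares
  and so contained in \<open>LL\<close>.\<close>

lemma perfect: "prods UNIV = UNIV"
proof -
  interpret adj: leibniz_rep sL mult sL mult UNIV LB by (rule leibniz_rep_adjoint)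
  have UL: "ideal_L UNIV" by (rule idealI) auto
  note P = ideal_prods[OF UL]
  note sP = idealD(1)[OF P]
  have R: "{x. \<forall>y. killing x y = 0} \<subseteq> K"
    using adj.radical_ideal[OF UL] unfolding killing_def[symmetric]
    by (intro killing_zero_kernel) auto
  have prod: "u \<bullet> v \<in> prods UNIV" for u v unfolding prods_def by (rule span_base) auto
  have KP: "K \<subseteq> prods UNIV" unfolding leib_kernel_def prods_def by (rule span_mono) auto
  have "x \<in> prods UNIV" for x
  proof -
    obtain y where y: "y \<in> prods UNIV" "\<forall>z\<in>prods UNIV. killing (x - y) z = 0"
      using ideal_decomposition[OF P] by auto
    have "(x - y) \<bullet> v \<in> K" for v
    proof -
      have "killing ((x - y) \<bullet> v) z = 0" for z
        using y(2) prod[of v z] unfolding killing_def adj.form_invariant by auto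
      then show ?thesis using R by auto
    qed
    then have "x - y \<in> K" by (rule mult_into_kernel)
    then have "x - y + y \<in> prods UNIV" using KP y(1) by (intro subspace_add[OF sP]) auto
    then show ?thesis by simp
  qed
  then show ?thesis by auto
qed

end

section \<open>The Casimir operator and complete reducibility\<close>

context leibniz_rep
begin

text \<open>For an orthogonal set \<open>A\<close> the dual vectors are the
  \<open>a / form a a\<close>, whence the coefficients.\<close>

definition casimir :: "'l set \<Rightarrow> 'm \<Rightarrow> 'm" where
  "casimir A w = (\<Sum>a\<in>A. sM (1 / form a a) (act a (act a w)))"

lemma endo_casimir: "M.endo (casimir A)"
  unfolding casimir_def
  by (intro M.endoI)
     (simp_all add: M.endo_add[OF endo_act] M.endo_scale[OF endo_act] M.scale_right_distrib
        sum.distrib M.scale_sum_right mult.commute)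

lemma casimir_in: "w \<in> W \<Longrightarrow> casimir A w \<in> W"
  unfolding casimir_def by (intro M.subspace_sum[OF sW] M.subspace_scale[OF sW] act_in)

lemma trc_casimir:
  assumes "\<And>a. a \<in> A \<Longrightarrow> form a a \<noteq> 0"
  shows "M.trc MB (casimir A) = of_nat (card A)"
proof -
  have "M.trc MB (casimir A) = (\<Sum>a\<in>A. M.trc MB (\<lambda>w. sM (1 / form a a) (act a (act a w))))"
    unfolding casimir_def by (rule M.trc_sum[OF MB]) (intro M.subspace_scale[OF sW] act_in)
  also have "\<dots> = (\<Sum>a\<in>A. 1 / form a a * form a a)"
    unfolding form_def by (intro sum.cong refl M.trc_scale[OF MB]) (intro act_in)
  finally show ?thesis using assms by simp
qed

text \<open>Modulo \<open>K\<close>, left multiplication by \<open>l\<close> has a matrix with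
  respect to \<open>A\<close> that is skew for the form. The two halves of the commutator cancel
  after exchanging the summation indices.\<close>

lemma casimir_commute:
  assumes I: "ideal_L I" and A: "finite A" "A \<subseteq> I"
    and dual: "\<And>x. x \<in> I \<Longrightarrow> x - (\<Sum>a\<in>A. sL (form x a / form a a) a) \<in> K"
    and w: "w \<in> W"
  shows "casimir A (act l w) = act l (casimir A w)"
proof -
  let ?g = "\<lambda>a b. form (l \<bullet> a) b / (form b b * form a a)"
  \<comment> \<open>By invariance the two entries add up to the form of
    \<open>a \<bullet> b + b \<bullet> a\<close>, an element of \<open>K\<close>, with
    \<open>l\<close>.\<close>
  have skew: "form (l \<bullet> a) b = - form (l \<bullet> b) a" for a b
  proof -
    have "form (l \<bullet> a) b + form (l \<bullet> b) a = form (a \<bullet> b + b \<bullet> a) l"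
      by (simp add: form_invariant form_add form_sym[of l] flip: form_add_right)
    then show ?thesis using form_kernel[OF anticomm_in_kernel] by (simp add: eq_neg_iff_add_eq_0)
  qed
  have expand: "act (l \<bullet> a) v = (\<Sum>b\<in>A. sM (form (l \<bullet> a) b / form b b) (act b v))" if "a \<in> A" "v \<in> W" for a v
  proof -
    have "l \<bullet> a \<in> I" using that(1) A(2) idealD(2)[OF I] by auto
    from act_kernel[OF dual[OF this] that(2)] show ?thesis
      using that(2) by (simp add: act_diff act_sum act_scale)
  qed
  have one: "act l (act a (act a w)) = act a (act a (act l w)) + act (l \<bullet> a) (act a w) + act a (act (l \<bullet> a) w)" for a
    using w by (simp add: act_mult act_in M.endo_diff[OF endo_act])
  have "act l (casimir A w) - casimir A (act l w)
      = (\<Sum>a\<in>A. sM (1 / form a a) (act (l \<bullet> a) (act a w)) + sM (1 / form a a) (act a (act (l \<bullet> a) w)))"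
    unfolding casimir_def
    by (simp add: M.endo_sum[OF endo_act] M.endo_scale[OF endo_act] one M.scale_right_distrib add.assoc
        flip: sum_subtractf)
  also have "\<dots> = (\<Sum>a\<in>A. \<Sum>b\<in>A. sM (?g a b) (act b (act a w))) + (\<Sum>a\<in>A. \<Sum>b\<in>A. sM (?g a b) (act a (act b w)))"
    using w by (simp add: sum.distrib expand act_in M.endo_sum[OF endo_act] M.endo_scale[OF endo_act]
        M.scale_sum_right mult.commute)
  also have "(\<Sum>a\<in>A. \<Sum>b\<in>A. sM (?g a b) (act a (act b w))) = (\<Sum>a\<in>A. \<Sum>b\<in>A. sM (?g b a) (act b (act a w)))"
    by (rule sum.swap)
  also have "\<dots> = - (\<Sum>a\<in>A. \<Sum>b\<in>A. sM (?g a b) (act b (act a w)))"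
    unfolding sum_negf[symmetric]
    by (intro sum.cong refl) (subst skew, simp add: mult.commute)
  finally show ?thesis by simp
qed

lemma leibniz_rep_subrep:
  assumes "M.fin_basis B' W'" "W' \<subseteq> W" "\<And>x w. w \<in> W' \<Longrightarrow> act x w \<in> W'"
  shows "leibniz_rep sL mult sM act W' B'"
proof (intro leibniz_rep.intro leibniz_rep_axioms.intro)
  show "semisimple_leibniz sL mult" by (rule semisimple_leibniz_axioms)
  show "vspace_0 sM" by (rule M.vspace_0_axioms)
  show "vspace.fin_basis sM B' W'" by (rule assms(1))
  show "M.endo (act x)" for x by (rule endo_act)
  show "act x w \<in> W'" if "w \<in> W'" for x w using assms(3) that .
  fix w x y c assume "w \<in> W'"
  then have w: "w \<in> W" using assms(2) by auto
  show "act (x + y) w = act x w + act y w" by (rule act_add[OF w])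
  show "act (sL c x) w = sM c (act x w)" by (rule act_scale[OF w])
  show "act (x \<bullet> y) w = act x (act y w) - act y (act x w)" by (rule act_mult[OF w])
qed

text \<open>The trace form of \<open>W\<close> degenerates on the annihilator \<open>k\<close> of
  \<open>W\<close>, so \<open>A\<close> is taken in the Killing complement \<open>I\<close> of
  \<open>k\<close>; it acts on \<open>W\<close> as all of \<open>L\<close> does and meets
  \<open>k\<close> inside \<open>K\<close>. The radical \<open>J\<close> of the form on
  \<open>I\<close> lies in \<open>K\<close>: an element \<open>x\<close> of \<open>prods J\<close>
  acts nilpotently on \<open>W\<close>, so high powers of \<open>mult x\<close> take values in both
  \<open>k\<close> and \<open>I\<close>, hence in \<open>K\<close>.\<close>

lemma orthogonal_casimir_set:
  shows "\<exists>I A. ideal_L I \<and> finite A \<and> A \<subseteq> I \<and> (\<forall>a\<in>A. form a a \<noteq> 0)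
    \<and> (\<forall>x\<in>I. x - (\<Sum>a\<in>A. sL (form x a / form a a) a) \<in> K)
    \<and> (\<forall>x. \<exists>y\<in>I. \<forall>w\<in>W. act x w = act y w)"
proof -
  interpret adj: leibniz_rep sL mult sL mult UNIV LB by (rule leibniz_rep_adjoint)
  define k where "k = {x. \<forall>w\<in>W. act x w = 0}"
  have k: "ideal_L k" unfolding k_def by (rule act_annihilator_ideal)
  define I where "I = {x. \<forall>z\<in>k. killing x z = 0}"
  have I: "ideal_L I" unfolding I_def killing_def by (rule adj.perp_ideal[OF k])
  note sI = idealD(1)[OF I] and sk = idealD(1)[OF k]
  have "ideal_L (k \<inter> I)"
    using idealD[OF k] idealD[OF I] by (intro idealI) (auto intro: subspace_inter)
  then have kI: "k \<inter> I \<subseteq> K"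
    by (rule killing_zero_kernel) (auto simp: I_def)
  define J where "J = {x\<in>I. \<forall>y\<in>I. form x y = 0}"
  have J: "ideal_L J" unfolding J_def by (rule radical_ideal[OF I])
  have "J \<subseteq> K"
  proof (rule nilpotent_prods_kernel[OF J])
    fix x assume x: "x \<in> prods J"
    have "prods J \<subseteq> J" unfolding prods_def using idealD[OF J] by (intro span_minimal) auto
    then have xI: "x \<in> I" using x unfolding J_def by auto
    obtain N where N: "\<And>w. w \<in> W \<Longrightarrow> (act x ^^ N) w = 0"
      using nilpotent_prods[OF J _ x] unfolding J_def by auto
    \<comment> \<open>One factor beyond \<open>2 * N\<close> makes the exponent positive even for
      \<open>N = 0\<close>; the values then lie in \<open>I\<close>, because \<open>x\<close>
      does.\<close>
    have "(mult x ^^ Suc (2 * N)) y \<in> K" for y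
    proof -
      have "act ((mult x ^^ Suc (2 * N)) y) w = 0" if "w \<in> W" for w
        using act_pow_mult_zero[OF N that, of 0 0 "Suc (2 * N)"] by simp
      then have "(mult x ^^ Suc (2 * N)) y \<in> k" unfolding k_def by blast
      moreover have "(mult x ^^ Suc (2 * N)) y \<in> I" using idealD(3)[OF I xI] by simp
      ultimately show ?thesis using kI by blast
    qed
    then show "\<exists>N. \<forall>y. (mult x ^^ N) y \<in> K" by blast
  qed
  obtain IB where IB: "fin_basis IB I" using subspace_basis sI by auto
  obtain A where A: "finite A" "A \<subseteq> I" "\<forall>a\<in>A. form a a \<noteq> 0"
    and Ax: "\<forall>x\<in>I. \<forall>z\<in>I. form (x - (\<Sum>a\<in>A. sL (form x a / form a a) a)) z = 0"
    using orthogonal_set[OF IB, of form] form_add form_scale form_sym by auto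
  have "x - (\<Sum>a\<in>A. sL (form x a / form a a) a) \<in> K" if x: "x \<in> I" for x
  proof -
    have "x - (\<Sum>a\<in>A. sL (form x a / form a a) a) \<in> I"
      using A(2) x by (intro subspace_diff[OF sI] subspace_sum[OF sI] subspace_scale[OF sI]) auto
    then show ?thesis using Ax x \<open>J \<subseteq> K\<close> unfolding J_def by auto
  qed
  moreover have "\<exists>y\<in>I. \<forall>w\<in>W. act x w = act y w" for x
  proof -
    obtain u where u: "u \<in> k" "\<forall>z\<in>k. killing (x - u) z = 0" using ideal_decomposition[OF k] by auto
    then have "x - u \<in> I" unfolding I_def by auto
    moreover have "act x w = act (x - u) w" if "w \<in> W" for w
      using u(1) that unfolding k_def by (simp add: act_diff)
    ultimately show ?thesis by auto
  qed
  ultimately show ?thesis using I A by blast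
qed

end

context semisimple_leibniz
begin

text \<open>The null part \<open>W0\<close> of the Casimir operator is proper by the trace, and
  \<open>W\<close> is \<open>W0\<close> plus the image of a power that lies inside \<open>V\<close>.
  So \<open>W0\<close> is not contained in \<open>V\<close>, and induction applies to
  \<open>W0\<close> and its intersection with \<open>V\<close>. If \<open>A\<close> is empty,
  \<open>I\<close> lies in \<open>K\<close> and the whole action on \<open>W\<close>
  vanishes.\<close>

lemma invariant_outside:
  assumes "leibniz_rep sL mult sM act W MB" "module.subspace sM V" "V \<subset> W" "\<And>x w. w \<in> W \<Longrightarrow> act x w \<in> V"
  shows "\<exists>w\<in>W. w \<notin> V \<and> (\<forall>x. act x w = 0)"
  using assms
proof (induction "card MB" arbitrary: MB W V rule: less_induct)
  case less
  interpret leibniz_rep sL mult sM act W MB by (rule less.prems(1))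
  note sV = less.prems(2) and VW = less.prems(3) and LV = less.prems(4)
  obtain I A where I: "ideal_L I" and A: "finite A" "A \<subseteq> I" "\<forall>a\<in>A. form a a \<noteq> 0"
    and dual': "\<forall>x\<in>I. x - (\<Sum>a\<in>A. sL (form x a / form a a) a) \<in> K"
    and cover: "\<forall>x. \<exists>y\<in>I. \<forall>w\<in>W. act x w = act y w"
    using orthogonal_casimir_set by (elim exE conjE)
  note dual = bspec[OF dual']
  show ?case
  proof (cases "A = {}")
    case True
    have "act x w = 0" if w: "w \<in> W" for x w
    proof -
      obtain y where "y \<in> I" "act x w = act y w" using cover w by meson
      then show ?thesis using dual[of y] True act_kernel[OF _ w] by simp
    qed
    moreover obtain w where "w \<in> W" "w \<notin> V" using psubset_imp_ex_mem[OF VW] by auto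
    ultimately show ?thesis by blast
  next
    case False
    let ?C = "casimir A"
    note comm = casimir_commute[OF I A(1,2) dual]
    have Cpow: "M.endo (?C ^^ n)" for n by (rule M.endo_compow[OF endo_casimir])
    have CW: "(?C ^^ n) w \<in> W" if "w \<in> W" for n w
      by (rule compow_in[of W ?C w n, OF casimir_in that])
    have Cact: "(?C ^^ n) (act l w) = act l ((?C ^^ n) w)" if "w \<in> W" for n l w
      by (induction n) (simp_all add: comm CW[OF that])
    have CV: "?C w \<in> V" if "w \<in> W" for w
      unfolding casimir_def using that LV act_in
      by (intro M.subspace_sum[OF sV] M.subspace_scale[OF sV]) auto
    have CVpow: "(?C ^^ Suc n) w \<in> V" if "w \<in> W" for n w
      using CV[OF CW[OF that, of n]] by simp
    have sIm: "M.subspace ((?C ^^ n) ` W)" for n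
      using module_hom.subspace_image[of sM sM "?C ^^ n" W] Cpow sW by (simp add: linear_iff_module_hom)
    have dec: "(?C ^^ Suc n) ` W \<subseteq> (?C ^^ n) ` W" for n
      using casimir_in by (auto simp: funpow_swap1)
    obtain n where n: "(?C ^^ Suc n) ` W = (?C ^^ n) ` W"
      using M.descending_stable[OF MB, of "\<lambda>n. (?C ^^ n) ` W"] sIm dec CW by blast
    have stab: "(?C ^^ (n + j)) ` W = (?C ^^ n) ` W" for j
    proof (induction j)
      case (Suc j)
      have "(?C ^^ (n + Suc j)) ` W = ?C ` ((?C ^^ (n + j)) ` W)" by (simp add: image_image)
      also have "\<dots> = ?C ` ((?C ^^ n) ` W)" by (simp only: Suc)
      also have "\<dots> = (?C ^^ Suc n) ` W" by (simp add: image_image)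
      finally show ?case using n by simp
    qed simp
    \<comment> \<open>The successor makes \<open>N\<close> positive, so that \<open>?C ^^ N\<close>
      maps \<open>W\<close> into \<open>V\<close>.\<close>
    define N where "N = Suc n"
    have fit: "\<exists>u\<in>W. (?C ^^ N) w = (?C ^^ (N + N)) u" if "w \<in> W" for w
    proof -
      have "(?C ^^ (N + N)) ` W = (?C ^^ N) ` W"
        using stab[of 1] stab[of "N + 1"] unfolding N_def by (simp add: add.commute add.left_commute)
      then show ?thesis using that by blast
    qed
    define W0 where "W0 = {w\<in>W. (?C ^^ N) w = 0}"
    have sW0: "M.subspace W0"
      unfolding W0_def using M.subspace_0[OF sW] M.subspace_add[OF sW] M.subspace_scale[OF sW]
      by (intro M.subspaceI) (auto simp: M.endo_zero[OF Cpow] M.endo_add[OF Cpow] M.endo_scale[OF Cpow])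
    have "W0 \<noteq> W"
    proof
      assume "W0 = W"
      then have "M.trc MB ?C = 0"
        by (intro M.trc_nilpotent[OF MB endo_casimir casimir_in, of N]) (auto simp: W0_def)
      then show False using trc_casimir[of A] A False by simp
    qed
    then have "W0 \<subset> W" unfolding W0_def by auto
    then obtain B' where B': "M.fin_basis B' W0" "card B' < card MB"
      using M.fin_basis_psubset[OF MB sW0] by auto
    have actW0: "act x w \<in> W0" if "w \<in> W0" for x w
      using that act_in unfolding W0_def by (auto simp: Cact M.endo_zero[OF endo_act])
    have rep: "leibniz_rep sL mult sM act W0 B'"
      using \<open>W0 \<subset> W\<close> actW0 by (intro leibniz_rep_subrep B') auto
    have "\<not> W0 \<subseteq> V"
    proof
      assume W0V: "W0 \<subseteq> V"
      have "w \<in> V" if w: "w \<in> W" for w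
      proof -
        obtain u where u: "u \<in> W" "(?C ^^ N) w = (?C ^^ (N + N)) u" using fit[OF w] by auto
        have "(?C ^^ N) (w - (?C ^^ N) u) = 0"
          using u(2) by (simp add: M.endo_diff[OF Cpow] funpow_add)
        then have "w - (?C ^^ N) u \<in> V"
          using W0V w CW[OF u(1)] M.subspace_diff[OF sW] unfolding W0_def by auto
        moreover have "(?C ^^ N) u \<in> V" unfolding N_def by (rule CVpow[OF u(1)])
        ultimately have "w - (?C ^^ N) u + (?C ^^ N) u \<in> V" by (rule M.subspace_add[OF sV])
        then show ?thesis by simp
      qed
      then show False using VW by auto
    qed
    then have "W0 \<inter> V \<subset> W0" by auto
    moreover have "act x w \<in> W0 \<inter> V" if "w \<in> W0" for x w
      using actW0[OF that] LV that unfolding W0_def by auto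
    ultimately have "\<exists>w\<in>W0. w \<notin> W0 \<inter> V \<and> (\<forall>x. act x w = 0)"
      by (intro less.hyps[OF B'(2) rep] M.subspace_inter[OF sW0 sV])
    then show ?thesis unfolding W0_def by auto
  qed
qed

text \<open>This is the form in which Weyl's theorem on complete reducibility is needed.\<close>

theorem invariant_complement:
  assumes R: "leibniz_rep sL mult sM act W MB" and V: "module.subspace sM V" "V \<subseteq> W"
    and LV: "\<And>x w. w \<in> W \<Longrightarrow> act x w \<in> V" and w: "w \<in> W"
  shows "\<exists>v\<in>V. \<forall>x. act x (w - v) = 0"
proof -
  interpret leibniz_rep sL mult sM act W MB by (rule R)
  \<comment> \<open>If \<open>V\<close> plus the invariants were a proper subspace, it would still
    contain all \<open>act x w\<close>, and \<open>invariant_outside\<close> would yield an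
    invariant outside it.\<close>
  define V' where "V' = {v + u | v u. v \<in> V \<and> u \<in> {u\<in>W. \<forall>x. act x u = 0}}"
  have sU: "M.subspace {u\<in>W. \<forall>x. act x u = 0}"
    using M.subspace_0[OF sW] M.subspace_add[OF sW] M.subspace_scale[OF sW]
    by (intro M.subspaceI) (auto simp: M.endo_zero[OF endo_act] M.endo_add[OF endo_act] M.endo_scale[OF endo_act])
  have sV': "M.subspace V'" unfolding V'_def by (rule M.subspace_sums[OF V(1) sU])
  have VV': "V \<subseteq> V'" unfolding V'_def using M.subspace_0[OF sU] by force
  have UV': "{u\<in>W. \<forall>x. act x u = 0} \<subseteq> V'" unfolding V'_def using M.subspace_0[OF V(1)] by force
  have V'W: "V' \<subseteq> W" unfolding V'_def using V(2) M.subspace_add[OF sW] by auto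
  have "V' = W"
  proof (rule ccontr)
    assume "V' \<noteq> W"
    then have "V' \<subset> W" using V'W by auto
    moreover have "act x w \<in> V'" if "w \<in> W" for x w using LV[OF that] VV' by auto
    ultimately obtain w where "w \<in> W" "w \<notin> V'" "\<forall>x. act x w = 0"
      using invariant_outside[OF R sV'] by blast
    then show False using UV' by auto
  qed
  then have "w \<in> V'" using w by simp
  then obtain v u where "v \<in> V" "w = v + u" "\<forall>x. act x u = 0" unfolding V'_def by auto
  then show ?thesis by (intro bexI[of _ v]) auto
qed

end

section \<open>Cartan calculus on cochains\<close>

lemma sgn_pow_Suc: "sgn_pow (Suc k) v = - sgn_pow k v"
  by (simp add: sgn_pow_def)

lemma sgn_pow_0: "sgn_pow 0 v = v"
  by (simp add: sgn_pow_def)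

lemma sgn_pow_add: "sgn_pow k (v + w) = sgn_pow k v + sgn_pow k w"
  by (simp add: sgn_pow_def)

lemma remove_nth_Cons [simp]:
  "remove_nth 0 (a # xs) = xs" "remove_nth (Suc i) (a # xs) = a # remove_nth i xs"
  by (simp_all add: remove_nth_def)

text \<open>\<open>ins a\<close> is the insertion operator \<open>i\<^sub>a\<close>; the action \<open>\<theta>\<^sub>a\<close> is \<open>th a\<close> below.\<close>

definition ins :: "'a \<Rightarrow> ('a list \<Rightarrow> 'b) \<Rightarrow> 'a list \<Rightarrow> 'b" where
  "ins a f = (\<lambda>xs. f (a # xs))"

lemma ins_apply [simp]: "ins a f xs = f (a # xs)"
  by (simp add: ins_def)

lemma fun_eq_ins: "f [] = g [] \<Longrightarrow> (\<And>a. ins a f = ins a g) \<Longrightarrow> f = g"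
  by (rule ext, case_tac x) (auto simp: ins_def fun_eq_iff)

locale leibniz_bimodule = semisimple_leibniz sL mult + M: vspace_0 sM
  for sL :: "'f::field_char_0 \<Rightarrow> 'l::ab_group_add \<Rightarrow> 'l" and mult (infixl "\<bullet>" 75)
    and sM :: "'f \<Rightarrow> 'm::ab_group_add \<Rightarrow> 'm" +
  fixes la :: "'l \<Rightarrow> 'm \<Rightarrow> 'm" and ra :: "'m \<Rightarrow> 'l \<Rightarrow> 'm"
  assumes bimod: "bimodule sL mult sM la ra" and fin_dim_M: "fin_dim sM"
begin

lemma endo_la: "M.endo (la x)" and endo_ra: "M.endo (\<lambda>m. ra m x)"
  using bimod unfolding bimodule_def left_module_def bilin_def by blast+

lemma linear_la: "Vector_Spaces.linear sL sM (\<lambda>x. la x m)"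
  and linear_ra: "Vector_Spaces.linear sL sM (ra m)"
  using bimod unfolding bimodule_def left_module_def bilin_def by blast+

lemma la_left: "la (x + y) m = la x m + la y m" "la (sL c x) m = sM c (la x m)"
  and ra_right: "ra m (x + y) = ra m x + ra m y" "ra m (sL c x) = sM c (ra m x)"
  using linear_la[of m] linear_ra[of m] by (simp_all add: Vector_Spaces.linear_iff)

lemma la_mult: "la (x \<bullet> y) m = la x (la y m) - la y (la x m)"
  using bimod unfolding bimodule_def left_module_def by blast

lemma ra_la: "ra (la x m) y = la x (ra m y) - ra m (x \<bullet> y)"
  and ra_ra: "ra (ra m x) y = ra m (x \<bullet> y) - la x (ra m y)"
  using bimod unfolding bimodule_def by blast+

lemmas la_simps = M.endo_add[OF endo_la] M.endo_scale[OF endo_la] M.endo_zero[OF endo_la] M.endo_diff[OF endo_la]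
lemmas ra_simps = M.endo_add[OF endo_ra] M.endo_scale[OF endo_ra] M.endo_zero[OF endo_ra] M.endo_diff[OF endo_ra]

lemma la_minus: "la x (- m) = - la x m"
  using la_simps(4)[of x 0 m] by (simp add: la_simps)

abbreviation fsc :: "'f \<Rightarrow> ('l list \<Rightarrow> 'm) \<Rightarrow> 'l list \<Rightarrow> 'm" where
  "fsc \<equiv> (\<lambda>c f xs. sM c (f xs))"

sublocale F: vspace_0 fsc
  by (intro vspace_0.intro vspace_fun M.vspace_axioms)

abbreviation "C n \<equiv> cochains sL sM n"
abbreviation "d n \<equiv> cobound mult la ra n"

definition th :: "'l \<Rightarrow> ('l list \<Rightarrow> 'm) \<Rightarrow> 'l list \<Rightarrow> 'm" where
  "th a f = (\<lambda>xs. la a (f xs) - (\<Sum>j<length xs. f (xs[j := a \<bullet> xs ! j])))"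

lemma linear_LM: "Vector_Spaces.linear sL sM h \<longleftrightarrow>
    (\<forall>x y. h (x + y) = h x + h y) \<and> (\<forall>c x. h (sL c x) = sM c (h x))"
  unfolding Vector_Spaces.linear_iff using vector_space_axioms M.vector_space_axioms by auto

lemma cochain_0: "f \<in> C 0 \<longleftrightarrow> (\<forall>xs. xs \<noteq> [] \<longrightarrow> f xs = 0)"
  unfolding cochains_def by auto

lemma cochain_length: "f \<in> C n \<Longrightarrow> length xs \<noteq> n \<Longrightarrow> f xs = 0"
  unfolding cochains_def by auto

lemma cochain_linear: "f \<in> C n \<Longrightarrow> length xs = n \<Longrightarrow> i < n \<Longrightarrow> Vector_Spaces.linear sL sM (\<lambda>y. f (xs[i := y]))"
  unfolding cochains_def by auto

text \<open>A cochain of degree \<open>n + 1\<close> is a linear family of cochains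
  \<open>ins a f\<close> of degree \<open>n\<close>. With \<open>fun_eq_ins\<close>, this reduces
  most facts about \<open>th\<close> and \<open>d\<close> to inductions on the degree.\<close>

lemma cochain_Suc: "f \<in> C (Suc n) \<longleftrightarrow> f [] = 0 \<and> (\<forall>a. ins a f \<in> C n) \<and>
    (\<forall>a b. ins (a + b) f = ins a f + ins b f) \<and> (\<forall>c a. ins (sL c a) f = fsc c (ins a f))"
    (is "?L \<longleftrightarrow> ?R")
proof
  assume f: ?L
  have "ins a f \<in> C n" for a
    unfolding cochains_def
  proof (intro CollectI conjI allI impI)
    fix xs :: "'l list" and i assume "length xs = n \<and> i < n"
    then show "Vector_Spaces.linear sL sM (\<lambda>y. ins a f (xs[i := y]))"
      using cochain_linear[OF f, of "a # xs" "Suc i"] by simp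
  next
    fix xs :: "'l list" assume "length xs \<noteq> n"
    then show "ins a f xs = 0" using cochain_length[OF f, of "a # xs"] by simp
  qed
  moreover have lin: "Vector_Spaces.linear sL sM (\<lambda>y. f (y # xs))" for xs
  proof (cases "length xs = n")
    case True
    then show ?thesis using cochain_linear[OF f, of "0 # xs" 0] by simp
  next
    case False
    then show ?thesis unfolding linear_LM using cochain_length[OF f] by simp
  qed
  ultimately show ?R using cochain_length[OF f, of "[]"] lin unfolding linear_LM by (simp add: fun_eq_iff)
next
  assume R: ?R
  show ?L
    unfolding cochains_def
  proof (intro CollectI conjI allI impI)
    fix xs :: "'l list" and i assume xs: "length xs = Suc n \<and> i < Suc n"
    then obtain a ys where ays: "xs = a # ys" "length ys = n" by (cases xs) auto
    show "Vector_Spaces.linear sL sM (\<lambda>y. f (xs[i := y]))"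
    proof (cases i)
      case 0
      then show ?thesis using R unfolding linear_LM ays(1) by (simp add: fun_eq_iff)
    next
      case (Suc k)
      then have "Vector_Spaces.linear sL sM (\<lambda>y. ins a f (ys[k := y]))"
        using R ays xs by (intro cochain_linear[of "ins a f" n]) auto
      then show ?thesis using Suc ays by simp
    qed
  next
    fix xs :: "'l list" assume "length xs \<noteq> Suc n"
    then show "f xs = 0"
      using R cochain_length[of "ins (hd xs) f" n "tl xs"] by (cases xs) auto
  qed
qed

lemma cochain_ins: "f \<in> C (Suc n) \<Longrightarrow> ins a f \<in> C n"
  and ins_add_arg: "f \<in> C (Suc n) \<Longrightarrow> ins (a + b) f = ins a f + ins b f"
  and ins_scale_arg: "f \<in> C (Suc n) \<Longrightarrow> ins (sL c a) f = fsc c (ins a f)"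
  and cochain_Nil: "f \<in> C (Suc n) \<Longrightarrow> f [] = 0"
  unfolding cochain_Suc by blast+

lemma ins_diff_arg: "f \<in> C (Suc n) \<Longrightarrow> ins (a - b) f = ins a f - ins b f"
  using ins_add_arg[of f n "a - b" b] by simp

lemma endo_ins: "F.endo (ins a)"
  by (intro F.endoI) (auto simp: fun_eq_iff)

lemmas ins_simps = F.endo_add[OF endo_ins] F.endo_scale[OF endo_ins] F.endo_zero[OF endo_ins] F.endo_diff[OF endo_ins]

lemma sC: "F.subspace (C n)"
proof (induction n)
  case 0
  show ?case by (intro F.subspaceI) (auto simp: cochain_0)
next
  case (Suc n)
  show ?case
  proof (rule F.subspaceI)
    show "0 \<in> C (Suc n)" using F.subspace_0[OF Suc] by (auto simp: cochain_Suc ins_simps fun_eq_iff)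
    show "f + g \<in> C (Suc n)" if f: "f \<in> C (Suc n)" and g: "g \<in> C (Suc n)" for f g
      unfolding cochain_Suc ins_simps ins_add_arg[OF f] ins_add_arg[OF g] ins_scale_arg[OF f] ins_scale_arg[OF g]
      using F.subspace_add[OF Suc cochain_ins[OF f] cochain_ins[OF g]] cochain_Nil[OF f] cochain_Nil[OF g]
      by (auto simp: fun_eq_iff M.scale_right_distrib)
    show "fsc c f \<in> C (Suc n)" if f: "f \<in> C (Suc n)" for c f
      unfolding cochain_Suc ins_simps ins_add_arg[OF f] ins_scale_arg[OF f]
      using F.subspace_scale[OF Suc cochain_ins[OF f], of c] cochain_Nil[OF f]
      by (auto simp: fun_eq_iff M.scale_right_distrib mult.commute)
  qed
qed

lemma ins_expand:
  assumes "f \<in> C (Suc n)"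
  shows "ins a f = (\<Sum>b\<in>LB. fsc (rep LB a b) (ins b f))"
proof -
  have "ins (\<Sum>b\<in>B. sL (r b) b) f = (\<Sum>b\<in>B. fsc (r b) (ins b f))" for B r
  proof (induction B rule: infinite_finite_induct)
    case (insert x B)
    show ?case
      by (simp only: sum.insert[OF insert.hyps(1,2)] ins_add_arg[OF assms] ins_scale_arg[OF assms] insert.IH)
  qed (use ins_scale_arg[OF assms, of 0 0] in \<open>auto simp: fun_eq_iff\<close>)
  then show ?thesis using rep_sum[OF LB UNIV_I, of a] by metis
qed

lemma endo_d: "F.endo (d n)"
proof (rule F.endoI)
  show "d n (f + g) = d n f + d n g" for f g
    by (auto simp: cobound_def fun_eq_iff la_simps ra_simps sgn_pow_add sum.distrib)
  show "d n (fsc c f) = fsc c (d n f)" for c f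
  proof -
    have sp: "sgn_pow k (sM c v) = sM c (sgn_pow k v)" for k v by (simp add: sgn_pow_def)
    show ?thesis
      by (auto simp: cobound_def fun_eq_iff la_simps ra_simps sp M.scale_sum_right M.scale_right_distrib)
  qed
qed

lemmas d_simps = F.endo_add[OF endo_d] F.endo_scale[OF endo_d] F.endo_zero[OF endo_d] F.endo_diff[OF endo_d]

lemma endo_th: "F.endo (th x)"
  by (intro F.endoI)
     (auto simp: th_def fun_eq_iff la_simps sum.distrib M.scale_right_diff_distrib M.scale_sum_right)

lemmas th_simps = F.endo_add[OF endo_th] F.endo_scale[OF endo_th] F.endo_zero[OF endo_th] F.endo_diff[OF endo_th]

lemma ins_th: "ins a (th x f) = th x (ins a f) - ins (x \<bullet> a) f"
  by (auto simp: th_def fun_eq_iff sum.lessThan_Suc_shift simp del: sum.lessThan_Suc)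

text \<open>Cartan's formula. The terms in which the first argument \<open>a\<close> acts or
  multiplies make up \<open>th a f\<close>. All others are those of \<open>d n (ins a f)\<close>
  with indices shifted by one, hence with the opposite sign.\<close>

lemma ins_d:
  assumes f: "f \<in> C (Suc n)"
  shows "ins a (d (Suc n) f) = th a f - d n (ins a f)"
proof
  fix ys :: "'l list"
  show "ins a (d (Suc n) f) ys = (th a f - d n (ins a f)) ys"
  proof (cases "length ys = Suc n")
    case False
    then have "f ys = 0" "\<And>j y. f (ys[j := y]) = 0" using cochain_length[OF f] by auto
    then show ?thesis using False by (simp add: cobound_def th_def la_simps)
  next
    case True
    let ?A = "\<Sum>i<n. sgn_pow i (la (ys ! i) (f (a # remove_nth i ys)))"
    let ?R = "sgn_pow (Suc n) (ra (f (a # take n ys)) (ys ! n))"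
    let ?G = "\<Sum>j\<le>n. \<Sum>i<j. sgn_pow (Suc i) (f (a # remove_nth i (ys[j := ys ! i \<bullet> ys ! j])))"
    let ?T = "\<Sum>j\<le>n. f (ys[j := a \<bullet> ys ! j])"
    have S1: "(\<Sum>i<Suc n. sgn_pow i (la ((a # ys) ! i) (f (remove_nth i (a # ys))))) = la a (f ys) - ?A"
      by (simp only: sum.lessThan_Suc_shift) (simp add: sgn_pow_0 sgn_pow_Suc sum_negf)
    have S3: "(\<Sum>j\<le>Suc n. \<Sum>i<j. sgn_pow (Suc i) (f (remove_nth i ((a # ys)[j := (a # ys) ! i \<bullet> (a # ys) ! j]))))
        = - ?T - ?G"
      by (simp only: sum.atMost_Suc_shift sum.lessThan_Suc_shift)
         (simp add: sgn_pow_0 sgn_pow_Suc sum_negf sum_subtractf)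
    have "ins a (d (Suc n) f) ys = (la a (f ys) - ?A) + - ?R + (- ?T - ?G)"
      using True unfolding ins_apply cobound_def S1 S3 by (simp add: sgn_pow_Suc)
    moreover have "d n (ins a f) ys = ?A + ?R + ?G"
      using True unfolding cobound_def by simp
    moreover have "th a f ys = la a (f ys) - ?T"
      using True by (simp add: th_def lessThan_Suc_atMost)
    ultimately show ?thesis by simp
  qed
qed

text \<open>Degree 0 is the exception to Cartan's formula: the first slot is also the last, so the
  right action stands where the left one would be.\<close>

lemma ins_d0: "ins a (d 0 f) = (\<lambda>xs. if xs = [] then - ra (f []) a else 0)"
  by (auto simp: fun_eq_iff cobound_def sgn_pow_def)

lemma d_Nil: "d n f [] = 0"
  by (simp add: cobound_def)

declare ins_apply [simp del]

lemma th_cochain: "f \<in> C n \<Longrightarrow> th x f \<in> C n"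
proof (induction n arbitrary: f)
  case 0
  then show ?case by (auto simp: cochain_0 th_def la_simps)
next
  case (Suc n)
  note f = Suc.prems
  have i: "ins a (th x f) \<in> C n" for a
    unfolding ins_th by (intro F.subspace_diff[OF sC] Suc.IH cochain_ins[OF f])
  moreover have "th x f [] = 0" using cochain_Nil[OF f] by (simp add: th_def la_simps)
  moreover have "ins (a + b) (th x f) = ins a (th x f) + ins b (th x f)" for a b
    by (simp add: ins_th ins_add_arg[OF f] th_simps mult_simps)
  moreover have "ins (sL c a) (th x f) = fsc c (ins a (th x f))" for c a
    by (simp only: ins_th ins_scale_arg[OF f] th_simps mult_simps) (simp add: fun_eq_iff M.scale_right_diff_distrib)
  ultimately show ?case unfolding cochain_Suc by blast
qed

lemma th_0:
  assumes "f \<in> C 0"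
  shows "th x f = (\<lambda>xs. la x (f xs))"
proof
  fix xs :: "'l list"
  have "(\<Sum>j<length xs. f (xs[j := x \<bullet> xs ! j])) = 0"
  proof (intro sum.neutral ballI)
    fix j assume "j \<in> {..<length xs}"
    then have "xs[j := x \<bullet> xs ! j] \<noteq> []" by auto
    then show "f (xs[j := x \<bullet> xs ! j]) = 0" using assms by (simp add: cochain_0)
  qed
  then show "th x f xs = la x (f xs)" by (simp add: th_def)
qed

lemma th_add: "f \<in> C n \<Longrightarrow> th (x + y) f = th x f + th y f"
proof (induction n arbitrary: f)
  case 0
  then show ?case by (simp add: th_0 la_left fun_eq_iff)
next
  case (Suc n)
  note f = Suc.prems
  show ?case
  proof (rule fun_eq_ins)
    show "th (x + y) f [] = (th x f + th y f) []" by (simp add: th_def la_left)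
    show "ins a (th (x + y) f) = ins a (th x f + th y f)" for a
      by (simp only: ins_simps ins_th Suc.IH[OF cochain_ins[OF f]] mult_simps ins_add_arg[OF f])
         (simp add: fun_eq_iff)
  qed
qed

lemma th_scale: "f \<in> C n \<Longrightarrow> th (sL c x) f = fsc c (th x f)"
proof (induction n arbitrary: f)
  case 0
  then show ?case by (simp add: th_0 la_left fun_eq_iff)
next
  case (Suc n)
  note f = Suc.prems
  show ?case
  proof (rule fun_eq_ins)
    show "th (sL c x) f [] = fsc c (th x f) []" by (simp add: th_def la_left)
    show "ins a (th (sL c x) f) = ins a (fsc c (th x f))" for a
      by (simp only: ins_simps ins_th Suc.IH[OF cochain_ins[OF f]] mult_simps ins_scale_arg[OF f])
         (simp add: fun_eq_iff M.scale_right_diff_distrib)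
  qed
qed

lemma th_mult: "f \<in> C n \<Longrightarrow> th (x \<bullet> y) f = th x (th y f) - th y (th x f)"
proof (induction n arbitrary: f)
  case 0
  then show ?case using th_cochain[of f 0] by (simp add: th_0 la_mult fun_eq_iff)
next
  case (Suc n)
  note f = Suc.prems
  show ?case
  proof (rule fun_eq_ins)
    show "th (x \<bullet> y) f [] = (th x (th y f) - th y (th x f)) []" by (simp add: th_def la_mult)
    show "ins a (th (x \<bullet> y) f) = ins a (th x (th y f) - th y (th x f))" for a
      by (simp only: ins_simps ins_th th_simps Suc.IH[OF cochain_ins[OF f]] leibniz'[of x y a] ins_diff_arg[OF f])
         (simp add: fun_eq_iff)
  qed
qed

lemma d_cochain: "f \<in> C n \<Longrightarrow> d n f \<in> C (Suc n)"
proof (induction n arbitrary: f)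
  case 0
  show ?case
    unfolding cochain_Suc ins_d0
    by (auto simp: d_Nil cochain_0 ra_right fun_eq_iff)
next
  case (Suc n)
  note f = Suc.prems
  show ?case
  proof (rule cochain_Suc[THEN iffD2], unfold ins_d[OF f], intro conjI allI)
    show "th a f - d n (ins a f) \<in> C (Suc n)" for a
      by (intro F.subspace_diff[OF sC] th_cochain f Suc.IH cochain_ins)
    show "th (a + b) f - d n (ins (a + b) f) = th a f - d n (ins a f) + (th b f - d n (ins b f))" for a b
      by (simp only: th_add[OF f] ins_add_arg[OF f] d_simps) (simp add: fun_eq_iff)
    show "th (sL c a) f - d n (ins (sL c a) f) = fsc c (th a f - d n (ins a f))" for c a
      by (simp only: th_scale[OF f] ins_scale_arg[OF f] d_simps) (simp add: fun_eq_iff M.scale_right_diff_distrib)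
  qed (rule d_Nil)
qed

text \<open>Degree 0 rests on the bimodule identity \<open>ra_la\<close>. Above it, Cartan's formula
  and the commutator rules \<open>ins_th\<close> and \<open>th_mult\<close> carry the
  induction.\<close>

lemma d_th: "f \<in> C n \<Longrightarrow> d n (th x f) = th x (d n f)"
proof (induction n arbitrary: f)
  case 0
  show ?case
  proof (rule fun_eq_ins)
    show "d 0 (th x f) [] = th x (d 0 f) []" by (simp add: d_Nil th_def la_simps)
    show "ins a (d 0 (th x f)) = ins a (th x (d 0 f))" for a
      unfolding ins_th ins_d0
      by (auto simp: fun_eq_iff th_def la_simps la_minus ra_la)
  qed
next
  case (Suc n)
  note f = Suc.prems
  show ?case
  proof (rule fun_eq_ins)
    show "d (Suc n) (th x f) [] = th x (d (Suc n) f) []" by (simp add: d_Nil th_def la_simps)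
    show "ins a (d (Suc n) (th x f)) = ins a (th x (d (Suc n) f))" for a
      by (simp only: ins_d[OF th_cochain[OF f]] ins_th ins_d[OF f] d_simps th_simps
          Suc.IH[OF cochain_ins[OF f]] th_mult[OF f, of x a])
         (simp add: fun_eq_iff)
  qed
qed

text \<open>Complete reducibility is proved with traces, so the cochain spaces need finite bases
  although they sit inside the space of all functions on lists.\<close>

lemma cochains_finite: "\<exists>G. finite G \<and> C n \<subseteq> F.span G"
proof (induction n)
  case 0
  obtain G where G: "finite G" "M.span G = UNIV" using fin_dim_M unfolding fin_dim_def by auto
  define e where "e m = (\<lambda>xs :: 'l list. if xs = [] then m else (0 :: 'm))" for m
  have "e m \<in> F.span (e ` G)" for m
  proof -
    have "m \<in> M.span G" using G by simp
    then show ?thesis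
    proof (induction rule: M.span_induct_alt)
      case base
      have "e 0 = 0" by (auto simp: e_def fun_eq_iff)
      then show ?case by (simp only: F.span_zero)
    next
      case (step c u v)
      have "e (sM c u + v) = fsc c (e u) + e v" by (auto simp: e_def fun_eq_iff)
      moreover have "e u \<in> F.span (e ` G)" using step(1) by (intro F.span_base) auto
      ultimately show ?case using step(2) by (simp only: F.span_add F.span_scale)
    qed
  qed
  moreover have "f = e (f [])" if "f \<in> C 0" for f
    using that by (auto simp: cochain_0 e_def fun_eq_iff)
  ultimately have "C 0 \<subseteq> F.span (e ` G)" by (metis subsetI)
  then show ?case using G by blast
next
  case (Suc n)
  obtain G where G: "finite G" "C n \<subseteq> F.span G" using Suc by auto
  have fB: "finite LB" using fin_basisD[OF LB] by auto
  \<comment> \<open>\<open>E b g\<close> is the tensor product of the coordinate form of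
    \<open>b\<close> with \<open>g\<close>; a cochain \<open>f\<close> is the sum of the
    \<open>E b (ins b f)\<close>.\<close>
  define E where "E b g = (\<lambda>xs. case xs of [] \<Rightarrow> 0 | x # ys \<Rightarrow> sM (rep LB x b) (g ys))"
    for b and g :: "'l list \<Rightarrow> 'm"
  let ?G = "\<Union>b\<in>LB. E b ` G"
  have "E b g \<in> F.span ?G" if b: "b \<in> LB" and g: "g \<in> C n" for b g
  proof -
    have "g \<in> F.span G" using g G by auto
    then show ?thesis
    proof (induction rule: F.span_induct_alt)
      case base
      have "E b 0 = 0" by (auto simp: E_def fun_eq_iff split: list.split)
      then show ?case by (simp only: F.span_zero)
    next
      case (step c u v)
      have "E b (fsc c u + v) = fsc c (E b u) + E b v"
        by (auto simp: E_def fun_eq_iff M.scale_right_distrib mult.commute split: list.split)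
      moreover have "E b u \<in> F.span ?G" using step b by (intro F.span_base) auto
      ultimately show ?case using step by (simp only: F.span_add F.span_scale)
    qed
  qed
  note E_span = this
  have E_eq: "f = (\<Sum>b\<in>LB. E b (ins b f))" if f: "f \<in> C (Suc n)" for f
  proof (rule fun_eq_ins)
    have s: "(\<Sum>b\<in>B. h b) xs = (\<Sum>b\<in>B. h b xs)" for B :: "'l set" and h :: "'l \<Rightarrow> 'l list \<Rightarrow> 'm" and xs
      by (induction B rule: infinite_finite_induct) auto
    show "f [] = (\<Sum>b\<in>LB. E b (ins b f)) []" by (simp add: s E_def cochain_Nil[OF f])
    show "ins a f = ins a (\<Sum>b\<in>LB. E b (ins b f))" for a
      by (subst ins_expand[OF f]) (simp add: fun_eq_iff s E_def ins_apply)
  qed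
  have "C (Suc n) \<subseteq> F.span ?G"
  proof
    fix f assume f: "f \<in> C (Suc n)"
    have "(\<Sum>b\<in>LB. E b (ins b f)) \<in> F.span ?G"
      by (intro F.span_sum E_span cochain_ins[OF f])
    then show "f \<in> F.span ?G" using E_eq[OF f] by simp
  qed
  moreover have "finite ?G" using G(1) fB by simp
  ultimately show ?case by (intro exI[of _ ?G] conjI)
qed

lemma cochain_rep:
  assumes "F.subspace W" "W \<subseteq> C n" "\<And>x w. w \<in> W \<Longrightarrow> th x w \<in> W"
  shows "\<exists>B. leibniz_rep sL mult fsc th W B"
proof -
  obtain G where "finite G" "C n \<subseteq> F.span G" using cochains_finite by blast
  then obtain B where B: "F.fin_basis B W" using F.fin_basis_exists[OF assms(1), of G] assms(2) by auto
  have "leibniz_rep sL mult fsc th W B"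
  proof (intro leibniz_rep.intro leibniz_rep_axioms.intro)
    show "semisimple_leibniz sL mult" by (rule semisimple_leibniz_axioms)
    show "vspace_0 fsc" by (rule F.vspace_0_axioms)
    show "vspace.fin_basis fsc B W" by (rule B)
    show "F.endo (th x)" for x by (rule endo_th)
    show "th x w \<in> W" if "w \<in> W" for x w using assms(3) that .
    fix w x y c assume "w \<in> W"
    then have w: "w \<in> C n" using assms(2) by auto
    show "th (x + y) w = th x w + th y w" by (rule th_add[OF w])
    show "th (sL c x) w = fsc c (th x w)" by (rule th_scale[OF w])
    show "th (x \<bullet> y) w = th x (th y w) - th y (th x w)" by (rule th_mult[OF w])
  qed
  then show ?thesis by blast
qed

end

section \<open>Vanishing and the exact sequence\<close>

context vspace
begin

section \<open>Cosets and quotient spaces\<close>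

definition cs :: "'b set \<Rightarrow> 'b \<Rightarrow> 'b set" where
  "cs U v = {v + u | u. u \<in> U}"

lemma cs_iff: "w \<in> cs U v \<longleftrightarrow> w - v \<in> U"
  unfolding cs_def by (auto intro!: exI[of _ "w - v"])

lemma cs_eq_iff:
  assumes "subspace U"
  shows "cs U v = cs U w \<longleftrightarrow> v - w \<in> U"
proof
  assume "cs U v = cs U w"
  moreover have "v \<in> cs U v" using subspace_0[OF assms] by (simp add: cs_iff)
  ultimately show "v - w \<in> U" by (simp add: cs_iff)
next
  assume vw: "v - w \<in> U"
  have "x - v \<in> U \<longleftrightarrow> x - w \<in> U" for x
    using subspace_add[OF assms _ vw, of "x - v"] subspace_diff[OF assms _ vw, of "x - w"]
    by (auto simp: algebra_simps)
  then show "cs U v = cs U w" by (auto simp: cs_iff)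
qed

lemma cs_zero: "cs U 0 = U"
  by (auto simp: cs_iff)

text \<open>Quotient operations and induced actions select representatives by \<open>SOME\<close>.
  Any such choice deviates from \<open>v\<close> by an element of \<open>U\<close>, which is why it
  does not influence the result.\<close>

lemma cs_some:
  assumes "subspace U"
  shows "(SOME w. w \<in> cs U v) - v \<in> U"
proof -
  have "v \<in> cs U v" using subspace_0[OF assms] by (simp add: cs_iff)
  then have "(SOME w. w \<in> cs U v) \<in> cs U v" by (rule someI)
  then show ?thesis by (simp add: cs_iff)
qed

context
  fixes V :: "('a, 'b) vsp" and U :: "'b set"
  assumes V: "vadd V = (+)" "vzero V = 0" "vscale V = scale" and U: "subspace U"
begin

lemma coset_cs: "coset V U v = cs U v"
  unfolding coset_def cs_def V ..

lemma quot_carrier: "vcarrier (quot V U) = {cs U v | v. v \<in> vcarrier V}"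
  unfolding quot_def by (simp add: coset_cs)

lemma quot_zero: "vzero (quot V U) = cs U 0"
  unfolding quot_def by (simp add: coset_cs V)

lemma quot_add: "vadd (quot V U) (cs U v) (cs U w) = cs U (v + w)"
proof -
  have "(SOME a. a \<in> cs U v) + (SOME a. a \<in> cs U w) - (v + w)
      = ((SOME a. a \<in> cs U v) - v) + ((SOME a. a \<in> cs U w) - w)" by simp
  also have "\<dots> \<in> U" by (intro subspace_add[OF U] cs_some[OF U])
  finally show ?thesis unfolding quot_def by (simp add: coset_cs V cs_eq_iff[OF U])
qed

lemma quot_scale: "vscale (quot V U) c (cs U v) = cs U (scale c v)"
proof -
  have "scale c (SOME a. a \<in> cs U v) - scale c v = scale c ((SOME a. a \<in> cs U v) - v)"
    by (simp add: scale_right_diff_distrib)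
  also have "\<dots> \<in> U" by (intro subspace_scale[OF U] cs_some[OF U])
  finally show ?thesis unfolding quot_def by (simp add: coset_cs V cs_eq_iff[OF U])
qed

lemma trivial_quot:
  assumes "0 \<in> vcarrier V" "vcarrier V \<subseteq> U"
  shows "trivial_vs (quot V U)"
proof -
  have "cs U v = cs U 0" if "v \<in> vcarrier V" for v
    using that assms(2) by (auto simp: cs_eq_iff[OF U])
  then show ?thesis using assms(1) unfolding trivial_vs_def quot_carrier quot_zero by blast
qed

end

end

context leibniz_bimodule
begin

lemma ra_minus: "ra (- m) x = - ra m x"
  using M.endo_diff[OF endo_ra[of x], of 0 m] by (simp add: ra_simps)

lemma sB: "F.subspace (d n ` C n)"
  using module_hom.subspace_image[of fsc fsc "d n" "C n"] endo_d sC by (simp add: linear_iff_module_hom)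

lemma sZ: "F.subspace {f \<in> C n. d n f = 0}"
  using F.subspace_0[OF sC] F.subspace_add[OF sC] F.subspace_scale[OF sC]
  by (intro F.subspaceI) (auto simp: d_simps fun_eq_iff)

lemma cocycle_th: "f \<in> C (Suc n) \<Longrightarrow> d (Suc n) f = 0 \<Longrightarrow> th x f = d n (ins x f)"
  using ins_d[of f n x] ins_simps(3)[of x] by simp

lemma cocycle_invariant:
  assumes "f \<in> C (Suc n)" "d (Suc n) f = 0"
  shows "\<exists>g\<in>C n. d (Suc n) (d n g) = 0 \<and> (\<forall>x. th x (f - d n g) = 0)"
proof -
  let ?W = "{f \<in> C (Suc n). d (Suc n) f = 0}"
  let ?V = "?W \<inter> d n ` C n"
  have V: "th x w \<in> ?V" if w: "w \<in> ?W" for x w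
  proof -
    have wC: "w \<in> C (Suc n)" "d (Suc n) w = 0" using w by auto
    have "th x w \<in> d n ` C n" unfolding cocycle_th[OF wC] using cochain_ins[OF wC(1)] by blast
    moreover have "d (Suc n) (th x w) = 0" unfolding d_th[OF wC(1)] wC(2) by (rule th_simps(3))
    ultimately show ?thesis using th_cochain[OF wC(1)] by blast
  qed
  then have "th x w \<in> ?W" if "w \<in> ?W" for x w using that by blast
  then obtain B where "leibniz_rep sL mult fsc th ?W B" using cochain_rep[OF sZ[of "Suc n"], of "Suc n"] by auto
  from invariant_complement[OF this F.subspace_inter[OF sZ sB] _ V] assms
  obtain v where "v \<in> ?V" "\<forall>x. th x (f - v) = 0" by blast
  then show ?thesis by auto
qed

lemma cocycle_coboundary:
  assumes f: "f \<in> C (Suc (Suc n))" "d (Suc (Suc n)) f = 0"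
  shows "f \<in> d (Suc n) ` C (Suc n)"
proof -
  obtain g where g: "g \<in> C (Suc n)" "d (Suc (Suc n)) (d (Suc n) g) = 0" "\<And>x. th x (f - d (Suc n) g) = 0"
    using cocycle_invariant[OF f] by blast
  define h where "h = f - d (Suc n) g"
  have h: "h \<in> C (Suc (Suc n))" unfolding h_def by (intro F.subspace_diff[OF sC] f d_cochain g)
  have dh: "d (Suc (Suc n)) h = 0" unfolding h_def d_simps f(2) g(2) by simp
  have thh: "th x h = 0" for x using g(3) unfolding h_def .
  note ih = cochain_ins[OF h]
  have d_ih: "d (Suc n) (ins a h) = 0" for a using cocycle_th[OF h dh, of a] thh by simp
  have inv: "th x (ins a h) = ins (x \<bullet> a) h" for x a
  proof -
    have "ins a (th x h) = 0" unfolding thh by (rule ins_simps(3))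
    then show ?thesis unfolding ins_th by simp
  qed
  \<comment> \<open>Cartan's formula is applied to the cocycle \<open>ins y h\<close>, which must
    have positive degree; this is where degree at least 2 of \<open>h\<close> enters.\<close>
  have "ins a h \<in> d n ` C n" for a
  proof -
    have "a \<in> prods UNIV" using perfect by simp
    then show ?thesis unfolding prods_def
    proof (induction rule: span_induct_alt)
      case base
      have "ins 0 h = 0" using ins_scale_arg[OF h, of 0 0] by (simp add: fun_eq_iff)
      then show ?case using F.subspace_0[OF sB, of n] by (simp only:)
    next
      case (step c u v)
      then obtain x y where u: "u = x \<bullet> y" by auto
      have "ins u h = d n (ins x (ins y h))"
        unfolding u inv[symmetric] using cocycle_th[OF ih d_ih] .
      then have "ins u h \<in> d n ` C n" using cochain_ins[OF ih] by blast
      then show ?case unfolding ins_add_arg[OF h] ins_scale_arg[OF h]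
        using step(2) by (intro F.subspace_add[OF sB] F.subspace_scale[OF sB])
    qed
  qed
  then have "\<forall>a. \<exists>t. t \<in> C n \<and> d n t = ins a h" by (metis imageE)
  then obtain t where t: "\<And>a. t a \<in> C n" "\<And>a. d n (t a) = ins a h" by metis
  have fLB: "finite LB" using fin_basisD[OF LB] by auto
  \<comment> \<open>The primitives \<open>t b\<close> are kept at basis vectors only and extended
    linearly, which turns the family into a cochain.\<close>
  define s where "s = (\<lambda>xs. case xs of [] \<Rightarrow> 0 | x # ys \<Rightarrow> (\<Sum>b\<in>LB. fsc (rep LB x b) (t b)) ys)"
  let ?e = "\<lambda>a. \<Sum>b\<in>LB. fsc (rep LB a b) (t b)"
  have ins_s: "ins a s = ?e a" for a
    by (simp add: s_def ins_def)
  have sum_app: "(\<Sum>b\<in>B. k b) xs = (\<Sum>b\<in>B. k b xs)" for B :: "'l set" and k :: "'l \<Rightarrow> 'l list \<Rightarrow> 'm" and xs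
    by (induction B rule: infinite_finite_induct) auto
  have s: "s \<in> C (Suc n)"
    unfolding cochain_Suc ins_s
  proof (intro conjI allI)
    show "s [] = 0" by (simp add: s_def)
    show "?e a \<in> C n" for a
      by (intro F.subspace_sum[OF sC] F.subspace_scale[OF sC] t)
    show "?e (a + a') = ?e a + ?e a'" for a a'
      by (simp add: fun_eq_iff sum_app rep_add[OF LB] M.scale_left_distrib sum.distrib)
    show "?e (sL c a) = fsc c (?e a)" for a c
      by (simp add: fun_eq_iff sum_app rep_scale[OF LB] M.scale_sum_right)
  qed
  have d_ins_s: "d n (ins a s) = ins a h" for a
    unfolding ins_s ins_expand[OF h, of a] F.endo_sum[OF endo_d] d_simps t(2) ..
  \<comment> \<open>Members of \<open>?W\<close> are families of primitives for a multiple of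
    \<open>h\<close>, with one scalar \<open>c\<close> for all \<open>a\<close>; \<open>?V\<close>
    is the case \<open>c = 0\<close>. As \<open>d\<close> commutes with \<open>th\<close> and
    \<open>h\<close> is invariant, \<open>th x\<close> maps \<open>?W\<close> into
    \<open>?V\<close>. Making \<open>s\<close> invariant by an element of \<open>?V\<close> keeps
    its scalar 1.\<close>
  let ?W = "{u \<in> C (Suc n). \<exists>c. \<forall>a. d n (ins a u) = fsc c (ins a h)}"
  let ?V = "{u \<in> C (Suc n). \<forall>a. d n (ins a u) = 0}"
  have sW: "F.subspace ?W"
  proof (rule F.subspaceI)
    show "0 \<in> ?W"
      using F.subspace_0[OF sC] by (auto simp: ins_simps d_simps fun_eq_iff intro!: exI[of _ 0])
    show "u + v \<in> ?W" if uv: "u \<in> ?W" "v \<in> ?W" for u v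
    proof -
      obtain b c where "\<And>a. d n (ins a u) = fsc b (ins a h)" "\<And>a. d n (ins a v) = fsc c (ins a h)"
        using uv by auto
      then have "d n (ins a (u + v)) = fsc (b + c) (ins a h)" for a
        by (simp add: ins_simps d_simps fun_eq_iff M.scale_left_distrib)
      then show ?thesis using uv F.subspace_add[OF sC] by blast
    qed
    show "fsc k u \<in> ?W" if u: "u \<in> ?W" for k u
    proof -
      obtain b where b: "\<And>a. d n (ins a u) = fsc b (ins a h)" using u by auto
      have "d n (ins a (fsc k u)) = fsc (k * b) (ins a h)" for a
        unfolding ins_simps d_simps b by (simp add: fun_eq_iff)
      then show ?thesis using u F.subspace_scale[OF sC] by blast
    qed
  qed
  have sV: "F.subspace ?V"
    using F.subspace_0[OF sC] F.subspace_add[OF sC] F.subspace_scale[OF sC]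
    by (intro F.subspaceI) (auto simp: ins_simps d_simps fun_eq_iff)
  have VW: "?V \<subseteq> ?W" by (auto simp: fun_eq_iff intro!: exI[of _ 0])
  have LV: "th x u \<in> ?V" if u: "u \<in> ?W" for x u
  proof -
    obtain c where c: "\<And>a. d n (ins a u) = fsc c (ins a h)" and uC: "u \<in> C (Suc n)" using u by auto
    have "d n (ins a (th x u)) = 0" for a
      unfolding ins_th d_simps d_th[OF cochain_ins[OF uC]] c th_simps inv by simp
    then show ?thesis using th_cochain[OF uC] by blast
  qed
  obtain B where R: "leibniz_rep sL mult fsc th ?W B"
    using cochain_rep[OF sW, of "Suc n"] LV VW by blast
  have "s \<in> ?W" using s d_ins_s by (auto intro!: exI[of _ 1])
  from invariant_complement[OF R sV VW LV this] obtain v where v: "v \<in> ?V" "\<And>x. th x (s - v) = 0" by blast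
  define u where "u = s - v"
  have u: "u \<in> C (Suc n)" unfolding u_def using s v(1) by (intro F.subspace_diff[OF sC]) auto
  \<comment> \<open>For invariant \<open>u\<close>, Cartan's formula leaves only
    \<open>- d n (ins a u)\<close>, which is \<open>- ins a h\<close>.\<close>
  have "d (Suc n) u = - h"
  proof (rule fun_eq_ins)
    show "d (Suc n) u [] = (- h) []" using cochain_Nil[OF h] by (simp add: d_Nil)
    have "d n (ins a u) = ins a h" for a using v(1) by (simp add: u_def ins_simps d_simps d_ins_s)
    moreover have "th a u = 0" for a using v(2) unfolding u_def .
    ultimately show "ins a (d (Suc n) u) = ins a (- h)" for a
      unfolding ins_d[OF u] by (simp add: fun_eq_iff ins_apply)
  qed
  then have "d (Suc n) (g - u) = f" unfolding d_simps h_def by simp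
  moreover have "g - u \<in> C (Suc n)" by (intro F.subspace_diff[OF sC] g u)
  ultimately show ?thesis by blast
qed

section \<open>The anti-symmetric kernel and cocycles of degree 1\<close>

abbreviation "N0 \<equiv> M0 sM la ra"

lemma sN0: "M.subspace N0"
  unfolding M0_def by simp

lemma sym_in_N0: "la x m + ra m x \<in> N0"
  unfolding M0_def by (rule M.span_base) auto

text \<open>The right-hand sides of \<open>ra_la\<close> and \<open>ra_ra\<close> are negatives of
  each other.\<close>

lemma ra_N0: "k \<in> N0 \<Longrightarrow> ra k y = 0"
  unfolding M0_def
  by (induction rule: M.span_induct_alt) (auto simp: ra_simps ra_la ra_ra)

lemma la_N0: "k \<in> N0 \<Longrightarrow> la x k \<in> N0"
  using sym_in_N0[of x k] by (simp add: ra_N0)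

definition const0 :: "'m \<Rightarrow> 'l list \<Rightarrow> 'm" where
  "const0 m = (\<lambda>xs. if xs = [] then m else 0)"

definition lift1 :: "('l \<Rightarrow> 'm) \<Rightarrow> 'l list \<Rightarrow> 'm" where
  "lift1 \<phi> = (\<lambda>xs. if length xs = 1 then \<phi> (hd xs) else 0)"

lemma const0_cochain: "const0 m \<in> C 0"
  by (auto simp: cochain_0 const0_def)

lemma const0_eq: "f \<in> C 0 \<Longrightarrow> const0 (f []) = f"
  by (auto simp: cochain_0 const0_def fun_eq_iff)

lemma const0_Nil: "const0 m [] = m"
  by (simp add: const0_def)

lemma const0_zero: "const0 0 = 0"
  by (simp add: const0_def fun_eq_iff)

lemma const0_add: "const0 (m + n) = const0 m + const0 n"
  by (simp add: const0_def fun_eq_iff)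

lemma const0_scale: "const0 (sM c m) = fsc c (const0 m)"
  by (simp add: const0_def fun_eq_iff)

lemma ins_d_const0: "ins a (d 0 f) = const0 (- ra (f []) a)"
  by (simp add: ins_d0 const0_def)

lemma d0_zero_iff: "d 0 f = 0 \<longleftrightarrow> (\<forall>a. ra (f []) a = 0)"
proof
  assume d0: "d 0 f = 0"
  show "\<forall>a. ra (f []) a = 0"
  proof
    fix a
    have "ins a (d 0 f) [] = 0" unfolding d0 by (simp add: ins_apply)
    then show "ra (f []) a = 0" unfolding ins_d_const0 const0_Nil by simp
  qed
next
  assume "\<forall>a. ra (f []) a = 0"
  then have "ins a (d 0 f) = ins a 0" for a unfolding ins_d_const0 by (simp add: const0_def fun_eq_iff ins_apply)
  then show "d 0 f = 0" by (rule fun_eq_ins[rotated]) (simp add: d_Nil)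
qed

lemma ins_lift1: "ins a (lift1 \<phi>) = const0 (\<phi> a)"
  by (auto simp: ins_def lift1_def const0_def fun_eq_iff)

lemma lift1_eq_iff: "f \<in> C (Suc 0) \<Longrightarrow> lift1 \<phi> = f \<longleftrightarrow> (\<forall>a. \<phi> a = f [a])"
proof
  assume f: "f \<in> C (Suc 0)" and "\<forall>a. \<phi> a = f [a]"
  then have "ins a (lift1 \<phi>) = ins a f" for a
    unfolding ins_lift1 using const0_eq[OF cochain_ins[OF f, of a]] by (simp add: ins_apply)
  then show "lift1 \<phi> = f"
    by (rule fun_eq_ins[rotated]) (simp add: cochain_Nil[OF f] lift1_def)
qed (auto simp: lift1_def)

lemma lift1_cochain:
  assumes "Vector_Spaces.linear sL sM \<phi>"
  shows "lift1 \<phi> \<in> C (Suc 0)"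
proof -
  have "\<phi> (a + b) = \<phi> a + \<phi> b" "\<phi> (sL c a) = sM c (\<phi> a)" for a b c
    using assms unfolding linear_LM by blast+
  then show ?thesis
    unfolding cochain_Suc ins_lift1 by (simp add: const0_cochain const0_add const0_scale) (simp add: lift1_def)
qed

abbreviation "HomN \<equiv> {\<phi>. Vector_Spaces.linear sL sM \<phi> \<and> (\<forall>x. \<phi> x \<in> N0) \<and> (\<forall>x y. \<phi> (x \<bullet> y) = la x (\<phi> y))}"

text \<open>Both terms of Cartan's formula vanish: the action by equivariance, and the coboundary of
  \<open>ins a (lift1 \<phi>)\<close> because \<open>N0\<close> is killed from the right.\<close>

lemma lift1_cocycle:
  assumes \<phi>: "\<phi> \<in> HomN"
  shows "d (Suc 0) (lift1 \<phi>) = 0"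
proof (rule fun_eq_ins)
  have f: "lift1 \<phi> \<in> C (Suc 0)" using \<phi> by (intro lift1_cochain) auto
  fix a
  have "th a (lift1 \<phi>) = d 0 (ins a (lift1 \<phi>))"
  proof (rule fun_eq_ins)
    show "th a (lift1 \<phi>) [] = d 0 (ins a (lift1 \<phi>)) []" by (simp add: d_Nil th_def la_simps lift1_def)
    fix b
    have "ins b (th a (lift1 \<phi>)) = 0"
      unfolding ins_th ins_lift1 th_0[OF const0_cochain] using \<phi> by (auto simp: const0_def fun_eq_iff la_simps)
    moreover have "ins b (d 0 (ins a (lift1 \<phi>))) = 0"
      unfolding ins_d_const0 ins_lift1 const0_Nil using \<phi> ra_N0 by (simp add: const0_zero)
    ultimately show "ins b (th a (lift1 \<phi>)) = ins b (d 0 (ins a (lift1 \<phi>)))" by (simp only:)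
  qed
  then have "ins a (d (Suc 0) (lift1 \<phi>)) = 0" unfolding ins_d[OF f] by simp
  then show "ins a (d (Suc 0) (lift1 \<phi>)) = ins a 0" unfolding ins_simps .
qed (simp add: d_Nil)

text \<open>For an invariant cocycle \<open>h\<close>, \<open>th x h = 0\<close> is equivariance of
  its values, and Cartan's formula then gives \<open>d 0 (ins x h) = 0\<close>: right multiplication
  kills the values. Hence \<open>\<phi> (x y) = x \<phi>(y)\<close> equals
  \<open>x \<phi>(y) + \<phi>(y) x\<close>, an element of \<open>N0\<close>, and
  \<open>L = LL\<close> covers all arguments.\<close>

lemma cocycle1_decomposition:
  assumes f: "f \<in> C (Suc 0)" "d (Suc 0) f = 0"
  shows "\<exists>\<phi>\<in>HomN. f - lift1 \<phi> \<in> d 0 ` C 0"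
proof -
  obtain g where g: "g \<in> C 0" "d (Suc 0) (d 0 g) = 0" "\<And>x. th x (f - d 0 g) = 0"
    using cocycle_invariant[OF f] by blast
  define h where "h = f - d 0 g"
  have h: "h \<in> C (Suc 0)" unfolding h_def by (intro F.subspace_diff[OF sC] f d_cochain g)
  have dh: "d (Suc 0) h = 0" unfolding h_def d_simps f(2) g(2) by simp
  have thh: "th x h = 0" for x using g(3) unfolding h_def .
  define \<phi> where "\<phi> = (\<lambda>a. h [a])"
  have lift: "lift1 \<phi> = h" unfolding lift1_eq_iff[OF h] \<phi>_def by simp
  have lin: "\<phi> (a + b) = \<phi> a + \<phi> b" "\<phi> (sL c a) = sM c (\<phi> a)" for a b c
    using fun_cong[OF ins_add_arg[OF h, of a b], of "[]"] fun_cong[OF ins_scale_arg[OF h, of c a], of "[]"]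
    by (simp_all add: ins_apply \<phi>_def)
  have equiv: "\<phi> (x \<bullet> y) = la x (\<phi> y)" for x y
    using fun_cong[OF thh[of x], of "[y]"] by (simp add: th_def \<phi>_def)
  have ra0: "ra (\<phi> x) y = 0" for x y
  proof -
    have "d 0 (ins x h) = 0" using cocycle_th[OF h dh, of x] thh by simp
    then show ?thesis unfolding d0_zero_iff by (simp add: ins_apply \<phi>_def)
  qed
  have N0: "\<phi> a \<in> N0" for a
  proof -
    have "a \<in> prods UNIV" using perfect by simp
    then show ?thesis unfolding prods_def
    proof (induction rule: span_induct_alt)
      case base
      then show ?case using lin(2)[of 0 0] M.subspace_0[OF sN0] by simp
    next
      case (step c u v)
      then obtain x y where u: "u = x \<bullet> y" by auto
      have "\<phi> u \<in> N0" unfolding u equiv using sym_in_N0[of x "\<phi> y"] by (simp add: ra0)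
      then show ?case unfolding lin using step(2) by (intro M.subspace_add[OF sN0] M.subspace_scale[OF sN0])
    qed
  qed
  have "\<phi> \<in> HomN" using lin N0 equiv by (auto simp: linear_LM)
  moreover have "f - lift1 \<phi> \<in> d 0 ` C 0" unfolding lift h_def using g(1) by simp
  ultimately show ?thesis by blast
qed

section \<open>Cohomology spaces as explicit cosets, and vanishing\<close>

abbreviation "cobs \<equiv> coboundaries sL mult sM la ra"
abbreviation "cocyc \<equiv> cocycle_vs sL mult sM la ra"
abbreviation "HLn \<equiv> HL sL mult sM la ra"
abbreviation "MI \<equiv> Msym_inv_vs sM la ra"
abbreviation "HomV \<equiv> HomL_vs sL mult sM la ra"

lemma cocycles_eq: "cocycles sL mult sM la ra n = {f \<in> C n. d n f = 0}"
  unfolding cocycles_def by (simp add: zero_fun_def)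

lemma cocycle_vs_ops:
  "vadd (cocyc n) = (+)" "vzero (cocyc n) = 0"
  "vscale (cocyc n) = fsc" "vcarrier (cocyc n) = {f \<in> C n. d n f = 0}"
  unfolding cocycle_vs_def by (auto simp: plus_fun_def zero_fun_def fun_eq_iff cocycles_eq)

lemma sB': "F.subspace (cobs n)"
proof (cases n)
  case 0
  have "{\<lambda>xs :: 'l list. 0 :: 'm} = {0}" by (simp add: zero_fun_def)
  then show ?thesis unfolding 0 using F.subspace_single_0 by (simp only: coboundaries.simps)
qed (simp add: sB)

lemma HL_trivial:
  assumes "\<And>f. f \<in> C (Suc n) \<Longrightarrow> d (Suc n) f = 0 \<Longrightarrow> f \<in> d n ` C n"
  shows "trivial_vs (HLn (Suc n))"
  unfolding HL_def
proof (rule F.trivial_quot[OF cocycle_vs_ops(1-3) sB'])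
  show "0 \<in> vcarrier (cocyc (Suc n))"
    unfolding cocycle_vs_ops using F.subspace_0[OF sZ] .
  show "vcarrier (cocyc (Suc n)) \<subseteq> cobs (Suc n)"
    unfolding cocycle_vs_ops using assms by auto
qed

lemma HL_higher_trivial: "2 \<le> n \<Longrightarrow> trivial_vs (HLn n)"
proof -
  assume "2 \<le> n"
  then obtain k where "n = Suc (Suc k)" by (metis add_2_eq_Suc le_Suc_ex)
  then show ?thesis using HL_trivial[OF cocycle_coboundary] by simp
qed

lemma HL1_symmetric_trivial:
  assumes "symmetric_bimod la ra"
  shows "trivial_vs (HLn (Suc 0))"
proof (rule HL_trivial)
  fix f assume f: "f \<in> C (Suc 0)" "d (Suc 0) f = 0"
  have "{la x m + ra m x |x m. True} \<subseteq> {0}" using assms unfolding symmetric_bimod_def by auto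
  then have N0: "N0 \<subseteq> {0}" unfolding M0_def by (intro M.span_minimal) auto
  obtain \<phi> where \<phi>: "\<phi> \<in> HomN" "f - lift1 \<phi> \<in> d 0 ` C 0" using cocycle1_decomposition[OF f] by blast
  have "\<phi> x = 0" for x using \<phi>(1) N0 by auto
  then have "lift1 \<phi> = 0" by (auto simp: lift1_def fun_eq_iff)
  then show "f \<in> d 0 ` C 0" using \<phi>(2) by simp
qed

abbreviation "cosN \<equiv> M.cs N0"
abbreviation "B1 \<equiv> d 0 ` C 0"

lemma sub_vs_ops:
  "vadd (sub_vs sM U) = (+)" "vzero (sub_vs sM U) = 0" "vscale (sub_vs sM U) = sM" "vcarrier (sub_vs sM U) = U"
  unfolding sub_vs_def by auto

lemmas Msym_quot = M.quot_carrier[OF sub_vs_ops(1-3) sN0] M.quot_zero[OF sub_vs_ops(1-3) sN0]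
  M.quot_add[OF sub_vs_ops(1-3) sN0] M.quot_scale[OF sub_vs_ops(1-3) sN0]

lemma Msym_inv_ops:
  "vzero MI = cosN 0"
  "vadd MI (cosN v) (cosN w) = cosN (v + w)"
  "vscale MI c (cosN v) = cosN (sM c v)"
  unfolding Msym_inv_vs_def Msym_vs_def by (simp_all add: Msym_quot)

text \<open>Invariance is tested on a representative chosen by \<open>SOME\<close>; any other gives
  the same answer, as \<open>N0\<close> is stable under the left action.\<close>

lemma Msym_inv_carrier:
  "vcarrier MI = {cosN m | m. \<forall>x. la x m \<in> N0}"
proof -
  have "coset (sub_vs sM UNIV) N0 (la x (SOME w. w \<in> cosN m)) = N0 \<longleftrightarrow> la x m \<in> N0" for m x
  proof -
    let ?w = "SOME w. w \<in> cosN m"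
    have "la x (?w - m) \<in> N0" by (intro la_N0 M.cs_some[OF sN0])
    then have diff: "la x ?w - la x m \<in> N0" by (simp add: la_simps)
    have "coset (sub_vs sM UNIV) N0 (la x ?w) = cosN (la x ?w)"
      by (rule M.coset_cs[OF sub_vs_ops(1-3) sN0])
    also have "\<dots> = cosN (la x m)" using diff M.cs_eq_iff[OF sN0] by simp
    finally have "coset (sub_vs sM UNIV) N0 (la x ?w) = N0 \<longleftrightarrow> cosN (la x m) = cosN 0"
      by (simp only: M.cs_zero)
    then show "coset (sub_vs sM UNIV) N0 (la x ?w) = N0 \<longleftrightarrow> la x m \<in> N0"
      by (simp only: M.cs_eq_iff[OF sN0] diff_zero)
  qed
  then show ?thesis
    unfolding Msym_inv_vs_def Msym_vs_def by (auto simp: Msym_quot sub_vs_ops)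
qed

lemmas HL_quot = F.quot_carrier[OF cocycle_vs_ops(1-3) sB'] F.quot_zero[OF cocycle_vs_ops(1-3) sB']
  F.quot_add[OF cocycle_vs_ops(1-3) sB'] F.quot_scale[OF cocycle_vs_ops(1-3) sB']

abbreviation "cos0 \<equiv> F.cs {0}"

lemma coboundaries_0: "cobs 0 = {0}"
  by (simp add: zero_fun_def)

lemma coboundaries_1: "cobs 1 = B1"
  by simp

text \<open>Zero is the only coboundary in degree 0, so classes are cosets of \<open>{0}\<close>;
  the cocycles are the constants annihilated from the right.\<close>

lemma HL0_ops:
  "vcarrier (HLn 0) = {cos0 (const0 m) | m. \<forall>a. ra m a = 0}"
  "vzero (HLn 0) = cos0 0"
  "vadd (HLn 0) (cos0 f) (cos0 g) = cos0 (f + g)"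
  "vscale (HLn 0) c (cos0 f) = cos0 (fsc c f)"
proof -
  have car: "vcarrier (HLn 0) = {cos0 f | f. f \<in> {f \<in> C 0. \<forall>a. ra (f []) a = 0}}"
    using HL_quot(1)[of 0 0] unfolding HL_def cocycle_vs_ops coboundaries_0 d0_zero_iff .
  show "vcarrier (HLn 0) = {cos0 (const0 m) | m. \<forall>a. ra m a = 0}"
    unfolding car
  proof (intro equalityI subsetI)
    fix A assume "A \<in> {cos0 f |f. f \<in> {f \<in> C 0. \<forall>a. ra (f []) a = 0}}"
    then obtain f where f: "A = cos0 f" "f \<in> C 0" "\<forall>a. ra (f []) a = 0" by blast
    have "A = cos0 (const0 (f []))" unfolding const0_eq[OF f(2)] by (rule f(1))
    then show "A \<in> {cos0 (const0 m) |m. \<forall>a. ra m a = 0}" using f(3) by blast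
  next
    fix A assume "A \<in> {cos0 (const0 m) |m. \<forall>a. ra m a = 0}"
    then obtain m where m: "A = cos0 (const0 m)" "\<forall>a. ra m a = 0" by blast
    have "const0 m \<in> {f \<in> C 0. \<forall>a. ra (f []) a = 0}"
      using m(2) const0_cochain by (simp add: const0_Nil)
    then show "A \<in> {cos0 f |f. f \<in> {f \<in> C 0. \<forall>a. ra (f []) a = 0}}" using m(1) by blast
  qed
  show "vzero (HLn 0) = cos0 0"
    using HL_quot(2)[of 0 0] unfolding HL_def coboundaries_0 .
  show "vadd (HLn 0) (cos0 f) (cos0 g) = cos0 (f + g)"
    using HL_quot(3)[of 0 0 f g] unfolding HL_def coboundaries_0 .
  show "vscale (HLn 0) c (cos0 f) = cos0 (fsc c f)"
    using HL_quot(4)[of 0 0 c f] unfolding HL_def coboundaries_0 .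
qed

lemma HL1_ops:
  "vcarrier (HLn 1) = {F.cs B1 f | f. f \<in> C (Suc 0) \<and> d (Suc 0) f = 0}"
  "vzero (HLn 1) = F.cs B1 0"
  "vadd (HLn 1) (F.cs B1 f) (F.cs B1 g) = F.cs B1 (f + g)"
  "vscale (HLn 1) c (F.cs B1 f) = F.cs B1 (fsc c f)"
proof -
  show "vcarrier (HLn 1) = {F.cs B1 f | f. f \<in> C (Suc 0) \<and> d (Suc 0) f = 0}"
    using HL_quot(1)[of 1 1] unfolding HL_def cocycle_vs_ops coboundaries_1 by simp
  show "vzero (HLn 1) = F.cs B1 0"
    using HL_quot(2)[of 1 1] unfolding HL_def coboundaries_1 .
  show "vadd (HLn 1) (F.cs B1 f) (F.cs B1 g) = F.cs B1 (f + g)"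
    using HL_quot(3)[of 1 1 f g] unfolding HL_def coboundaries_1 .
  show "vscale (HLn 1) c (F.cs B1 f) = F.cs B1 (fsc c f)"
    using HL_quot(4)[of 1 1 c f] unfolding HL_def coboundaries_1 .
qed

lemma HomL_ops:
  "vcarrier HomV = HomN"
  "vzero HomV = (\<lambda>x. 0)"
  "vadd HomV = (\<lambda>\<phi> \<psi> x. \<phi> x + \<psi> x)"
  "vscale HomV = (\<lambda>c \<phi> x. sM c (\<phi> x))"
  unfolding HomL_vs_def by simp_all

section \<open>The maps of the five-term sequence\<close>

abbreviation "MIset \<equiv> {cosN m |m. \<forall>x. la x m \<in> N0}"
abbreviation "H0set \<equiv> {cos0 (const0 m) |m. \<forall>a. ra m a = 0}"

definition "incl_map m = cos0 (const0 m)"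
definition "proj_map A = cosN ((SOME f. f \<in> A) [])"
text \<open>The connecting map takes the class of \<open>m\<close> to \<open>ra m\<close>, up to
  sign the coboundary of the constant \<open>m\<close>. It depends on the class only, because
  \<open>N0\<close> is killed from the right.\<close>

definition "conn_map D = ra (SOME m. m \<in> D)"
definition "class_map \<phi> = F.cs B1 (lift1 \<phi>)"

lemma proj_map_cos0: "proj_map (cos0 f) = cosN (f [])"
proof -
  have "(SOME g. g \<in> cos0 f) - f \<in> {0}" by (rule F.cs_some[OF F.subspace_single_0])
  then have "(SOME g. g \<in> cos0 f) = f" by (simp only: singleton_iff eq_iff_diff_eq_0[symmetric])
  then show ?thesis unfolding proj_map_def by simp
qed

lemma conn_map_cosN: "conn_map (cosN m) = ra m"
proof
  fix x
  have "ra ((SOME w. w \<in> cosN m) - m) x = 0" by (intro ra_N0 M.cs_some[OF sN0])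
  then show "conn_map (cosN m) x = ra m x" unfolding conn_map_def by (simp add: ra_simps)
qed

text \<open>If \<open>la x m\<close> lies in \<open>N0\<close>, so does \<open>ra m x\<close>, since
  their sum does. Moreover \<open>ra (la x m) y = 0\<close> turns the bimodule identity
  \<open>ra_la\<close> into equivariance.\<close>

lemma conn_map_in:
  assumes "\<And>x. la x m \<in> N0"
  shows "ra m \<in> HomN"
proof -
  have "ra m x \<in> N0" for x
    using M.subspace_diff[OF sN0 sym_in_N0[of x m] assms[of x]] by simp
  moreover have "ra m (x \<bullet> y) = la x (ra m y)" for x y
    using ra_la[of x m y] ra_N0[OF assms[of x], of y] by simp
  ultimately show ?thesis using linear_ra by blast
qed

lemma lin_incl_map: "lin_map (M0_vs sM la ra) (HLn 0) incl_map"
  unfolding lin_map_def M0_vs_def sub_vs_ops incl_map_def HL0_ops const0_add const0_scale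
  using ra_N0 by auto

lemma lin_proj_map: "lin_map (HLn 0) MI proj_map"
  unfolding lin_map_def
proof (intro conjI ballI allI)
  fix A c assume "A \<in> vcarrier (HLn 0)"
  then obtain m where A: "A = cos0 (const0 m)" and m: "\<And>a. ra m a = 0" unfolding HL0_ops by auto
  have "la x m \<in> N0" for x using sym_in_N0[of x m] m by simp
  then show "proj_map A \<in> vcarrier MI"
    unfolding A proj_map_cos0 const0_Nil Msym_inv_carrier by auto
  show "proj_map (vscale (HLn 0) c A) = vscale MI c (proj_map A)"
    unfolding A HL0_ops proj_map_cos0 Msym_inv_ops ..
  fix B assume "B \<in> vcarrier (HLn 0)"
  then obtain n where B: "B = cos0 (const0 n)" unfolding HL0_ops by auto
  show "proj_map (vadd (HLn 0) A B) = vadd MI (proj_map A) (proj_map B)"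
    unfolding A B HL0_ops proj_map_cos0 Msym_inv_ops by simp
qed

lemma lin_conn_map: "lin_map MI HomV conn_map"
  unfolding lin_map_def
proof (intro conjI ballI allI)
  fix A c assume "A \<in> vcarrier MI"
  then obtain m where A: "A = cosN m" and m: "\<And>x. la x m \<in> N0" unfolding Msym_inv_carrier by auto
  show "conn_map A \<in> vcarrier HomV"
    unfolding A conn_map_cosN HomL_ops by (rule conn_map_in[OF m])
  show "conn_map (vscale MI c A) = vscale HomV c (conn_map A)"
    unfolding A Msym_inv_ops conn_map_cosN HomL_ops by (simp add: fun_eq_iff ra_simps)
  fix B assume "B \<in> vcarrier MI"
  then obtain n where B: "B = cosN n" unfolding Msym_inv_carrier by auto
  show "conn_map (vadd MI A B) = vadd HomV (conn_map A) (conn_map B)"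
    unfolding A B Msym_inv_ops conn_map_cosN HomL_ops by (simp add: fun_eq_iff ra_simps)
qed

lemma lin_class_map: "lin_map HomV (HLn 1) class_map"
  unfolding lin_map_def HomL_ops
proof (intro conjI ballI allI)
  fix \<phi> \<psi> :: "'l \<Rightarrow> 'm" and c assume \<phi>: "\<phi> \<in> HomN"
  then show "class_map \<phi> \<in> vcarrier (HLn 1)"
    unfolding class_map_def HL1_ops using lift1_cocycle[OF \<phi>] lift1_cochain by blast
  have "lift1 (\<lambda>x. sM c (\<phi> x)) = fsc c (lift1 \<phi>)" by (auto simp: lift1_def fun_eq_iff)
  then show "class_map (\<lambda>x. sM c (\<phi> x)) = vscale (HLn 1) c (class_map \<phi>)"
    unfolding class_map_def HL1_ops by simp
  have "lift1 (\<lambda>x. \<phi> x + \<psi> x) = lift1 \<phi> + lift1 \<psi>" by (auto simp: lift1_def fun_eq_iff)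
  then show "class_map (\<lambda>x. \<phi> x + \<psi> x) = vadd (HLn 1) (class_map \<phi>) (class_map \<psi>)"
    unfolding class_map_def HL1_ops by simp
qed

lemma cosN_eq_zero: "cosN m = cosN 0 \<longleftrightarrow> m \<in> N0"
  by (simp add: M.cs_eq_iff[OF sN0])

lemma cos0_eq_zero: "cos0 f = cos0 0 \<longleftrightarrow> f = 0"
  by (simp only: F.cs_eq_iff[OF F.subspace_single_0] diff_zero singleton_iff)

lemma exact_sequence:
  "exact5 (M0_vs sM la ra) (HLn 0) MI
    HomV (HLn 1) incl_map proj_map conn_map class_map"
  unfolding exact5_def
proof (intro conjI lin_incl_map lin_proj_map lin_conn_map lin_class_map)
  have "const0 m = 0 \<longleftrightarrow> m = 0" for m by (metis const0_Nil const0_zero zero_fun_apply)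
  then show "{a \<in> vcarrier (M0_vs sM la ra). incl_map a = vzero (HLn 0)} = {vzero (M0_vs sM la ra)}"
    unfolding M0_vs_def sub_vs_ops incl_map_def HL0_ops cos0_eq_zero using M.subspace_0[OF sN0] by auto
  show "exact_at (M0_vs sM la ra) (HLn 0) MI incl_map proj_map"
    unfolding exact_at_def M0_vs_def sub_vs_ops HL0_ops Msym_inv_ops
  proof (intro equalityI subsetI)
    fix A assume "A \<in> incl_map ` N0"
    then obtain m where A: "A = cos0 (const0 m)" and m: "m \<in> N0" unfolding incl_map_def by blast
    have "proj_map A = cosN 0" unfolding A proj_map_cos0 const0_Nil cosN_eq_zero by (rule m)
    then show "A \<in> {b \<in> H0set. proj_map b = cosN 0}"
      using A ra_N0[OF m] by blast
  next
    fix A assume "A \<in> {b \<in> H0set. proj_map b = cosN 0}"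
    then obtain m where A: "A = cos0 (const0 m)" and p: "proj_map A = cosN 0" by blast
    have "m \<in> N0" using p unfolding A proj_map_cos0 const0_Nil cosN_eq_zero .
    then show "A \<in> incl_map ` N0" using A unfolding incl_map_def by blast
  qed
  show "exact_at (HLn 0) MI HomV proj_map conn_map"
    unfolding exact_at_def HL0_ops Msym_inv_carrier HomL_ops
  proof (intro equalityI subsetI)
    fix D assume "D \<in> proj_map ` H0set"
    then obtain m where D: "D = cosN m" and m: "\<And>a. ra m a = 0" by (auto simp: proj_map_cos0 const0_Nil)
    have "la x m \<in> N0" for x using sym_in_N0[of x m] m by simp
    then show "D \<in> {b \<in> MIset. conn_map b = (\<lambda>x. 0)}"
      using m by (auto simp: D conn_map_cosN fun_eq_iff)
  next
    fix D assume "D \<in> {b \<in> MIset. conn_map b = (\<lambda>x. 0)}"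
    then obtain m where D: "D = cosN m" and m: "\<And>a. ra m a = 0" by (auto simp: conn_map_cosN fun_eq_iff)
    have "proj_map (cos0 (const0 m)) = D" unfolding D proj_map_cos0 const0_Nil ..
    then show "D \<in> proj_map ` H0set" using m by blast
  qed
  show "exact_at MI HomV (HLn 1) conn_map class_map"
    unfolding exact_at_def HL1_ops Msym_inv_carrier HomL_ops
  proof (intro equalityI subsetI)
    fix \<phi> assume "\<phi> \<in> conn_map ` MIset"
    then obtain m where \<phi>: "\<phi> = ra m" and m: "\<And>x. la x m \<in> N0" by (auto simp: conn_map_cosN)
    \<comment> \<open>The sign compensates for the minus of the right action in
      \<open>d 0\<close>.\<close>
    have "lift1 \<phi> = d 0 (const0 (- m))"
    proof (rule fun_eq_ins)
      show "ins a (lift1 \<phi>) = ins a (d 0 (const0 (- m)))" for a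
        unfolding ins_lift1 ins_d_const0 const0_Nil \<phi> by (simp add: ra_minus)
    qed (simp add: d_Nil lift1_def)
    then have "lift1 \<phi> \<in> B1" using const0_cochain by blast
    then have "class_map \<phi> = F.cs B1 0" unfolding class_map_def F.cs_eq_iff[OF sB] by simp
    then show "\<phi> \<in> {b \<in> HomN. class_map b = F.cs B1 0}" using conn_map_in[OF m] unfolding \<phi> by blast
  next
    fix \<phi> assume "\<phi> \<in> {b \<in> HomN. class_map b = F.cs B1 0}"
    then have \<phi>: "\<phi> \<in> HomN" and "lift1 \<phi> \<in> B1" unfolding class_map_def F.cs_eq_iff[OF sB] by auto
    then obtain g where g: "lift1 \<phi> = d 0 g" by auto
    define m where "m = - g []"
    have ra: "\<phi> x = ra m x" for x
    proof -
      have "const0 (\<phi> x) = const0 (- ra (g []) x)" unfolding ins_lift1[symmetric] g ins_d_const0 ..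
      then have "\<phi> x = - ra (g []) x" by (metis const0_Nil)
      then show ?thesis unfolding m_def by (simp add: ra_minus)
    qed
    have "la x m \<in> N0" for x
    proof -
      have "ra m x \<in> N0" using \<phi> unfolding ra[of x, symmetric] by blast
      from M.subspace_diff[OF sN0 sym_in_N0[of x m] this] show ?thesis by simp
    qed
    moreover have "conn_map (cosN m) = \<phi>" unfolding conn_map_cosN using ra by (simp add: fun_eq_iff)
    ultimately show "\<phi> \<in> conn_map ` MIset" by blast
  qed
  show "class_map ` vcarrier HomV = vcarrier (HLn 1)"
  proof
    show "class_map ` vcarrier HomV \<subseteq> vcarrier (HLn 1)"
      using lin_class_map unfolding lin_map_def by blast
    show "vcarrier (HLn 1) \<subseteq> class_map ` vcarrier HomV"
    proof
      fix A assume "A \<in> vcarrier (HLn 1)"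
      then obtain f where A: "A = F.cs B1 f" and f: "f \<in> C (Suc 0)" "d (Suc 0) f = 0" unfolding HL1_ops by auto
      obtain \<phi> where \<phi>: "\<phi> \<in> HomN" "f - lift1 \<phi> \<in> B1" using cocycle1_decomposition[OF f] by blast
      then have "A = class_map \<phi>" unfolding A class_map_def F.cs_eq_iff[OF sB] by simp
      then show "A \<in> class_map ` vcarrier HomV" unfolding HomL_ops using \<phi>(1) by blast
    qed
  qed
qed

end

theorem theorem4p3:
  fixes sL :: "'f::field_char_0 \<Rightarrow> 'l::ab_group_add \<Rightarrow> 'l"
    and mult :: "'l \<Rightarrow> 'l \<Rightarrow> 'l"
    and sM :: "'f \<Rightarrow> 'm::ab_group_add \<Rightarrow> 'm"
    and la :: "'l \<Rightarrow> 'm \<Rightarrow> 'm"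
    and ra :: "'m \<Rightarrow> 'l \<Rightarrow> 'm"
  assumes "leibniz_algebra sL mult" and "fin_dim sL" and "semisimple sL mult"
    and "bimodule sL mult sM la ra" and "fin_dim sM"
  shows "(\<forall>n\<ge>2. trivial_vs (HL sL mult sM la ra n))
    \<and> (\<exists>f1 f2 f3 f4. exact5 (M0_vs sM la ra) (HL sL mult sM la ra 0) (Msym_inv_vs sM la ra)
          (HomL_vs sL mult sM la ra) (HL sL mult sM la ra 1) f1 f2 f3 f4)
    \<and> (symmetric_bimod la ra \<longrightarrow> (\<forall>n\<ge>1. trivial_vs (HL sL mult sM la ra n)))"
proof -
  have vL: "vspace_0 sL" and vM: "vspace_0 sM"
    using assms(1,5) unfolding leibniz_algebra_def fin_dim_def
    by (simp_all add: vspace_0_def vspace_def)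
  interpret leibniz_bimodule sL mult sM la ra
    by (intro leibniz_bimodule.intro leibniz_bimodule_axioms.intro
        semisimple_leibniz.intro semisimple_leibniz_axioms.intro vL vM assms)
  have "trivial_vs (HL sL mult sM la ra n)" if "symmetric_bimod la ra" "1 \<le> n" for n
  proof (cases "n = 1")
    case True
    then show ?thesis using HL1_symmetric_trivial[OF that(1)] by simp
  next
    case False
    then show ?thesis using HL_higher_trivial that(2) by simp
  qed
  then show ?thesis using HL_higher_trivial exact_sequence by blast
qed

end
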